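(* Let $a\in(-1,0)$. There exists a unique $\zeta_a\in\mathbb{R}$ such that $\beta_a=\mu_a(\zeta_a)$. Furthermore: (1) $\zeta_a<0$ and $\mu_a''(\zeta_a)>0$; (2) $|a|\Theta_0<\beta_a<\Theta_0$; (3) the positive $L^2$-normalized ground state $\phi_a:=\varphi_{a,\zeta_a}$ satisfies $\phi_a'(0)<0$.
   Context: For $a\in[-1,1)\setminus\{0\}$ let $\sigma(\tau)=1$ for $\tau>0$ and $\sigma(\tau)=a$ for $\tau<0$. Let $B^1(\mathbb{R})=\{u\in L^2(\mathbb{R}): u'\in L^2(\mathbb{R}),\ \tau u\in L^2(\mathbb{R})\}$. For $\xi\in\mathbb{R}$, $\mathfrak h_a[\xi]=-\frac{d^2}{d\tau^2}+(\xi+\sigma(\tau)\tau)^2$ is the self-adjoint operator on $L^2(\mathbb{R})$ associated with the quadratic form $q_a[\xi](u)=\int_{\mathbb{R}}\big(|u'|^2+(\xi+\sigma(\tau)\tau)^2|u|^2\big)d\tau$ on $B^1(\mathbb{R})$; it has compact resolvent. Its lowest eigenvalue is $\mu_a(\xi)=\inf_{u\in B^1(\mathbb{R})\setminus\{0\}} q_a[\xi](u)/\|u\|^2_{L^2(\mathbb{R})}$; it is simple, and $\varphi_{a,\xi}$ denotes the unique positive $L^2$-normalized eigenfunction. The maps $\xi\mapsto\mu_a(\xi)$ and $\xi\mapsto\varphi_{a,\xi}$ are $C^\infty$. Set $\beta_a=\inf_{\xi\in\mathbb{R}}\mu_a(\xi)$. The de Gennes constant $\Theta_0$ is $\inf_{\xi\in\mathbb{R}}\lambda^N(\xi)$,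 where $\lambda^N(\xi)$ is the lowest eigenvalue of the Neumann realization of $-\frac{d^2}{d\tau^2}+(\tau+\xi)^2$ on $L^2(\mathbb{R}_+)$ (equivalently $\Theta_0=\beta_{-1}$). *)

theory Defs
  imports "HOL-Analysis.Analysis"
begin

text \<open>Piecewise constant coefficient: sigma a t = 1 for t > 0, = a for t < 0
  (the value at t = 0 is irrelevant, it is a null set).\<close>
definition sigma :: "real \<Rightarrow> real \<Rightarrow> real" where
  "sigma a t = (if t > 0 then 1 else a)"

definition sq_int_on :: "real set \<Rightarrow> (real \<Rightarrow> real) \<Rightarrow> bool" where
  "sq_int_on S f \<longleftrightarrow> set_borel_measurable lborel S f \<and> set_integrable lborel S (\<lambda>t. (f t)^2)"

text \<open>g is the weak derivative of u on the interval I, u being its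
  (locally absolutely continuous) representative.\<close>
definition weak_deriv_on :: "real set \<Rightarrow> (real \<Rightarrow> real) \<Rightarrow> (real \<Rightarrow> real) \<Rightarrow> bool" where
  "weak_deriv_on I u g \<longleftrightarrow>
     (\<forall>x\<in>I. \<forall>y\<in>I. x \<le> y \<longrightarrow>
        set_integrable lborel {x..y} g \<and> u y - u x = (LINT t:{x..y}|lborel. g t))"

definition in_B1 :: "(real \<Rightarrow> real) \<Rightarrow> (real \<Rightarrow> real) \<Rightarrow> bool" where
  "in_B1 u g \<longleftrightarrow> sq_int_on UNIV u \<and> sq_int_on UNIV g \<and> sq_int_on UNIV (\<lambda>t. t * u t)
                 \<and> weak_deriv_on UNIV u g"

definition qform :: "real \<Rightarrow> real \<Rightarrow> (real \<Rightarrow> real) \<Rightarrow> (real \<Rightarrow> real) \<Rightarrow> real" where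
  "qform a \<xi> u g = (LINT t|lborel. (g t)^2 + (\<xi> + sigma a t * t)^2 * (u t)^2)"

definition L2sq :: "(real \<Rightarrow> real) \<Rightarrow> real" where
  "L2sq u = (LINT t|lborel. (u t)^2)"

text \<open>Lowest eigenvalue mu_a(xi): infimum of the Rayleigh quotient over B^1(R).\<close>
definition mu :: "real \<Rightarrow> real \<Rightarrow> real" where
  "mu a \<xi> = Inf {qform a \<xi> u g / L2sq u | u g. in_B1 u g \<and> L2sq u \<noteq> 0}"

definition beta :: "real \<Rightarrow> real" where
  "beta a = (INF \<xi>. mu a \<xi>)"

text \<open>u is a positive L^2-normalized eigenfunction of h_a[xi] (the operator
  associated with the form q_a[xi]) for the eigenvalue mu_a(xi):
  u lies in the form domain and q_a[xi](u,v) = mu_a(xi) <u,v> for all v in the form domain.\<close>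
definition is_ground_state :: "real \<Rightarrow> real \<Rightarrow> (real \<Rightarrow> real) \<Rightarrow> bool" where
  "is_ground_state a \<xi> u \<longleftrightarrow>
     (\<exists>g. in_B1 u g \<and> (\<forall>t. u t > 0) \<and> L2sq u = 1 \<and>
        (\<forall>v h. in_B1 v h \<longrightarrow>
           (LINT t|lborel. g t * h t + (\<xi> + sigma a t * t)^2 * u t * v t)
             = mu a \<xi> * (LINT t|lborel. u t * v t)))"

definition phi :: "real \<Rightarrow> real \<Rightarrow> (real \<Rightarrow> real)" where
  "phi a \<xi> = (THE u. is_ground_state a \<xi> u)"

text \<open>Neumann problem on R_+: lowest eigenvalue as infimum of the Rayleigh quotient
  of the Neumann form (form domain without boundary condition).\<close>
definition in_H1_pos :: "(real \<Rightarrow> real) \<Rightarrow> (real \<Rightarrow> real) \<Rightarrow> bool" where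
  "in_H1_pos u g \<longleftrightarrow> sq_int_on {0<..} u \<and> sq_int_on {0<..} g \<and> sq_int_on {0<..} (\<lambda>t. t * u t)
                     \<and> weak_deriv_on {0<..} u g"

definition lambdaN :: "real \<Rightarrow> real" where
  "lambdaN \<xi> = Inf {(LINT t:{0<..}|lborel. (g t)^2 + (t + \<xi>)^2 * (u t)^2)
                       / (LINT t:{0<..}|lborel. (u t)^2)
                    | u g. in_H1_pos u g \<and> (LINT t:{0<..}|lborel. (u t)^2) \<noteq> 0}"

definition Theta0 :: real where
  "Theta0 = (INF \<xi>. lambdaN \<xi>)"

end

theory Submission
  imports Defs "HOL-Real_Asymp.Real_Asymp"
begin

text \<open>
  Put $a = -k^2$. For $\lambda < 1$ the equation $-F'' + x^2 F = \lambda F$ has the explicit positive solution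
  $F_\lambda(x) = e^{-x^2/2} \int_0^\infty t^{s-1} e^{-2xt-t^2}\,dt$, $s = (1-\lambda)/2$, decaying at $+\infty$. Its
  logarithmic derivative $M_\lambda$ solves $M' = x^2 - \lambda - M^2$, and Picone's identity gives
  $\int_0^\infty v'^2 + ((t+\xi)^2 - \lambda) v^2 \ge -M_\lambda(\xi)\, v(0)^2$ with equality at $F_\lambda(\cdot+\xi)$.
  Splitting the line at the origin and rescaling the left half by $k$, one finds for $\lambda < k^2$ that
  $\mu(\xi)$ lies below, at or above $\lambda$ according to the sign of
  $G(\lambda,\xi) = M_\lambda(\xi) + k M_{\lambda/k^2}(\xi/k)$. No compactness argument is needed: if
  $\mu(\xi) < k^2$, then two profiles $F$ glued at the origin form the ground state.

  Since $\mu(\xi) - \xi^2$ is an infimum of affine functions, $\mu$ is continuous. Its values drop below $k^2$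
  somewhere and stay above such a value outside a compact interval, so the minimum is attained. There
  $M^2 + \beta - \zeta^2 = 0$ with $M = M_\beta(\zeta)$. The function $(M_\beta^2 + \beta - x^2) F_\beta^2$ has derivative
  $-2x F_\beta^2$ and vanishes at $+\infty$, hence it has at most one zero, and that zero is negative. Differentiating
  $\mu' = (1 + 1/k^2)(M^2 + \mu - \xi^2)\,\varphi(0)^2$ at $\zeta$, where $M$ is stationary, gives $\mu'' > 0$.

  For $\beta < \Theta_0$, the Neumann profile with $x^2 \le \lambda$ is used on both sides, rescaled by $k$ on the left.
  Then $\beta < \Theta_0$ forces $M_\beta(\zeta) < 0$, which is the sign of $\phi'(0)$, and the matching condition makes the slope
  on the left half positive, which yields $\beta > k^2 \Theta_0$.
\<close>

section \<open>The integrals $J_s(x)$\<close>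

text \<open>\<open>Theta0\<close> and \<open>mu\<close> are bare infima of Rayleigh quotients, so
  minimisers and regularity in \<xi> must come out of explicit functions. F is, up to a constant,
  the parabolic cylinder function D_nu (sqrt 2 x) with nu = (l - 1)/2; its integral converges
  exactly for l < 1, and on the left half, where the parameter is l/k^2, this becomes l < k^2. The
  dip of mu below k^2 is therefore crucial: as l rises to k^2, the left slope tends to that of a
  Gaussian and G becomes positive at a suitable \<xi>. For derivatives, testing the form at \<xi>'
  with the ground state at \<xi> bounds mu(\<xi>') by a quadratic polynomial, and exchanging the two
  points gives the matching lower bound. For the strict bound by Theta0, suppose Theta0 <= beta.
  Then every l slightly above beta has a Neumann profile with x^2 <= l, and gluing yields beta (1 +
  k) <= l (1 - k + 2 k^2). Since 1 - k + 2 k^2 < 1 + k for 0 < k < 1 and beta > 0, letting l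
  decrease to beta is contradictory.\<close>

lemma set_integral_FTC_halfline:
  fixes F f :: "real \<Rightarrow> real"
  assumes F: "\<And>x. x > 0 \<Longrightarrow> (F has_real_derivative f x) (at x)"
    and f: "\<And>x. x > 0 \<Longrightarrow> isCont f x"
    and int: "set_integrable lborel {0<..} f"
    and A: "(F \<longlongrightarrow> A) (at_right 0)" and B: "(F \<longlongrightarrow> B) at_top"
  shows "(LINT t:{0<..}|lborel. f t) = B - A"
proof -
  have E: "einterval 0 \<infinity> = {0<..}" by (auto simp: einterval_def)
  have "(LBINT x=0..\<infinity>. f x) = B - A"
  proof (rule interval_integral_FTC_integrable[where F=F])
    show "\<And>x. 0 < ereal x \<Longrightarrow> ereal x < \<infinity> \<Longrightarrow> (F has_vector_derivative f x) (at x)"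
      using F by (simp add: has_real_derivative_iff_has_vector_derivative)
    show "((F \<circ> real_of_ereal) \<longlongrightarrow> A) (at_right 0)"
      using A unfolding zero_ereal_def by (simp add: ereal_tendsto_simps)
    show "((F \<circ> real_of_ereal) \<longlongrightarrow> B) (at_left \<infinity>)"
      using B by (simp add: ereal_tendsto_simps)
  qed (use f int E in auto)
  then show ?thesis by (simp add: interval_lebesgue_integral_def E)
qed

lemma set_integrable_continuous_bound:
  fixes f g :: "real \<Rightarrow> real"
  assumes "set_integrable lborel {0<..} g" "continuous_on {0<..} f" "\<And>x. x > 0 \<Longrightarrow> \<bar>f x\<bar> \<le> g x"
  shows "set_integrable lborel {0<..} f"
proof (rule set_integrable_bound[OF assms(1)])
  show "set_borel_measurable lborel {0<..} f"
    unfolding set_borel_measurable_def real_scaleR_def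
    using borel_measurable_continuous_on_indicator[OF _ assms(2)] by simp
  show "AE x in lborel. x \<in> {0<..} \<longrightarrow> norm (f x) \<le> norm (g x)"
    using assms(3) by (intro AE_I2) (auto intro: order_trans[OF _ abs_ge_self])
qed

lemma set_integrable_powr_exp:
  assumes "s > (0::real)"
  shows "set_integrable lborel {0<..} (\<lambda>t. t powr (s - 1) * exp (- t))"
proof -
  let ?f = "\<lambda>t::real. t powr (s - 1) * exp (- t)"
  have "(?f has_integral Gamma s) {0..}"
    using Gamma_integral_real[OF assms] by (simp add: exp_minus field_simps)
  then have "?f absolutely_integrable_on {0..}"
    by (subst absolutely_integrable_on_iff_nonneg) auto
  then have "set_integrable lebesgue {0<..} ?f"
    by (rule set_integrable_subset) auto
  then show ?thesis
    unfolding set_integrable_def by (subst (asm) integrable_completion) auto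
qed

definition pcw :: "real \<Rightarrow> real \<Rightarrow> real \<Rightarrow> real" where
  "pcw s x t = t powr (s - 1) * exp (- (2 * x * t) - t\<^sup>2)"

definition pcJ :: "real \<Rightarrow> real \<Rightarrow> real" where
  "pcJ s x = (LINT t:{0<..}|lborel. pcw s x t)"

lemma pcw_pos: "t > 0 \<Longrightarrow> pcw s x t > 0"
  by (simp add: pcw_def)

lemma pcw_Suc: "t > 0 \<Longrightarrow> pcw (s + 1) x t = t * pcw s x t"
  by (simp add: pcw_def powr_diff)

lemma pcw_Suc2: "t > 0 \<Longrightarrow> pcw (s + 2) x t = t\<^sup>2 * pcw s x t"
  using pcw_Suc[of t s x] pcw_Suc[of t "s+1" x] by (simp add: power2_eq_square add.assoc)

lemma pcw_integrable:
  assumes "s > 0"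
  shows "set_integrable lborel {0<..} (pcw s x)"
proof (rule set_integrable_continuous_bound)
  \<comment> \<open>Completing the square: -2xt - t^2 exceeds -t by at most ((1 - 2x)/2)^2.\<close>
  let ?c = "exp (((1 - 2 * x) / 2)\<^sup>2)"
  show "set_integrable lborel {0<..} (\<lambda>t. ?c * (t powr (s - 1) * exp (- t)))"
    using set_integrable_powr_exp[OF assms] by (rule set_integrable_mult_right)
  fix t :: real assume t: "t > 0"
  have "- (2 * x * t) - t\<^sup>2 = ((1 - 2 * x) / 2)\<^sup>2 - t - (t - (1 - 2 * x) / 2)\<^sup>2"
    by (simp add: power2_eq_square field_simps)
  also have "\<dots> \<le> ((1 - 2 * x) / 2)\<^sup>2 + - t" by simp
  finally have "exp (- (2 * x * t) - t\<^sup>2) \<le> ?c * exp (- t)"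
    unfolding exp_add[symmetric] by simp
  then have "t powr (s - 1) * exp (- (2 * x * t) - t\<^sup>2) \<le> t powr (s - 1) * (?c * exp (- t))"
    by (rule mult_left_mono) simp
  then show "\<bar>pcw s x t\<bar> \<le> ?c * (t powr (s - 1) * exp (- t))"
    by (simp add: mult_ac pcw_def)
qed (unfold pcw_def, auto intro!: continuous_intros)

lemma set_integral_pos:
  fixes f :: "real \<Rightarrow> real"
  assumes "set_integrable lborel {0<..} f" "\<And>x. x > 0 \<Longrightarrow> f x > 0"
  shows "(LINT t:{0<..}|lborel. f t) > 0"
proof -
  have "(LINT t:{0<..}|lborel. f t) \<ge> 0"
    unfolding set_lebesgue_integral_def
    by (rule integral_nonneg_AE) (auto simp: indicator_def intro!: AE_I2 less_imp_le assms(2))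
  moreover have "(LINT t:{0<..}|lborel. f t) \<noteq> 0"
  proof
    assume "(LINT t:{0<..}|lborel. f t) = 0"
    then have "AE x in lborel. indicat_real {0<..} x *\<^sub>R f x = 0"
      using assms unfolding set_lebesgue_integral_def set_integrable_def
      by (subst (asm) integral_nonneg_eq_0_iff_AE)
        (auto simp: indicator_def intro!: AE_I2 less_imp_le)
    then have "AE x in lborel. x \<notin> {0<..(1::real)}"
      by (rule AE_mp) (use assms(2) in \<open>fastforce intro!: AE_I2 simp: indicator_def\<close>)
    moreover have "{x \<in> space lborel. \<not> x \<notin> {0<..(1::real)}} = {0<..1}" by auto
    ultimately have "emeasure lborel {0<..(1::real)} = 0"
      by (subst (asm) AE_iff_measurable[of "{0<..(1::real)}"]) auto
    then show False by simp
  qed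
  ultimately show ?thesis by simp
qed

lemma pcJ_pos: "s > 0 \<Longrightarrow> pcJ s x > 0"
  unfolding pcJ_def by (rule set_integral_pos[OF pcw_integrable pcw_pos])

lemma pcJ_Suc: "pcJ (s + 1) x = (LINT t:{0<..}|lborel. t * pcw s x t)"
  unfolding pcJ_def by (rule set_lebesgue_integral_cong) (auto simp: pcw_Suc)

lemma pcw_Suc_integrable: "s > 0 \<Longrightarrow> set_integrable lborel {0<..} (\<lambda>t. t * pcw s x t)"
  using pcw_integrable[of "s+1" x] set_integrable_cong[of lborel lborel "{0<..}" "{0<..}" "pcw (s+1) x" "\<lambda>t. t * pcw s x t"]
  by (simp add: pcw_Suc)

lemma pcJ_Suc2: "pcJ (s + 2) x = (LINT t:{0<..}|lborel. t\<^sup>2 * pcw s x t)"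
  unfolding pcJ_def by (rule set_lebesgue_integral_cong) (auto simp: pcw_Suc2)

lemma pcw_Suc2_integrable: "s > 0 \<Longrightarrow> set_integrable lborel {0<..} (\<lambda>t. t\<^sup>2 * pcw s x t)"
  using pcw_integrable[of "s+2" x] set_integrable_cong[of lborel lborel "{0<..}" "{0<..}" "pcw (s+2) x" "\<lambda>t. t\<^sup>2 * pcw s x t"]
  by (simp add: pcw_Suc2)

lemma pcJ_antimono: 
  assumes "s > 0" "x \<le> y"
  shows "pcJ s y \<le> pcJ s x"
  unfolding pcJ_def
proof (rule set_integral_mono)
  fix t :: real assume "t \<in> {0<..}"
  then show "pcw s y t \<le> pcw s x t" using assms by (auto simp: pcw_def intro!: mult_left_mono mult_right_mono)
qed (use assms in \<open>auto intro: pcw_integrable\<close>)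

lemma exp_quadratic_remainder:
  fixes u :: real
  shows "\<bar>exp u - 1 - u\<bar> \<le> u\<^sup>2 * exp \<bar>u\<bar>"
proof -
  have "\<exists>t. \<bar>t\<bar> \<le> \<bar>u\<bar> \<and> exp u = (\<Sum>m<2. u ^ m / fact m) + exp t / fact 2 * u ^ 2"
    using Maclaurin_exp_le[of u 2] by (metis (no_types, lifting))
  then obtain t where t: "\<bar>t\<bar> \<le> \<bar>u\<bar>" "exp u = (\<Sum>m<2. u ^ m / fact m) + exp t / fact 2 * u ^ 2" by blast
  have "exp u - 1 - u = exp t / 2 * u\<^sup>2" using t(2) by (simp add: eval_nat_numeral)
  then have "\<bar>exp u - 1 - u\<bar> = exp t / 2 * u\<^sup>2" by (simp only: abs_of_nonneg) simp
  also have "exp t / 2 \<le> exp \<bar>u\<bar>" 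
    using t(1) exp_le_cancel_iff[of t "\<bar>u\<bar>"] exp_gt_zero[of "\<bar>u\<bar>"] by linarith
  then have "exp t / 2 * u\<^sup>2 \<le> exp \<bar>u\<bar> * u\<^sup>2" 
    by (rule mult_right_mono) simp
  finally show ?thesis by (simp add: mult.commute)
qed

text \<open>A second-order Taylor remainder under the integral sign bounds the error of the
  difference quotient by a multiple of |h|.\<close>

lemma pcJ_deriv:
  assumes s: "s > 0"
  shows "(pcJ s has_real_derivative - 2 * pcJ (s + 1) x) (at x)"
proof -
  \<comment> \<open>The 4 and the shift to s + 2 come from (2ht)^2; shifting x by -1 absorbs the
    factor exp (2t), which dominates exp |2ht| for |h| <= 1.\<close>
  define C where "C = 4 * pcJ (s + 2) (x - 1)"
  have est: "\<bar>pcJ s (x + h) - pcJ s x + 2 * h * pcJ (s + 1) x\<bar> \<le> C * h\<^sup>2" if h: "\<bar>h\<bar> \<le> 1" for h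
  proof -
    let ?f = "\<lambda>t::real. pcw s (x + h) t - pcw s x t + 2 * h * (t * pcw s x t)"
    let ?g = "\<lambda>t::real. (4 * h\<^sup>2) * (t\<^sup>2 * pcw s (x - 1) t)"
    note i1 = pcw_integrable[OF s, of "x + h"] and i2 = pcw_integrable[OF s, of x]
      and i3 = set_integrable_mult_right[OF pcw_Suc_integrable[OF s, of x], of "2 * h"]
    have I: "set_integrable lborel {0<..} ?f"
      using s by (intro set_integral_add set_integral_diff set_integrable_mult_right pcw_integrable pcw_Suc_integrable)
    have eqf: "pcJ s (x + h) - pcJ s x + 2 * h * pcJ (s + 1) x = (LINT t:{0<..}|lborel. ?f t)"
      unfolding pcJ_Suc unfolding pcJ_def
      by (simp add: set_integral_add(2)[OF set_integral_diff(1)[OF i1 i2] i3] set_integral_diff(2)[OF i1 i2])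
    have eqg: "C * h\<^sup>2 = (LINT t:{0<..}|lborel. ?g t)"
      using s by (simp add: C_def pcJ_Suc2)
    have Ig: "set_integrable lborel {0<..} ?g"
      using s by (intro set_integrable_mult_right pcw_Suc2_integrable)
    have b: "\<bar>?f t\<bar> \<le> ?g t" if t: "t > 0" for t
    proof -
      have e: "pcw s (x + h) t = pcw s x t * exp (-2*h*t)"
        by (simp add: exp_add[symmetric] algebra_simps pcw_def)
      have "?f t = pcw s x t * (exp (-2*h*t) - 1 - (-2*h*t))" unfolding e by (simp add: algebra_simps)
      then have "\<bar>?f t\<bar> = pcw s x t * \<bar>exp (-2*h*t) - 1 - (-2*h*t)\<bar>" 
        using pcw_pos[OF t, of s x] by (simp add: abs_mult)
      also have "\<dots> \<le> pcw s x t * ((-2*h*t)\<^sup>2 * exp \<bar>-2*h*t\<bar>)"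
        using pcw_pos[OF t, of s x] by (intro mult_left_mono exp_quadratic_remainder) simp
      also have "\<dots> \<le> pcw s x t * ((-2*h*t)\<^sup>2 * exp (2 * t))"
        using h t pcw_pos[OF t, of s x] by (intro mult_left_mono) (auto simp: abs_mult mult_left_le_one_le)
      also have "\<dots> = ?g t"
      proof -
        have e2: "pcw s (x - 1) t = pcw s x t * exp (2*t)"
          by (simp add: exp_add[symmetric] algebra_simps pcw_def)
        show ?thesis unfolding e2 by (simp add: power2_eq_square)
      qed
      finally show ?thesis .
    qed
    have "(LINT t:{0<..}|lborel. ?f t) \<le> (LINT t:{0<..}|lborel. ?g t)"
      using I Ig by (rule set_integral_mono) (use b in \<open>auto simp: abs_le_iff\<close>)
    moreover have "(LINT t:{0<..}|lborel. - ?g t) \<le> (LINT t:{0<..}|lborel. ?f t)"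
    proof (rule set_integral_mono)
      show "set_integrable lborel {0<..} (\<lambda>t. - ?g t)" 
        using set_integrable_mult_right[of "-1", OF Ig] by simp
      fix t :: real assume "t \<in> {0<..}"
      then show "- ?g t \<le> ?f t" using b[of t] by (simp add: abs_le_iff)
    qed (rule I)
    ultimately show ?thesis unfolding eqf eqg set_integral_uminus[OF Ig] by linarith
  qed
  have "((\<lambda>h. (pcJ s (x + h) - pcJ s x) / h) \<longlongrightarrow> - 2 * pcJ (s + 1) x) (at 0)"
  proof (rule LIM_zero_cancel, rule Lim_null_comparison)
    show "\<forall>\<^sub>F h in at 0. norm ((pcJ s (x + h) - pcJ s x) / h - - 2 * pcJ (s + 1) x) \<le> C * \<bar>h\<bar>"
      unfolding eventually_at
    proof (intro exI[of _ 1] conjI ballI impI)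
      fix h :: real assume h: "h \<noteq> 0 \<and> dist h 0 < 1"
      then have "\<bar>pcJ s (x + h) - pcJ s x + 2 * h * pcJ (s + 1) x\<bar> / \<bar>h\<bar> \<le> C * h\<^sup>2 / \<bar>h\<bar>"
        by (intro divide_right_mono est) auto
      also have "C * h\<^sup>2 / \<bar>h\<bar> = C * \<bar>h\<bar>"
      proof -
        have "h\<^sup>2 = \<bar>h\<bar> * \<bar>h\<bar>" by (simp only: abs_mult_self_eq power2_eq_square)
        then have "C * h\<^sup>2 / \<bar>h\<bar> = C * (\<bar>h\<bar> * \<bar>h\<bar>) / \<bar>h\<bar>" by (rule arg_cong)
        also have "\<dots> = C * \<bar>h\<bar>" using h by (simp del: abs_mult_self_eq)
        finally show ?thesis .
      qed
      also have "\<bar>pcJ s (x + h) - pcJ s x + 2 * h * pcJ (s + 1) x\<bar> / \<bar>h\<bar> =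
          \<bar>(pcJ s (x + h) - pcJ s x + 2 * h * pcJ (s + 1) x) / h\<bar>"
        by (rule abs_divide[symmetric])
      also have "(pcJ s (x + h) - pcJ s x + 2 * h * pcJ (s + 1) x) / h = (pcJ s (x + h) - pcJ s x) / h - - 2 * pcJ (s + 1) x"
        using h by (simp add: add_divide_distrib)
      finally show "norm ((pcJ s (x + h) - pcJ s x) / h - - 2 * pcJ (s + 1) x) \<le> C * \<bar>h\<bar>" by simp
    qed simp
    show "((\<lambda>h. C * \<bar>h\<bar>) \<longlongrightarrow> 0) (at 0)" by (auto intro!: tendsto_eq_intros)
  qed
  then show ?thesis by (simp add: DERIV_def)
qed

text \<open>Integrate the derivative of t^s exp (-2xt - t^2) over the half-line; the boundary terms
  vanish because s > 0. This three-term recurrence carries the differential equation for F.\<close>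

lemma pcJ_rec:
  assumes s: "s > 0"
  shows "x * pcJ (s + 1) x + pcJ (s + 2) x = s / 2 * pcJ s x"
proof -
  let ?w = "pcw s x"
  let ?F = "pcw (s + 1) x"
  let ?f = "\<lambda>t. s * ?w t - (2 * x) * (t * ?w t) - 2 * (t\<^sup>2 * ?w t)"
  note i1 = set_integrable_mult_right[OF pcw_integrable[OF s, of x], of s]
    and i2 = set_integrable_mult_right[OF pcw_Suc_integrable[OF s, of x], of "2 * x"]
    and i3 = set_integrable_mult_right[OF pcw_Suc2_integrable[OF s, of x], of 2]
  have "(LINT t:{0<..}|lborel. ?f t) = 0 - 0"
  proof (rule set_integral_FTC_halfline[where F="?F"])
    fix t :: real assume t: "t > 0"
    then have ps: "t powr s = t * t powr (s - 1)" by (simp add: powr_diff)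
    have "((\<lambda>t. t powr s * exp (- (2 * x * t) - t\<^sup>2)) has_real_derivative
        s * t powr (s - 1) * exp (- (2 * x * t) - t\<^sup>2) + exp (- (2 * x * t) - t\<^sup>2) * (- (2 * x) - 2 * t) * t powr s) (at t)"
      by (intro DERIV_mult has_real_derivative_powr t) (auto intro!: derivative_eq_intros)
    also have "s * t powr (s - 1) * exp (- (2 * x * t) - t\<^sup>2) + exp (- (2 * x * t) - t\<^sup>2) * (- (2 * x) - 2 * t) * t powr s = ?f t"
      unfolding ps pcw_def by (simp add: power2_eq_square algebra_simps)
    also have "(\<lambda>t. t powr s * exp (- (2 * x * t) - t\<^sup>2)) = ?F" by (simp add: pcw_def fun_eq_iff)
    finally show "(?F has_real_derivative ?f t) (at t)" .
    show "isCont ?f t" unfolding pcw_def using t by (auto intro!: continuous_intros)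
  next
    show "set_integrable lborel {0<..} ?f"
      using s by (intro set_integral_diff set_integrable_mult_right pcw_integrable pcw_Suc_integrable pcw_Suc2_integrable)
    have a: "((\<lambda>t::real. t powr (s + 1 - 1)) \<longlongrightarrow> 0) (at_right 0)"
      using s by (auto intro!: tendsto_eq_intros tendsto_powr' eventually_at_rightI[of 0 1])
    have b: "((\<lambda>t. exp (- (2 * x * t) - t\<^sup>2)) \<longlongrightarrow> exp 0) (at_right 0)"
      by (auto intro!: tendsto_eq_intros)
    show "(?F \<longlongrightarrow> 0) (at_right 0)" unfolding pcw_def using tendsto_mult[OF a b] by simp
    show "(?F \<longlongrightarrow> 0) at_top" unfolding pcw_def by real_asymp
  qed
  moreover have "(LINT t:{0<..}|lborel. ?f t) = s * pcJ s x - 2 * x * pcJ (s+1) x - 2 * pcJ (s+2) x"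
    unfolding pcJ_Suc pcJ_Suc2 unfolding pcJ_def
    by (simp add: set_integral_diff(2)[OF set_integral_diff(1)[OF i1 i2] i3] set_integral_diff(2)[OF i1 i2])
  ultimately show ?thesis by (simp add: algebra_simps)
qed

text \<open>For fixed t > 0 the integrand is the exponential of an affine function of (s, x), hence
  jointly convex. Convexity on an open subset of the plane yields the joint continuity
  \<open>pcJ_tendsto\<close>.\<close>

lemma pcJ_convex: "convex_on ({0<..} \<times> UNIV) (\<lambda>p. pcJ (fst p) (snd p))"
proof (rule convex_onI)
  show "convex (({0<..} :: real set) \<times> (UNIV :: real set))" by (intro convex_Times) auto
  fix r :: real and p q :: "real \<times> real"
  assume r: "0 < r" "r < 1" and p: "p \<in> {0<..} \<times> UNIV" and q: "q \<in> {0<..} \<times> UNIV"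
  obtain s x where [simp]: "p = (s, x)" by (cases p)
  obtain s' x' where [simp]: "q = (s', x')" by (cases q)
  have s: "s > 0" "s' > 0" using p q by auto
  let ?w = pcw
  let ?S = "(1 - r) * s + r * s'" and ?X = "(1 - r) * x + r * x'"
  have S: "?S > 0" using r s by (intro add_pos_pos mult_pos_pos) auto
  have "pcJ ?S ?X \<le> (LINT t:{0<..}|lborel. (1 - r) * ?w s x t + r * ?w s' x' t)"
    unfolding pcJ_def
  proof (rule set_integral_mono)
    fix t :: real assume "t \<in> {0<..}"
    then have t: "t > 0" by simp
    have e: "?w s x t = exp ((s - 1) * ln t - 2 * x * t - t\<^sup>2)" for s x
      using t by (simp add: pcw_def powr_def exp_add[symmetric] algebra_simps)
    have "exp ((1 - r) *\<^sub>R ((s - 1) * ln t - 2 * x * t - t\<^sup>2) + r *\<^sub>R ((s' - 1) * ln t - 2 * x' * t - t\<^sup>2))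
        \<le> (1 - r) * exp ((s - 1) * ln t - 2 * x * t - t\<^sup>2) + r * exp ((s' - 1) * ln t - 2 * x' * t - t\<^sup>2)"
      using r by (intro convex_onD[OF exp_convex]) auto
    moreover have "(1 - r) *\<^sub>R ((s - 1) * ln t - 2 * x * t - t\<^sup>2) + r *\<^sub>R ((s' - 1) * ln t - 2 * x' * t - t\<^sup>2)
       = (?S - 1) * ln t - 2 * ?X * t - t\<^sup>2"
      by (simp add: algebra_simps)
    ultimately show "?w ?S ?X t \<le> (1 - r) * ?w s x t + r * ?w s' x' t" unfolding e by simp
  qed (use s S in \<open>auto intro!: set_integral_add set_integrable_mult_right pcw_integrable\<close>)
  also have "\<dots> = (1 - r) * pcJ s x + r * pcJ s' x'"
    using s by (simp add: pcJ_def set_integral_add pcw_integrable set_integrable_mult_right)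
  finally show "pcJ (fst ((1 - r) *\<^sub>R p + r *\<^sub>R q)) (snd ((1 - r) *\<^sub>R p + r *\<^sub>R q))
    \<le> (1 - r) * pcJ (fst p) (snd p) + r * pcJ (fst q) (snd q)" by simp
qed

lemma pcJ_tendsto:
  assumes "(f \<longlongrightarrow> s) F" "(g \<longlongrightarrow> x) F" "s > 0"
  shows "((\<lambda>i. pcJ (f i) (g i)) \<longlongrightarrow> pcJ s x) F"
proof -
  have o: "open (({0<..} :: real set) \<times> (UNIV :: real set))" by (intro open_Times) auto
  have "continuous_on ({0<..} \<times> UNIV) (\<lambda>p. pcJ (fst p) (snd p))"
    by (rule convex_on_continuous[OF o pcJ_convex])
  then have "isCont (\<lambda>p. pcJ (fst p) (snd p)) (s, x)"
    using assms(3) o by (simp add: continuous_on_eq_continuous_at)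
  from isCont_tendsto_compose[OF this tendsto_Pair[OF assms(1,2)]] show ?thesis by simp
qed

text \<open>On (0,1] the exponential factor is at least exp (-2|x| - 1), and t^(s-1) integrates to
  1/s. The blow-up as s tends to 0 drives the limit \<open>pcM_tendsto_1\<close>.\<close>

lemma pcJ_lower:
  assumes "0 < s" "s < 1"
  shows "pcJ s x \<ge> exp (- 2 * \<bar>x\<bar> - 1) / s"
proof -
  let ?c = "exp (- 2 * \<bar>x\<bar> - 1)"
  have i: "((\<lambda>t. t powr (s - 1)) has_integral (1 / s)) {0..1}"
    using has_integral_powr_from_0[of "s-1" 1] assms by simp
  then have "(\<lambda>t::real. t powr (s - 1)) absolutely_integrable_on {0..1}"
    by (subst absolutely_integrable_on_iff_nonneg) auto
  then have I: "set_integrable lborel {0..1} (\<lambda>t::real. t powr (s - 1))"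
    unfolding set_integrable_def by (subst (asm) integrable_completion) auto
  have v: "(LINT t:{0..1}|lborel. t powr (s - 1)) = 1 / s"
    using set_borel_integral_eq_integral(2)[OF I] i by (simp add: integral_unique)
  have "?c / s = (LINT t:{0..1}|lborel. ?c * t powr (s - 1))" using v by simp
  also have "\<dots> = (LINT t:{0<..1}|lborel. ?c * t powr (s - 1))"
    by (rule set_integral_discrete_difference[of "{0}"]) auto
  also have "\<dots> \<le> (LINT t:{0<..1}|lborel. pcw s x t)"
  proof (rule set_integral_mono)
    show "set_integrable lborel {0<..1} (\<lambda>t. ?c * t powr (s - 1))"
      by (rule set_integrable_mult_right, rule set_integrable_subset[OF I]) auto
    show "set_integrable lborel {0<..1} (pcw s x)"
      by (rule set_integrable_subset[OF pcw_integrable[OF assms(1)]]) auto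
    fix t :: real assume t: "t \<in> {0<..1}"
    have "\<bar>x\<bar> * t \<le> \<bar>x\<bar>" using t by (intro mult_left_le) auto
    moreover have "x * t \<le> \<bar>x\<bar> * t" using t by (intro mult_right_mono) auto
    ultimately have "x * t \<le> \<bar>x\<bar>" by linarith
    moreover have "t\<^sup>2 \<le> 1" using t by (simp add: power_le_one)
    ultimately have "- 2 * \<bar>x\<bar> - 1 \<le> - (2 * x * t) - t\<^sup>2" by (simp add: mult.assoc)
    then have "?c \<le> exp (- (2 * x * t) - t\<^sup>2)" by simp
    then show "?c * t powr (s - 1) \<le> pcw s x t"
      by (simp add: mult.commute mult_left_mono pcw_def)
  qed
  also have "\<dots> \<le> pcJ s x"
    unfolding pcJ_def set_lebesgue_integral_def
  proof (rule integral_mono)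
    show "integrable lborel (\<lambda>t. indicat_real {0<..1} t *\<^sub>R pcw s x t)"
      unfolding set_integrable_def[symmetric] by (rule set_integrable_subset[OF pcw_integrable[OF assms(1)]]) auto
    show "integrable lborel (\<lambda>t. indicat_real {0<..} t *\<^sub>R pcw s x t)"
      unfolding set_integrable_def[symmetric] by (rule pcw_integrable[OF assms(1)])
  qed (auto simp: indicator_def pcw_pos less_imp_le)
  finally show ?thesis .
qed

section \<open>Decaying solutions of the oscillator equation and their logarithmic derivative\<close>

definition pcF :: "real \<Rightarrow> real \<Rightarrow> real" where
  "pcF l x = exp (- x\<^sup>2 / 2) * pcJ ((1 - l) / 2) x"

text \<open>F'/F written out with \<open>pcJ_deriv\<close>; in this form M < -x and joint continuity
  in (l, x) can be read off.\<close>

definition pcM :: "real \<Rightarrow> real \<Rightarrow> real" where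
  "pcM l x = - x - 2 * pcJ ((1 - l) / 2 + 1) x / pcJ ((1 - l) / 2) x"

lemma pcJ_half_pos: 
  assumes "l < 1"
  shows "pcJ ((1 - l) / 2) x > 0" "pcJ ((1 - l) / 2 + 1) x > 0"
  using assms by (auto intro!: pcJ_pos add_pos_pos)

lemma pcF_pos: "l < 1 \<Longrightarrow> pcF l x > 0"
  by (simp add: pcF_def pcJ_pos)

lemma pcM_less: "l < 1 \<Longrightarrow> pcM l x < - x"
  using pcJ_half_pos[of l x] by (simp add: pcM_def)

lemma pcF_deriv:
  assumes "l < 1"
  shows "(pcF l has_real_derivative pcM l x * pcF l x) (at x)"
proof -
  let ?s = "(1 - l) / 2"
  have s: "?s > 0" using assms by simp
  have e: "((\<lambda>x. exp (- x\<^sup>2 / 2)) has_real_derivative - x * exp (- x\<^sup>2 / 2)) (at x)"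
    by (auto intro!: derivative_eq_intros)
  have "(pcF l has_real_derivative (- x * exp (- x\<^sup>2 / 2)) * pcJ ?s x + (- 2 * pcJ (?s + 1) x) * exp (- x\<^sup>2 / 2)) (at x)"
    unfolding pcF_def[abs_def] by (rule DERIV_mult[OF e pcJ_deriv[OF s]])
  also have "(- x * exp (- x\<^sup>2 / 2)) * pcJ ?s x + (- 2 * pcJ (?s + 1) x) * exp (- x\<^sup>2 / 2) = pcM l x * pcF l x"
    using pcJ_pos[OF s, of x] by (simp add: pcM_def pcF_def left_diff_distrib)
  finally show ?thesis .
qed

lemma pcM_deriv:
  assumes "l < 1"
  shows "(pcM l has_real_derivative x\<^sup>2 - l - (pcM l x)\<^sup>2) (at x)"
proof -
  let ?s = "(1 - l) / 2"
  have s: "?s > 0" using assms by simp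
  then have s1: "?s + 1 > 0" by linarith
  define A B where "A = pcJ (?s + 1) x" and "B = pcJ ?s x"
  have B: "B > 0" using pcJ_pos[OF s] by (simp add: B_def)
  \<comment> \<open>Eliminating the third integral closes the system in A and B; what remains is the
    Riccati equation.\<close>
  have D: "pcJ (?s + 1 + 1) x = ?s / 2 * B - x * A"
    using pcJ_rec[OF s, of x] by (simp add: A_def B_def add.assoc)
  have d: "((\<lambda>x. pcJ (?s + 1) x / pcJ ?s x) has_real_derivative
      ((- 2 * pcJ (?s + 1 + 1) x) * B - A * (- 2 * A)) / (B * B)) (at x)"
    unfolding A_def B_def using pcJ_pos[OF s, of x]
    by (intro DERIV_divide pcJ_deriv s s1) simp
  have eq: "-1 - 2 * (((- 2 * pcJ (?s + 1 + 1) x) * B - A * (- 2 * A)) / (B * B)) = x\<^sup>2 - l - (pcM l x)\<^sup>2"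
    using B unfolding D pcM_def A_def[symmetric] B_def[symmetric]
    by (simp add: field_simps power2_eq_square)
  have "((\<lambda>x. - x - 2 * (pcJ (?s + 1) x / pcJ ?s x)) has_real_derivative
     -1 - 2 * (((- 2 * pcJ (?s + 1 + 1) x) * B - A * (- 2 * A)) / (B * B))) (at x)"
    by (intro DERIV_diff DERIV_cmult d DERIV_minus DERIV_ident)
  then show ?thesis unfolding eq by (simp add: pcM_def[abs_def])
qed

lemma pcM_tendsto:
  assumes "(f \<longlongrightarrow> l) F" "(g \<longlongrightarrow> x) F" "l < 1"
  shows "((\<lambda>i. pcM (f i) (g i)) \<longlongrightarrow> pcM l x) F"
  unfolding pcM_def
  by (intro tendsto_intros pcJ_tendsto assms) (use assms(3) pcJ_half_pos(1)[of l x] in \<open>auto intro: add_pos_pos\<close>)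

lemma pcM_cont: "l < 1 \<Longrightarrow> isCont (pcM l) x"
  using pcM_deriv DERIV_isCont by blast

text \<open>As s tends to 0, J_s blows up while J_(s+1) stays bounded, so the quotient dies. The
  limit is the logarithmic derivative of the Gaussian exp (-x^2/2), the whole-line ground state at l
  = 1.\<close>

lemma pcM_tendsto_1: "((\<lambda>l. pcM l x) \<longlongrightarrow> - x) (at_left 1)"
proof -
  let ?r = "\<lambda>l. pcJ ((1 - l) / 2 + 1) x / pcJ ((1 - l) / 2) x"
  let ?c = "exp (- 2 * \<bar>x\<bar> - 1)"
  have "(?r \<longlongrightarrow> 0) (at_left 1)"
  proof (rule Lim_null_comparison)
    show "\<forall>\<^sub>F l in at_left 1. norm (?r l) \<le> pcJ ((1 - l) / 2 + 1) x * ((1 - l) / 2 / ?c)"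
    proof (rule eventually_at_leftI)
      fix l :: real assume l: "l \<in> {0<..<1}"
      have 1: "?c / ((1 - l) / 2) \<le> pcJ ((1 - l) / 2) x" by (rule pcJ_lower) (use l in auto)
      have 2: "pcJ ((1 - l) / 2 + 1) x > 0" using pcJ_half_pos l by simp
      have 3: "pcJ ((1 - l) / 2) x > 0" by (rule pcJ_pos) (use l in auto)
      have "?r l \<le> pcJ ((1 - l) / 2 + 1) x / (?c / ((1 - l) / 2))"
        using 1 2 3 l by (intro divide_left_mono) auto
      also have "\<dots> = pcJ ((1 - l) / 2 + 1) x * ((1 - l) / 2 / ?c)" by simp
      finally show "norm (?r l) \<le> pcJ ((1 - l) / 2 + 1) x * ((1 - l) / 2 / ?c)" using 2 3 by simp
    qed simp
    have "((\<lambda>l. pcJ ((1 - l) / 2 + 1) x) \<longlongrightarrow> pcJ 1 x) (at_left 1)"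
      by (rule pcJ_tendsto) (auto intro!: tendsto_eq_intros)
    moreover have "((\<lambda>l. (1 - l) / 2 / ?c) \<longlongrightarrow> 0) (at_left 1)"
      by (auto intro!: tendsto_eq_intros)
    ultimately show "((\<lambda>l. pcJ ((1 - l) / 2 + 1) x * ((1 - l) / 2 / ?c)) \<longlongrightarrow> 0) (at_left 1)"
      using tendsto_mult by force
  qed
  then have "((\<lambda>l. - x - 2 * ?r l) \<longlongrightarrow> - x - 2 * 0) (at_left 1)" by (intro tendsto_intros)
  then show ?thesis by (simp add: pcM_def)
qed

lemma pcF_deriv2:
  assumes "l < 1"
  shows "((\<lambda>x. pcM l x * pcF l x) has_real_derivative (x\<^sup>2 - l) * pcF l x) (at x)"
  by (rule DERIV_cong[OF DERIV_mult[OF pcM_deriv[OF assms] pcF_deriv[OF assms]]])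
    (simp add: power2_eq_square algebra_simps)

text \<open>Convexity of the solution where $x^2 \ge l$ propagates a negative slope to the left.\<close>
lemma pcM_neg_leftwards:
  assumes l: "l < 1" and y: "pcM l y < 0" and c: "\<And>x. x \<le> y \<Longrightarrow> l \<le> x\<^sup>2" and x: "x \<le> y"
  shows "pcM l x < 0"
proof -
  have "pcM l x * pcF l x \<le> pcM l y * pcF l y"
  proof (rule DERIV_nonneg_imp_nondecreasing[OF x])
    fix z assume "x \<le> z" "z \<le> y"
    then show "\<exists>d. ((\<lambda>x. pcM l x * pcF l x) has_real_derivative d) (at z) \<and> 0 \<le> d"
      using pcF_deriv2[OF l, of z] c[of z] pcF_pos[OF l, of z] by (intro exI conjI) auto
  qed
  also have "\<dots> < 0" using y pcF_pos[OF l] by (simp add: mult_neg_pos)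
  finally show ?thesis using pcF_pos[OF l, of x] by (simp add: mult_less_0_iff)
qed

text \<open>Right of the origin M < -x decides. For l <= 0 the condition l <= x^2 holds everywhere,
  so the negative sign at 0 spreads over the whole left half-line. This yields positivity of
  \<open>mu\<close>.\<close>

lemma pcM_neg:
  assumes "l \<le> 0"
  shows "pcM l x < 0"
proof (cases "x \<ge> 0")
  case True
  then show ?thesis using pcM_less[of l x] assms by simp
next
  case False
  show ?thesis
  proof (rule pcM_neg_leftwards[of l 0])
    show "l \<le> z\<^sup>2" for z :: real using assms by (rule order_trans) simp
  qed (use assms False pcM_less[of l 0] in auto)
qed

text \<open>Put r = -x - M > 0, which satisfies r' = -(1 - l) - (M - x) r. If M were nonnegative for
  all x <= -1, then r' <= x r there, so r would grow at least quadratically to the left, against r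
  <= -x. Once the slope is negative at some y <= -1, \<open>pcM_neg_leftwards\<close> keeps it
  so.\<close>

lemma pcM_neg_at_bot:
  assumes l: "l < 1"
  shows "\<exists>X\<le>0. \<forall>x\<le>X. pcM l x < 0"
proof -
  let ?r = "\<lambda>x. - x - pcM l x"
  have r: "?r x > 0" for x using pcM_less[OF l, of x] by simp
  have "\<exists>x\<le>-1. pcM l x < 0"
  proof (rule ccontr)
    assume "\<not> ?thesis"
    then have M: "pcM l x \<ge> 0" if "x \<le> -1" for x using that by force
    have dr: "(?r has_real_derivative -1 - (x\<^sup>2 - l - (pcM l x)\<^sup>2)) (at x)" for x
      by (intro DERIV_diff DERIV_minus DERIV_ident pcM_deriv l)
    have dr_le: "-1 - (x\<^sup>2 - l - (pcM l x)\<^sup>2) \<le> x * ?r x" if "x \<le> -1" for x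
    proof -
      have "-1 - (x\<^sup>2 - l - (pcM l x)\<^sup>2) = - (1 - l) - (pcM l x - x) * ?r x"
        by (simp add: power2_eq_square algebra_simps)
      moreover have "pcM l x * ?r x \<ge> 0" using M[OF that] r[of x] by simp
      ultimately show ?thesis using l by (simp add: left_diff_distrib)
    qed
    have mono: "?r (-1) \<le> ?r x" if x: "x \<le> -1" for x
    proof (rule DERIV_nonpos_imp_nonincreasing[OF x])
      fix z assume z: "x \<le> z" "z \<le> -1"
      have "z * ?r z \<le> 0" using z r[of z] by (simp add: mult_nonpos_nonneg)
      then show "\<exists>d. (?r has_real_derivative d) (at z) \<and> d \<le> 0"
        using dr[of z] dr_le[of z] z by (blast intro: order_trans)
    qed
    define r0 where "r0 = ?r (-1)"
    have r0: "r0 > 0" using r by (simp only: r0_def)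
    have quad: "r0 - r0 / 2 \<le> ?r x - r0 * x\<^sup>2 / 2" if x: "x \<le> -1" for x
    proof -
      have "?r (-1) - r0 * (-1)\<^sup>2 / 2 \<le> ?r x - r0 * x\<^sup>2 / 2"
      proof (rule DERIV_nonpos_imp_nonincreasing[OF x])
        fix z assume z: "x \<le> z" "z \<le> -1"
        have zr: "z * ?r z \<le> z * r0" using mono[of z] z unfolding r0_def by (intro mult_left_mono_neg) auto
        have "((\<lambda>z. r0 * z\<^sup>2 / 2) has_real_derivative z * r0) (at z)"
          by (auto intro!: derivative_eq_intros)
        then have "((\<lambda>x. ?r x - r0 * x\<^sup>2 / 2) has_real_derivative (-1 - (z\<^sup>2 - l - (pcM l z)\<^sup>2)) - z * r0) (at z)"
          by (intro DERIV_diff[OF dr])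
        moreover have "(-1 - (z\<^sup>2 - l - (pcM l z)\<^sup>2)) - z * r0 \<le> 0" using dr_le[of z] z zr by linarith
        ultimately show "\<exists>d. ((\<lambda>x. ?r x - r0 * x\<^sup>2 / 2) has_real_derivative d) (at z) \<and> d \<le> 0" by blast
      qed
      then show ?thesis by (simp add: r0_def)
    qed
    \<comment> \<open>Here -x - r0 x^2/2 equals -1 - r0/2 < 0, while \<open>quad\<close> together
      with M >= 0 bounds it below by r0/2.\<close>
    define x where "x = -1 - 2 / r0"
    have x: "x \<le> -1" using r0 by (simp add: x_def)
    have "r0 - r0 / 2 \<le> - x - r0 * x\<^sup>2 / 2" using quad[OF x] M[OF x] by simp
    moreover have "- x - r0 * x\<^sup>2 / 2 = - 1 - r0 / 2" using r0 by (simp add: x_def field_simps power2_eq_square)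
    ultimately show False using r0 by simp
  qed
  then obtain y where y: "y \<le> -1" "pcM l y < 0" by blast
  have "pcM l x < 0" if "x \<le> y" for x
  proof (rule pcM_neg_leftwards[OF l y(2) _ that])
    fix z assume "z \<le> y"
    then have "1 \<le> - z" using y by simp
    then have "1 \<le> (- z)\<^sup>2" by (rule one_le_power)
    then show "l \<le> z\<^sup>2" using l by simp
  qed
  then show ?thesis using y(1) by (intro exI[of _ y]) auto
qed

text \<open>If M <= x for all x < 0, then M^2 >= x^2, and the Riccati equation gives (M - x)' <= -(1
  + l) < 0; so M - x grows linearly to the left and ends up positive. Used at l = k^2 to make G
  positive.\<close>

lemma pcM_gt_self:
  assumes l: "-1 < l" "l < 1"
  shows "\<exists>x<0. pcM l x > x"
proof (rule ccontr)
  assume "\<not> ?thesis"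
  then have M: "pcM l x \<le> x" if "x < 0" for x using that by force
  define N where "N = pcM l (-1) + 1"
  \<comment> \<open>Travelling from -1 to y adds (1 + l)(-1 - y) = |N| + 1 to the initial value N of
    M - x.\<close>
  define y where "y = -1 - (\<bar>N\<bar> + 1) / (1 + l)"
  have y: "y \<le> -1" using l by (simp add: y_def)
  let ?g = "\<lambda>x. pcM l x - x + (1 + l) * x"
  have "?g (-1) \<le> ?g y"
  proof (rule DERIV_nonpos_imp_nonincreasing[OF y])
    fix z assume z: "y \<le> z" "z \<le> -1"
    have "(- z)\<^sup>2 \<le> (- pcM l z)\<^sup>2" using M[of z] z by (intro power_mono) auto
    then have "z\<^sup>2 - l - (pcM l z)\<^sup>2 - 1 + (1 + l) * 1 \<le> 0" by simp
    moreover have "(?g has_real_derivative z\<^sup>2 - l - (pcM l z)\<^sup>2 - 1 + (1 + l) * 1) (at z)"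
      by (intro DERIV_add DERIV_diff DERIV_cmult DERIV_ident pcM_deriv l)
    ultimately show "\<exists>d. (?g has_real_derivative d) (at z) \<and> d \<le> 0" by blast
  qed
  moreover have "(1 + l) * y = - (1 + l) - (\<bar>N\<bar> + 1)" using l by (simp add: y_def field_simps)
  ultimately have "pcM l y - y \<ge> N + \<bar>N\<bar> + 1" by (simp add: N_def)
  then show False using M[of y] y by simp
qed

text \<open>Compactness handles bounded arguments; for x >= 1 the recurrence bounds J_(s+1)/J_s by
  s/2. Linear growth matches the weight in the form domain: if v and t v are square integrable, so
  is M v.\<close>

lemma pcM_linear_bound:
  assumes l: "l < 1"
  shows "\<exists>C\<ge>0. \<forall>t\<ge>0. \<bar>pcM l (t + \<xi>)\<bar> \<le> C * (1 + t)"
proof -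
  let ?s = "(1 - l) / 2"
  have s: "?s > 0" using l by simp
  have "bounded (pcM l ` {\<xi>..max \<xi> 1})"
    by (intro compact_imp_bounded compact_continuous_image continuous_at_imp_continuous_on ballI pcM_cont l compact_Icc)
  then obtain B where B: "\<And>x. x \<in> {\<xi>..max \<xi> 1} \<Longrightarrow> \<bar>pcM l x\<bar> \<le> B"
    unfolding bounded_iff by (metis imageI real_norm_def)
  have far: "\<bar>pcM l x\<bar> \<le> x + 2 * ?s" if x: "x \<ge> 1" for x
  proof -
    have p: "pcJ (?s + 2) x > 0" "pcJ (?s + 1) x > 0" "pcJ ?s x > 0" using l by (auto intro!: pcJ_pos add_pos_pos)
    have "pcJ (?s + 1) x \<le> x * pcJ (?s + 1) x" using x p by simp
    also have "\<dots> \<le> ?s / 2 * pcJ ?s x" using pcJ_rec[OF s, of x] p by linarith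
    finally have "pcJ (?s + 1) x / pcJ ?s x \<le> ?s / 2" using p by (simp add: field_simps)
    moreover have "pcJ (?s + 1) x / pcJ ?s x \<ge> 0" using p by simp
    ultimately show ?thesis using x s unfolding pcM_def by linarith
  qed
  define C where "C = \<bar>B\<bar> + \<bar>\<xi>\<bar> + 2 * ?s + 1"
  have "\<bar>pcM l (t + \<xi>)\<bar> \<le> C * (1 + t)" if t: "t \<ge> 0" for t
  proof -
    have "\<bar>pcM l (t + \<xi>)\<bar> \<le> t + C"
    proof (cases "t + \<xi> \<le> max \<xi> 1")
      case True
      then have "\<bar>pcM l (t + \<xi>)\<bar> \<le> B" using B[of "t + \<xi>"] t by simp
      then show ?thesis using t s abs_ge_self[of B] abs_ge_zero[of \<xi>] unfolding C_def by linarith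
    next
      case False
      then show ?thesis using far[of "t + \<xi>"] abs_ge_zero[of B] abs_ge_self[of \<xi>] unfolding C_def by linarith
    qed
    also have "\<dots> \<le> C * (1 + t)" 
    proof -
      have "1 * t \<le> C * t" using t s by (intro mult_right_mono) (auto simp: C_def)
      then show ?thesis by (simp add: algebra_simps)
    qed
    finally show ?thesis .
  qed
  moreover have "C \<ge> 0" using s by (simp add: C_def)
  ultimately show ?thesis by blast
qed

text \<open>The Gaussian beats every exponential; with rate 2, a factor exp (-t) is left after the
  weight 1 + t has been absorbed in \<open>pf_pg_bound\<close>.\<close>

lemma pcF_exp_bound:
  assumes l: "l < 1"
  shows "\<exists>C\<ge>0. \<forall>t\<ge>0. pcF l (t + \<xi>) \<le> C * exp (- 2 * t)"
proof -
  let ?s = "(1 - l) / 2"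
  have s: "?s > 0" using l by simp
  let ?C = "exp (2 - 2 * \<xi>) * pcJ ?s \<xi>"
  have "pcF l (t + \<xi>) \<le> ?C * exp (- 2 * t)" if t: "t \<ge> 0" for t
  proof -
    have "0 \<le> (t + \<xi> - 2)\<^sup>2" by simp
    also have "(t + \<xi> - 2)\<^sup>2 = (t + \<xi>)\<^sup>2 - 4 * (t + \<xi>) + 4" by (simp add: power2_eq_square algebra_simps)
    finally have "- (t + \<xi>)\<^sup>2 / 2 \<le> (2 - 2 * \<xi>) + (- 2 * t)" by simp
    then have "exp (- (t + \<xi>)\<^sup>2 / 2) \<le> exp (2 - 2 * \<xi>) * exp (- 2 * t)" 
      unfolding exp_add[symmetric] by (simp only: exp_le_cancel_iff)
    moreover have "pcJ ?s (t + \<xi>) \<le> pcJ ?s \<xi>" by (rule pcJ_antimono[OF s]) (use t in simp)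
    ultimately have "pcF l (t + \<xi>) \<le> (exp (2 - 2 * \<xi>) * exp (- 2 * t)) * pcJ ?s \<xi>"
      unfolding pcF_def using pcJ_pos[OF s, of "t + \<xi>"] by (intro mult_mono) auto
    then show ?thesis by (simp add: mult_ac)
  qed
  moreover have "?C \<ge> 0" using pcJ_pos[OF s, of \<xi>] by simp
  ultimately show ?thesis by blast
qed

section \<open>Picone's identity on the half-line\<close>

lemma weak_deriv_on_continuous:
  assumes w: "weak_deriv_on {x..y} u g"
  shows "continuous_on {x..y} u"
proof (cases "x \<le> y")
  case True
  have i: "set_integrable lborel {x..y} g" using w True by (auto simp: weak_deriv_on_def)
  have "continuous_on {x..y} (\<lambda>t. u x + integral {x..t} g)"
    by (intro continuous_intros indefinite_integral_continuous_1 set_borel_integral_eq_integral(1)[OF i])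
  then show ?thesis
  proof (rule continuous_on_eq)
    fix t assume t: "t \<in> {x..y}"
    have "set_integrable lborel {x..t} g" by (rule set_integrable_subset[OF i]) (use t in auto)
    then have "(LINT t:{x..t}|lborel. g t) = integral {x..t} g" by (rule set_borel_integral_eq_integral(2))
    moreover have "u t - u x = (LINT t:{x..t}|lborel. g t)" using w t by (auto simp: weak_deriv_on_def)
    ultimately show "u x + integral {x..t} g = u t" by simp
  qed
qed simp

lemma set_integrable_mult_continuous:
  fixes g u :: "real \<Rightarrow> real"
  assumes g: "set_integrable lborel {x..y} g" and u: "continuous_on {x..y} u"
  shows "set_integrable lborel {x..y} (\<lambda>t. u t * g t)"
proof -
  have "bounded (u ` {x..y})" by (intro compact_imp_bounded compact_continuous_image u compact_Icc)
  then obtain B where B: "\<And>t. t \<in> {x..y} \<Longrightarrow> \<bar>u t\<bar> \<le> B" unfolding bounded_iff by (metis imageI real_norm_def)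
  show ?thesis
  proof (rule set_integrable_bound)
    show "set_integrable lborel {x..y} (\<lambda>t. B * g t)" using g by (rule set_integrable_mult_right)
    have 1: "(\<lambda>t. indicat_real {x..y} t * g t) \<in> borel_measurable lborel"
      using g by (auto simp: set_integrable_def)
    have 2: "(\<lambda>t. indicat_real {x..y} t * u t) \<in> borel_measurable lborel"
      using borel_measurable_continuous_on_indicator[OF _ u] by simp
    have "(\<lambda>t. (indicat_real {x..y} t * u t) * (indicat_real {x..y} t * g t)) \<in> borel_measurable lborel"
      using 2 1 by (rule borel_measurable_times)
    also have "(\<lambda>t. (indicat_real {x..y} t * u t) * (indicat_real {x..y} t * g t)) = (\<lambda>t. indicator {x..y} t *\<^sub>R (u t * g t))"
      by (auto simp: indicator_def)
    finally show "set_borel_measurable lborel {x..y} (\<lambda>t. u t * g t)" by (simp add: set_borel_measurable_def)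
    show "AE t in lborel. t \<in> {x..y} \<longrightarrow> norm (u t * g t) \<le> norm (B * g t)"
    proof (intro AE_I2 impI)
      fix t assume "t \<in> {x..y}"
      then have "\<bar>u t\<bar> \<le> \<bar>B\<bar>" using B by (meson abs_ge_self order_trans)
      then show "norm (u t * g t) \<le> norm (B * g t)" by (simp add: abs_mult mult_right_mono)
    qed
  qed
qed

text \<open>Fubini on the plane cut along the diagonal. When A and B are cut-off derivatives, the
  inner integrals are increments, and the identity becomes integration by parts for absolutely
  continuous functions.\<close>

lemma integral_mult_triangles:
  fixes A B :: "real \<Rightarrow> real"
  assumes A: "integrable lborel A" and B: "integrable lborel B"
  shows "(\<integral>s. A s \<partial>lborel) * (\<integral>t. B t \<partial>lborel) =
     (\<integral>t. B t * (\<integral>s. A s * of_bool (s \<le> t) \<partial>lborel) \<partial>lborel) + (\<integral>s. A s * (\<integral>t. B t * of_bool (t < s) \<partial>lborel) \<partial>lborel)"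
    and "integrable lborel (\<lambda>t. B t * (\<integral>s. A s * of_bool (s \<le> t) \<partial>lborel))"
    and "integrable lborel (\<lambda>s. A s * (\<integral>t. B t * of_bool (t < s) \<partial>lborel))"
proof -
  have [measurable]: "A \<in> borel_measurable borel" "B \<in> borel_measurable borel" using A B by auto
  have P: "integrable (lborel \<Otimes>\<^sub>M lborel) (\<lambda>(s, t). A s * B t)"
    by (rule lborel_pair.Fubini_integrable) (use A B in \<open>auto simp: abs_mult\<close>)
  have P1: "integrable (lborel \<Otimes>\<^sub>M lborel) (\<lambda>(s, t). A s * B t * of_bool (s \<le> t))"
    by (rule Bochner_Integration.integrable_bound[OF P]) (auto intro!: AE_I2 simp: case_prod_beta)
  have P2: "integrable (lborel \<Otimes>\<^sub>M lborel) (\<lambda>(s, t). A s * B t * of_bool (t < s))"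
    by (rule Bochner_Integration.integrable_bound[OF P]) (auto intro!: AE_I2 simp: case_prod_beta)
  have i1: "integrable lborel (\<lambda>s. A s * of_bool (s \<le> t))" for t
    by (rule Bochner_Integration.integrable_bound[OF A]) auto
  have i2: "integrable lborel (\<lambda>t. B t * of_bool (t < s))" for s
    by (rule Bochner_Integration.integrable_bound[OF B]) auto
  have i3: "integrable lborel (\<lambda>t. B t * of_bool (s \<le> t))" for s
    by (rule Bochner_Integration.integrable_bound[OF B]) auto
  have e1: "(\<integral>s. A s * B t * of_bool (s \<le> t) \<partial>lborel) = B t * (\<integral>s. A s * of_bool (s \<le> t) \<partial>lborel)" for t
    by (subst integral_mult_right_zero[symmetric]) (simp add: mult_ac)
  have e2: "(\<integral>t. A s * B t * of_bool (t < s) \<partial>lborel) = A s * (\<integral>t. B t * of_bool (t < s) \<partial>lborel)" for s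
    by (subst integral_mult_right_zero[symmetric]) (simp add: mult_ac)
  show "integrable lborel (\<lambda>t. B t * (\<integral>s. A s * of_bool (s \<le> t) \<partial>lborel))"
    using lborel_pair.integrable_snd[OF P1] by (simp add: e1)
  show I2: "integrable lborel (\<lambda>s. A s * (\<integral>t. B t * of_bool (t < s) \<partial>lborel))"
    using lborel_pair.integrable_fst[OF P2] by (simp add: e2)
  have "(\<integral>s. A s \<partial>lborel) * (\<integral>t. B t \<partial>lborel) = (\<integral>s. (\<integral>t. A s * B t * of_bool (s \<le> t) \<partial>lborel) + (\<integral>t. A s * B t * of_bool (t < s) \<partial>lborel) \<partial>lborel)"
  proof -
    have "(\<integral>t. A s * B t * of_bool (s \<le> t) \<partial>lborel) + (\<integral>t. A s * B t * of_bool (t < s) \<partial>lborel) = A s * (\<integral>t. B t \<partial>lborel)" for s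
    proof -
      have "(\<integral>t. A s * B t * of_bool (s \<le> t) \<partial>lborel) + (\<integral>t. A s * B t * of_bool (t < s) \<partial>lborel)
         = (\<integral>t. A s * (B t * of_bool (s \<le> t)) + A s * (B t * of_bool (t < s)) \<partial>lborel)"
        by (subst Bochner_Integration.integral_add) (use i3[of s] i2[of s] in \<open>auto simp: mult.assoc\<close>)
      also have "\<dots> = (\<integral>t. A s * B t \<partial>lborel)" by (intro Bochner_Integration.integral_cong) auto
      finally show ?thesis by simp
    qed
    then show ?thesis by simp
  qed
  also have "\<dots> = (\<integral>s. (\<integral>t. A s * B t * of_bool (s \<le> t) \<partial>lborel) \<partial>lborel) + (\<integral>s. (\<integral>t. A s * B t * of_bool (t < s) \<partial>lborel) \<partial>lborel)"
    using lborel_pair.integrable_fst[OF P1] lborel_pair.integrable_fst[OF P2]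
    by (intro Bochner_Integration.integral_add) auto
  also have "(\<integral>s. (\<integral>t. A s * B t * of_bool (s \<le> t) \<partial>lborel) \<partial>lborel) = (\<integral>t. (\<integral>s. A s * B t * of_bool (s \<le> t) \<partial>lborel) \<partial>lborel)"
    by (rule lborel_pair.Fubini_integral[symmetric]) (use P1 in simp)
  finally show "(\<integral>s. A s \<partial>lborel) * (\<integral>t. B t \<partial>lborel) =
     (\<integral>t. B t * (\<integral>s. A s * of_bool (s \<le> t) \<partial>lborel) \<partial>lborel) + (\<integral>s. A s * (\<integral>t. B t * of_bool (t < s) \<partial>lborel) \<partial>lborel)"
    by (simp add: e1 e2)
qed

lemma weak_deriv_on_mult:
  assumes u: "weak_deriv_on {a..} u g" and v: "weak_deriv_on {a..} v h"
  shows "weak_deriv_on {a..} (\<lambda>t. u t * v t) (\<lambda>t. u t * h t + v t * g t)"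
  unfolding weak_deriv_on_def
proof (intro ballI impI)
  fix x y :: real assume x: "x \<in> {a..}" and y: "y \<in> {a..}" and xy: "x \<le> y"
  let ?I = "{x..y}"
  have u': "weak_deriv_on ?I u g" and v': "weak_deriv_on ?I v h"
    using u v x by (auto simp: weak_deriv_on_def)
  have g: "set_integrable lborel ?I g" and h: "set_integrable lborel ?I h"
    using u' v' xy by (auto simp: weak_deriv_on_def)
  have uc: "continuous_on ?I u" and vc: "continuous_on ?I v"
    using u' v' by (auto intro: weak_deriv_on_continuous)
  have uh: "set_integrable lborel ?I (\<lambda>t. u t * h t)" and vg: "set_integrable lborel ?I (\<lambda>t. v t * g t)"
    using g h uc vc by (auto intro: set_integrable_mult_continuous)
  let ?A = "\<lambda>t. indicat_real ?I t * g t" and ?B = "\<lambda>t. indicat_real ?I t * h t"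
  have A: "integrable lborel ?A" and B: "integrable lborel ?B"
    using g h by (auto simp: set_integrable_def)
  have u1: "(\<integral>s. ?A s * of_bool (s \<le> t) \<partial>lborel) = u t - u x" if t: "t \<in> ?I" for t
  proof -
    have "u t - u x = (LINT t:{x..t}|lborel. g t)" using u' t xy by (auto simp: weak_deriv_on_def)
    also have "\<dots> = (\<integral>s. ?A s * of_bool (s \<le> t) \<partial>lborel)"
      unfolding set_lebesgue_integral_def
      by (intro Bochner_Integration.integral_cong) (use t in \<open>auto simp: indicator_def\<close>)
    finally show ?thesis by simp
  qed
  have v1: "(\<integral>s. ?B s * of_bool (s < t) \<partial>lborel) = v t - v x" if t: "t \<in> ?I" for t
  proof -
    have "v t - v x = (LINT t:{x..t}|lborel. h t)" using v' t xy by (auto simp: weak_deriv_on_def)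
    \<comment> \<open>The second triangle is strict, so the right endpoint, a null set, is
      dropped.\<close>
    also have "\<dots> = (LINT t:{x..<t}|lborel. h t)"
      by (rule set_integral_discrete_difference[of "{t}"]) auto
    also have "\<dots> = (\<integral>s. ?B s * of_bool (s < t) \<partial>lborel)"
      unfolding set_lebesgue_integral_def
      by (intro Bochner_Integration.integral_cong) (use t in \<open>auto simp: indicator_def\<close>)
    finally show ?thesis by simp
  qed
  have uy: "(\<integral>s. ?A s \<partial>lborel) = u y - u x" and vy: "(\<integral>s. ?B s \<partial>lborel) = v y - v x"
    using u' v' xy by (auto simp: weak_deriv_on_def set_lebesgue_integral_def)
  have "(\<integral>t. ?B t * (\<integral>s. ?A s * of_bool (s \<le> t) \<partial>lborel) \<partial>lborel) = (LINT t:?I|lborel. u t * h t - u x * h t)"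
    unfolding set_lebesgue_integral_def
  proof (intro Bochner_Integration.integral_cong refl)
    fix t show "?B t * (\<integral>s. ?A s * of_bool (s \<le> t) \<partial>lborel) = indicator ?I t *\<^sub>R (u t * h t - u x * h t)"
    proof (cases "t \<in> ?I")
      case True
      show ?thesis unfolding u1[OF True] using True by (simp add: algebra_simps)
    qed simp
  qed
  also have "\<dots> = (LINT t:?I|lborel. u t * h t) - u x * (v y - v x)"
    using vy by (subst set_integral_diff(2)[OF uh set_integrable_mult_right[OF h]]) (simp add: set_lebesgue_integral_def)
  finally have 1: "(\<integral>t. ?B t * (\<integral>s. ?A s * of_bool (s \<le> t) \<partial>lborel) \<partial>lborel) = (LINT t:?I|lborel. u t * h t) - u x * (v y - v x)" .
  have "(\<integral>s. ?A s * (\<integral>t. ?B t * of_bool (t < s) \<partial>lborel) \<partial>lborel) = (LINT t:?I|lborel. v t * g t - v x * g t)"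
    unfolding set_lebesgue_integral_def
  proof (intro Bochner_Integration.integral_cong refl)
    fix s show "?A s * (\<integral>t. ?B t * of_bool (t < s) \<partial>lborel) = indicator ?I s *\<^sub>R (v s * g s - v x * g s)"
    proof (cases "s \<in> ?I")
      case True
      show ?thesis unfolding v1[OF True] using True by (simp add: algebra_simps)
    qed simp
  qed
  also have "\<dots> = (LINT t:?I|lborel. v t * g t) - v x * (u y - u x)"
    using uy by (subst set_integral_diff(2)[OF vg set_integrable_mult_right[OF g]]) (simp add: set_lebesgue_integral_def)
  finally have 2: "(\<integral>s. ?A s * (\<integral>t. ?B t * of_bool (t < s) \<partial>lborel) \<partial>lborel) = (LINT t:?I|lborel. v t * g t) - v x * (u y - u x)" .
  \<comment> \<open>Moving the increments multiplied by \<open>u x\<close> and \<open>v x\<close> to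
    the left turns the product of increments into the increment of u v.\<close>
  have "(u y - u x) * (v y - v x) = (LINT t:?I|lborel. u t * h t) - u x * (v y - v x) + ((LINT t:?I|lborel. v t * g t) - v x * (u y - u x))"
    using integral_mult_triangles(1)[OF A B] unfolding 1 2 uy vy .
  then show "set_integrable lborel ?I (\<lambda>t. u t * h t + v t * g t) \<and>
    u y * v y - u x * v x = (LINT t:?I|lborel. u t * h t + v t * g t)"
    using uh vg by (simp add: set_integral_add algebra_simps)
qed

lemma weak_deriv_on_C1:
  assumes d: "\<And>t. (u has_real_derivative g t) (at t)" and c: "continuous_on UNIV g"
  shows "weak_deriv_on I u g"
  unfolding weak_deriv_on_def
proof (intro ballI impI conjI)
  fix x y :: real assume "x \<le> y"
  have c': "continuous_on {x..y} g" using c by (rule continuous_on_subset) simp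
  then show "set_integrable lborel {x..y} g" by (rule borel_integrable_atLeastAtMost')
  show "u y - u x = (LINT t:{x..y}|lborel. g t)"
    unfolding set_lebesgue_integral_def using d c' \<open>x \<le> y\<close>
    by (intro integral_FTC_atLeastAtMost[symmetric])
      (auto simp: has_real_derivative_iff_has_vector_derivative intro: has_vector_derivative_at_within)
qed

section \<open>Square integrability\<close>

lemma sq_int_on_mult_integrable:
  assumes "sq_int_on S f" "sq_int_on S g"
  shows "set_integrable lborel S (\<lambda>t. f t * g t)"
proof (rule set_integrable_bound)
  show "set_integrable lborel S (\<lambda>t. (f t)\<^sup>2 + (g t)\<^sup>2)" using assms by (auto simp: sq_int_on_def intro: set_integral_add)
  have "(\<lambda>t. (indicator S t *\<^sub>R f t) * (indicator S t *\<^sub>R g t)) \<in> borel_measurable lborel"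
    using assms unfolding sq_int_on_def set_borel_measurable_def by (intro borel_measurable_times) auto
  also have "(\<lambda>t. (indicator S t *\<^sub>R f t) * (indicator S t *\<^sub>R g t)) = (\<lambda>t. indicator S t *\<^sub>R (f t * g t))"
    by (auto simp: indicator_def)
  finally show "set_borel_measurable lborel S (\<lambda>t. f t * g t)" by (simp add: set_borel_measurable_def)
  show "AE t in lborel. t \<in> S \<longrightarrow> norm (f t * g t) \<le> norm ((f t)\<^sup>2 + (g t)\<^sup>2)"
  proof (intro AE_I2 impI)
    fix t
    have "2 * (\<bar>f t\<bar> * \<bar>g t\<bar>) \<le> (f t)\<^sup>2 + (g t)\<^sup>2" using sum_squares_bound[of "\<bar>f t\<bar>" "\<bar>g t\<bar>"] by simp
    moreover have "0 \<le> \<bar>f t\<bar> * \<bar>g t\<bar>" by simp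
    ultimately have "\<bar>f t\<bar> * \<bar>g t\<bar> \<le> (f t)\<^sup>2 + (g t)\<^sup>2" by linarith
    then show "norm (f t * g t) \<le> norm ((f t)\<^sup>2 + (g t)\<^sup>2)" by (simp add: abs_mult)
  qed
qed

lemma sq_int_on_add:
  assumes f: "sq_int_on S f" and g: "sq_int_on S g"
  shows "sq_int_on S (\<lambda>t. f t + g t)"
proof -
  have "set_integrable lborel S (\<lambda>t. (f t)\<^sup>2 + (g t)\<^sup>2 + 2 * (f t * g t))"
    using assms sq_int_on_mult_integrable[OF assms] by (auto simp: sq_int_on_def intro!: set_integral_add)
  also have "(\<lambda>t. (f t)\<^sup>2 + (g t)\<^sup>2 + 2 * (f t * g t)) = (\<lambda>t. (f t + g t)\<^sup>2)"
    by (auto simp: power2_eq_square algebra_simps)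
  finally show ?thesis using f g
    by (auto simp: sq_int_on_def set_borel_measurable_def scaleR_add_right simp del: real_scaleR_def)
qed

lemma sq_int_on_cmult:
  assumes "sq_int_on S f"
  shows "sq_int_on S (\<lambda>t. c * f t)"
proof -
  have "(\<lambda>x. c * (indicator S x *\<^sub>R f x)) \<in> borel_measurable lborel"
    using assms unfolding sq_int_on_def set_borel_measurable_def by (intro borel_measurable_times) auto
  also have "(\<lambda>x. c * (indicator S x *\<^sub>R f x)) = (\<lambda>x. indicator S x *\<^sub>R (c * f x))" by auto
  finally show ?thesis using assms
    by (simp add: sq_int_on_def set_borel_measurable_def power_mult_distrib)
qed

lemma sq_int_on_exp_bound:
  fixes f :: "real \<Rightarrow> real"
  assumes c: "continuous_on UNIV f" and b: "\<And>t. t \<ge> 0 \<Longrightarrow> \<bar>f t\<bar> \<le> C * exp (- t)"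
  shows "sq_int_on {0<..} f"
  unfolding sq_int_on_def
proof
  show "set_borel_measurable lborel {0<..} f"
    unfolding set_borel_measurable_def using c
    by (intro borel_measurable_scaleR) (auto intro: borel_measurable_continuous_onI)
  show "set_integrable lborel {0<..} (\<lambda>t. (f t)\<^sup>2)"
  proof (rule set_integrable_continuous_bound)
    have "set_integrable lborel {0<..} (\<lambda>t::real. t powr (1 - 1) * exp (- t))"
      by (rule set_integrable_powr_exp) simp
    then have "set_integrable lborel {0<..} (\<lambda>t::real. exp (- t))"
      by (rule set_integrable_cong[THEN iffD1, rotated 3]) auto
    then show "set_integrable lborel {0<..} (\<lambda>t. C\<^sup>2 * exp (- t))" by (rule set_integrable_mult_right)
    show "continuous_on {0<..} (\<lambda>t. (f t)\<^sup>2)"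
      using c by (intro continuous_intros) (rule continuous_on_subset, auto)
    fix t :: real assume t: "t > 0"
    have "\<bar>f t\<bar>\<^sup>2 \<le> (C * exp (- t))\<^sup>2" using b[of t] t by (intro power_mono) auto
    also have "\<dots> = C\<^sup>2 * exp (- 2 * t)" by (simp add: power_mult_distrib exp_double[symmetric])
    also have "\<dots> \<le> C\<^sup>2 * exp (- t)" using t by (intro mult_left_mono) auto
    finally show "\<bar>(f t)\<^sup>2\<bar> \<le> C\<^sup>2 * exp (- t)" by simp
  qed
qed

text \<open>Asking for the weak derivative on the closed half-line makes \<open>v 0\<close> the
  trace of v; \<open>in_H1_pos\<close> alone puts no constraint on the value at 0.\<close>

definition HL :: "(real \<Rightarrow> real) \<Rightarrow> (real \<Rightarrow> real) \<Rightarrow> bool" where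
  "HL v h \<longleftrightarrow> in_H1_pos v h \<and> weak_deriv_on {0..} v h"

definition Qf :: "real \<Rightarrow> (real \<Rightarrow> real) \<Rightarrow> (real \<Rightarrow> real) \<Rightarrow> real" where
  "Qf \<xi> v h = (LINT t:{0<..}|lborel. (h t)\<^sup>2 + (t + \<xi>)\<^sup>2 * (v t)\<^sup>2)"

definition Nf :: "(real \<Rightarrow> real) \<Rightarrow> real" where
  "Nf v = (LINT t:{0<..}|lborel. (v t)\<^sup>2)"

text \<open>Half the derivative of \<open>Qf \<xi> v h\<close> in \<xi>, as \<open>Qf_shift\<close>
  shows.\<close>

definition Tf :: "real \<Rightarrow> (real \<Rightarrow> real) \<Rightarrow> real" where
  "Tf \<xi> v = (LINT t:{0<..}|lborel. (t + \<xi>) * (v t)\<^sup>2)"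

lemma in_H1_pos_integrable:
  assumes "in_H1_pos v h"
  shows "set_integrable lborel {0<..} (\<lambda>t. (v t)\<^sup>2)" "set_integrable lborel {0<..} (\<lambda>t. (h t)\<^sup>2)"
    "set_integrable lborel {0<..} (\<lambda>t. (t + \<xi>)\<^sup>2 * (v t)\<^sup>2)" "set_integrable lborel {0<..} (\<lambda>t. (t + \<xi>) * (v t)\<^sup>2)"
proof -
  have v: "sq_int_on {0<..} v" and h: "sq_int_on {0<..} h" and tv: "sq_int_on {0<..} (\<lambda>t. t * v t)"
    using assms by (auto simp: in_H1_pos_def)
  show "set_integrable lborel {0<..} (\<lambda>t. (v t)\<^sup>2)" "set_integrable lborel {0<..} (\<lambda>t. (h t)\<^sup>2)"
    using v h by (auto simp: sq_int_on_def)
  have t: "sq_int_on {0<..} (\<lambda>t. t * v t + \<xi> * v t)" by (intro sq_int_on_add sq_int_on_cmult v tv)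
  then have "set_integrable lborel {0<..} (\<lambda>t. (t * v t + \<xi> * v t)\<^sup>2)" by (simp add: sq_int_on_def)
  then show "set_integrable lborel {0<..} (\<lambda>t. (t + \<xi>)\<^sup>2 * (v t)\<^sup>2)"
    by (simp add: distrib_right[symmetric] power_mult_distrib)
  have "set_integrable lborel {0<..} (\<lambda>t. (t * v t + \<xi> * v t) * v t)" by (rule sq_int_on_mult_integrable[OF t v])
  then show "set_integrable lborel {0<..} (\<lambda>t. (t + \<xi>) * (v t)\<^sup>2)"
    by (simp add: power2_eq_square algebra_simps)
qed

text \<open>A nonzero limit would make a positive constant integrable on a half-line. This removes
  the boundary term at infinity in \<open>picone\<close>.\<close>

lemma integrable_tendsto_zero:
  fixes B :: "real \<Rightarrow> real"
  assumes i: "set_integrable lborel {0<..} B" and l: "(B \<longlongrightarrow> L) at_top"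
  shows "L = 0"
proof (rule ccontr)
  assume "L \<noteq> 0"
  then have "((\<lambda>t. \<bar>B t\<bar>) \<longlongrightarrow> \<bar>L\<bar>) at_top" "\<bar>L\<bar> / 2 < \<bar>L\<bar>" using l by (auto intro: tendsto_rabs)
  then have "eventually (\<lambda>t. \<bar>B t\<bar> > \<bar>L\<bar> / 2) at_top" by (rule order_tendstoD(1))
  then obtain n where n: "\<And>t. t \<ge> n \<Longrightarrow> \<bar>B t\<bar> > \<bar>L\<bar> / 2" unfolding eventually_at_top_linorder by blast
  define m where "m = max n 1"
  have "set_integrable lborel {m..} B" by (rule set_integrable_subset[OF i]) (auto simp: m_def)
  then have "set_integrable lborel {m..} (\<lambda>t. \<bar>L\<bar> / 2)"
    by (rule set_integrable_bound) (use n in \<open>auto simp: m_def set_borel_measurable_def less_imp_le\<close>)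
  then have "set_integrable lborel {m..} (\<lambda>t. (2 / \<bar>L\<bar>) * (\<bar>L\<bar> / 2))" by (rule set_integrable_mult_right)
  then have "integrable lborel (indicat_real {m..})" using \<open>L \<noteq> 0\<close> by (simp add: set_integrable_def)
  then have "emeasure lborel {m..} < \<infinity>" by (simp add: integrable_indicator_iff)
  then obtain K where K: "K \<ge> 0" "emeasure lborel {m..} = ennreal K" by (cases "emeasure lborel {m..}" rule: ennreal_cases) auto
  have "emeasure lborel {m..m + (K + 1)} \<le> emeasure lborel {m..}" by (intro emeasure_mono) auto
  then show False using K by simp
qed

text \<open>By the Riccati equation, the derivative of M v^2 is h^2 + (t + \<xi>)^2 v^2 - l v^2
  minus the square (h - M v)^2. It is integrable, so M v^2 has a limit at infinity, and the limit is
  0 because M v^2 is itself integrable; the endpoint 0 contributes -M(\<xi>) v(0)^2.\<close>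

lemma picone:
  assumes l: "l < 1" and v: "HL v h"
  shows "Qf \<xi> v h = l * Nf v - pcM l \<xi> * (v 0)\<^sup>2 + (LINT t:{0<..}|lborel. (h t - pcM l (t + \<xi>) * v t)\<^sup>2)"
proof -
  let ?M = "\<lambda>t. pcM l (t + \<xi>)" 
  let ?M' = "\<lambda>t. (t + \<xi>)\<^sup>2 - l - (?M t)\<^sup>2"
  let ?f = "\<lambda>t. (h t)\<^sup>2 + (t + \<xi>)\<^sup>2 * (v t)\<^sup>2 - l * (v t)\<^sup>2 - (h t - ?M t * v t)\<^sup>2"
  let ?B = "\<lambda>t. ?M t * (v t * v t)"
  have Hv: "in_H1_pos v h" and w: "weak_deriv_on {0..} v h" using v by (auto simp: HL_def)
  have sv: "sq_int_on {0<..} v" and sh: "sq_int_on {0<..} h" and stv: "sq_int_on {0<..} (\<lambda>t. t * v t)"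
    using Hv by (auto simp: in_H1_pos_def)
  have dM: "(?M has_real_derivative ?M' t) (at t)" for t
    using pcM_deriv[OF l, of "t + \<xi>"] DERIV_shift[where f="pcM l" and x=t and z=\<xi>] by blast
  have cM: "continuous_on UNIV ?M" by (intro continuous_at_imp_continuous_on ballI DERIV_isCont[OF dM])
  have wM: "weak_deriv_on {0..} ?M ?M'"
    by (rule weak_deriv_on_C1[OF dM]) (intro continuous_intros cM)
  obtain C where C: "C \<ge> 0" "\<And>t. t \<ge> 0 \<Longrightarrow> \<bar>?M t\<bar> \<le> C * (1 + t)"
    using pcM_linear_bound[OF l] by blast
  have sMv: "sq_int_on {0<..} (\<lambda>t. ?M t * v t)"
    unfolding sq_int_on_def
  proof
    have mv: "(\<lambda>t. indicat_real {0<..} t * v t) \<in> borel_measurable lborel"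
      using sv by (auto simp: sq_int_on_def set_borel_measurable_def)
    have mM: "(\<lambda>t. ?M t * (indicat_real {0<..} t * v t)) \<in> borel_measurable lborel"
      using borel_measurable_times[OF _ mv, of ?M] borel_measurable_continuous_onI[OF cM] by simp
    then show "set_borel_measurable lborel {0<..} (\<lambda>t. ?M t * v t)"
      by (simp add: set_borel_measurable_def mult_ac)
    have "set_integrable lborel {0<..} (\<lambda>t. C\<^sup>2 * ((t + 1)\<^sup>2 * (v t)\<^sup>2))"
      by (intro set_integrable_mult_right in_H1_pos_integrable(3)[OF Hv])
    then show "set_integrable lborel {0<..} (\<lambda>t. (?M t * v t)\<^sup>2)"
    proof (rule set_integrable_bound)
      have "(\<lambda>t. (?M t * (indicat_real {0<..} t * v t))\<^sup>2) \<in> borel_measurable lborel"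
        by (intro borel_measurable_power mM)
      also have "(\<lambda>t. (?M t * (indicat_real {0<..} t * v t))\<^sup>2) = (\<lambda>t. indicat_real {0<..} t *\<^sub>R (?M t * v t)\<^sup>2)"
        by (auto simp: indicator_def)
      finally show "set_borel_measurable lborel {0<..} (\<lambda>t. (?M t * v t)\<^sup>2)" by (simp add: set_borel_measurable_def)
      show "AE t in lborel. t \<in> {0<..} \<longrightarrow> norm ((?M t * v t)\<^sup>2) \<le> norm (C\<^sup>2 * ((t + 1)\<^sup>2 * (v t)\<^sup>2))"
      proof (intro AE_I2 impI)
        fix t :: real assume "t \<in> {0<..}"
        then have "\<bar>?M t\<bar>\<^sup>2 \<le> (C * (1 + t))\<^sup>2" using C(2)[of t] by (intro power_mono) auto
        then have "(?M t)\<^sup>2 * (v t)\<^sup>2 \<le> (C * (1 + t))\<^sup>2 * (v t)\<^sup>2" by (intro mult_right_mono) auto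
        then show "norm ((?M t * v t)\<^sup>2) \<le> norm (C\<^sup>2 * ((t + 1)\<^sup>2 * (v t)\<^sup>2))"
          by (simp add: power_mult_distrib add.commute[of 1 t] mult.assoc)
      qed
    qed
  qed
  have sd: "sq_int_on {0<..} (\<lambda>t. h t - ?M t * v t)"
    using sq_int_on_add[OF sh sq_int_on_cmult[OF sMv, of "-1"]] by simp
  then have id: "set_integrable lborel {0<..} (\<lambda>t. (h t - ?M t * v t)\<^sup>2)" by (simp add: sq_int_on_def)
  note i = in_H1_pos_integrable[OF Hv]
  have iq: "set_integrable lborel {0<..} (\<lambda>t. (h t)\<^sup>2 + (t + \<xi>)\<^sup>2 * (v t)\<^sup>2)" by (intro set_integral_add i)
  have ifo: "set_integrable lborel {0<..} ?f"
    by (intro set_integral_diff set_integrable_mult_right iq i id)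
  then have ifc: "set_integrable lborel {0..} ?f"
    by (rule set_integrable_discrete_difference[of "{0}", THEN iffD1, rotated -1]) auto
  have iB: "set_integrable lborel {0<..} ?B"
    using sq_int_on_mult_integrable[OF sMv sv] by (simp add: mult.assoc)
  have feq: "?f = (\<lambda>t. ?M t * (v t * h t + v t * h t) + (v t * v t) * ?M' t)"
  proof
    fix t
    have "(h' :: real)\<^sup>2 + X * w\<^sup>2 - l * w\<^sup>2 - (h' - m * w)\<^sup>2 = m * (w * h' + w * h') + w * w * (X - l - m\<^sup>2)" for h' X w m
      by algebra
    then show "?f t = ?M t * (v t * h t + v t * h t) + (v t * v t) * ?M' t" .
  qed
  have wB: "weak_deriv_on {0..} ?B ?f"
    unfolding feq by (rule weak_deriv_on_mult[OF wM weak_deriv_on_mult[OF w w]])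
  have "((\<lambda>T. LINT t:{0..T}|lborel. ?f t) \<longlongrightarrow> (LINT t:{0..}|lborel. ?f t)) at_top"
    by (rule tendsto_set_lebesgue_integral_at_top[OF _ ifc]) auto
  then have "((\<lambda>T. ?B 0 + (LINT t:{0..T}|lborel. ?f t)) \<longlongrightarrow> ?B 0 + (LINT t:{0..}|lborel. ?f t)) at_top"
    by (intro tendsto_intros)
  moreover have "eventually (\<lambda>T. ?B 0 + (LINT t:{0..T}|lborel. ?f t) = ?B T) at_top"
    using eventually_ge_at_top[of 0]
  proof eventually_elim
    case (elim T)
    then have "?B T - ?B 0 = (LINT t:{0..T}|lborel. ?f t)"
      using wB[unfolded weak_deriv_on_def, THEN bspec, of 0, THEN bspec, of T] by auto
    then show ?case by simp
  qed
  ultimately have "(?B \<longlongrightarrow> ?B 0 + (LINT t:{0..}|lborel. ?f t)) at_top" by (rule Lim_transform_eventually)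
  then have "?B 0 + (LINT t:{0..}|lborel. ?f t) = 0" by (rule integrable_tendsto_zero[OF iB])
  moreover have "(LINT t:{0..}|lborel. ?f t) = (LINT t:{0<..}|lborel. ?f t)"
    by (rule set_integral_discrete_difference[of "{0}"]) auto
  moreover have "(LINT t:{0<..}|lborel. ?f t) = Qf \<xi> v h - l * Nf v - (LINT t:{0<..}|lborel. (h t - ?M t * v t)\<^sup>2)"
    unfolding Qf_def Nf_def
    unfolding set_integral_diff(2)[OF set_integral_diff(1)[OF iq set_integrable_mult_right[OF i(1), of l]] id]
      set_integral_diff(2)[OF iq set_integrable_mult_right[OF i(1), of l]] set_integral_mult_right by (rule refl)
  ultimately have "?B 0 + (Qf \<xi> v h - l * Nf v - (LINT t:{0<..}|lborel. (h t - ?M t * v t)\<^sup>2)) = 0" by metis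
  moreover have "?B 0 = pcM l \<xi> * (v 0)\<^sup>2" by (simp add: power2_eq_square)
  ultimately show ?thesis by linarith
qed

lemma picone_le:
  assumes l: "l < 1" and v: "HL v h"
  shows "l * Nf v - pcM l \<xi> * (v 0)\<^sup>2 \<le> Qf \<xi> v h"
proof -
  have "(LINT t:{0<..}|lborel. (h t - pcM l (t + \<xi>) * v t)\<^sup>2) \<ge> 0"
    unfolding set_lebesgue_integral_def by (intro Bochner_Integration.integral_nonneg) auto
  then show ?thesis using picone[OF assms] by simp
qed

section \<open>Half-line ground profiles and the Neumann problem\<close>

text \<open>Scaled to the value 1 at the origin, so that any two profiles can be glued there and the
  slope at 0 is \<open>pcM l \<xi>\<close>.\<close>

definition pf :: "real \<Rightarrow> real \<Rightarrow> real \<Rightarrow> real" where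
  "pf l \<xi> t = pcF l (t + \<xi>) / pcF l \<xi>"

definition pg :: "real \<Rightarrow> real \<Rightarrow> real \<Rightarrow> real" where
  "pg l \<xi> t = pcM l (t + \<xi>) * pf l \<xi> t"

definition pcR :: "real \<Rightarrow> real \<Rightarrow> real" where
  "pcR l \<xi> = Nf (pf l \<xi>)"

lemma pf_pos: "l < 1 \<Longrightarrow> pf l \<xi> t > 0"
  by (simp add: pf_def pcF_pos)

lemma pf_0: "l < 1 \<Longrightarrow> pf l \<xi> 0 = 1"
  using pcF_pos[of l \<xi>] by (simp add: pf_def)

lemma pf_deriv:
  assumes l: "l < 1"
  shows "(pf l \<xi> has_real_derivative pg l \<xi> t) (at t)"
proof -
  have "((\<lambda>t. pcF l (t + \<xi>)) has_real_derivative pcM l (t + \<xi>) * pcF l (t + \<xi>)) (at t)"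
    using pcF_deriv[OF l, of "t + \<xi>"] DERIV_shift[where f="pcF l" and x=t and z=\<xi>] by blast
  then have "((\<lambda>t. pcF l (t + \<xi>) / pcF l \<xi>) has_real_derivative pcM l (t + \<xi>) * pcF l (t + \<xi>) / pcF l \<xi>) (at t)"
    by (rule DERIV_cdivide)
  then show ?thesis by (simp add: pf_def[abs_def] pg_def)
qed

lemma pg_deriv:
  assumes l: "l < 1"
  shows "(pg l \<xi> has_real_derivative ((t + \<xi>)\<^sup>2 - l) * pf l \<xi> t) (at t)"
proof -
  have "((\<lambda>t. pcM l (t + \<xi>)) has_real_derivative (t + \<xi>)\<^sup>2 - l - (pcM l (t + \<xi>))\<^sup>2) (at t)"
    using pcM_deriv[OF l, of "t + \<xi>"] DERIV_shift[where f="pcM l" and x=t and z=\<xi>] by blast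
  from DERIV_mult[OF this pf_deriv[OF l, of \<xi>]]
  have "(pg l \<xi> has_real_derivative ((t + \<xi>)\<^sup>2 - l - (pcM l (t + \<xi>))\<^sup>2) * pf l \<xi> t + pg l \<xi> t * pcM l (t + \<xi>)) (at t)"
    by (simp add: pg_def[abs_def])
  then show ?thesis by (rule DERIV_cong) (simp add: pg_def power2_eq_square algebra_simps)
qed

lemma pf_continuous: "l < 1 \<Longrightarrow> continuous_on S (pf l \<xi>)"
  by (intro continuous_at_imp_continuous_on ballI DERIV_isCont[OF pf_deriv])

lemma pg_continuous: "l < 1 \<Longrightarrow> continuous_on S (pg l \<xi>)"
  by (intro continuous_at_imp_continuous_on ballI DERIV_isCont[OF pg_deriv])

lemma pf_pg_bound:
  assumes l: "l < 1"
  obtains C where "C \<ge> 0" "\<And>t. t \<ge> 0 \<Longrightarrow> \<bar>pf l \<xi> t\<bar> \<le> C * exp (- t)"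
    "\<And>t. t \<ge> 0 \<Longrightarrow> \<bar>pg l \<xi> t\<bar> \<le> C * exp (- t)" "\<And>t. t \<ge> 0 \<Longrightarrow> \<bar>(1 + t) * pf l \<xi> t\<bar> \<le> C * exp (- t)"
proof -
  obtain C1 where C1: "C1 \<ge> 0" "\<And>t. t \<ge> 0 \<Longrightarrow> pcF l (t + \<xi>) \<le> C1 * exp (- 2 * t)"
    using pcF_exp_bound[OF l] by blast
  obtain C2 where C2: "C2 \<ge> 0" "\<And>t. t \<ge> 0 \<Longrightarrow> \<bar>pcM l (t + \<xi>)\<bar> \<le> C2 * (1 + t)"
    using pcM_linear_bound[OF l] by blast
  define D where "D = C1 / pcF l \<xi>"
  have F: "pcF l \<xi> > 0" by (rule pcF_pos[OF l])
  have D: "D \<ge> 0" using C1 F by (simp add: D_def)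
  have f2: "(1 + t) * pf l \<xi> t \<le> D * exp (- t)" if t: "t \<ge> 0" for t
  proof -
    have "pf l \<xi> t \<le> C1 * exp (- 2 * t) / pcF l \<xi>"
      unfolding pf_def using C1(2)[OF t] F by (intro divide_right_mono) auto
    then have "pf l \<xi> t \<le> D * exp (- 2 * t)" by (simp add: D_def)
    then have "(1 + t) * pf l \<xi> t \<le> exp t * (D * exp (- 2 * t))"
      using t pf_pos[OF l, of \<xi> t] exp_ge_add_one_self[of t] by (intro mult_mono) auto
    also have "\<dots> = D * exp (t + - 2 * t)" by (simp only: exp_add mult.left_commute)
    finally show ?thesis by simp
  qed
  have f1: "pf l \<xi> t \<le> D * exp (- t)" if t: "t \<ge> 0" for t
  proof -
    have "1 * pf l \<xi> t \<le> (1 + t) * pf l \<xi> t" using t pf_pos[OF l, of \<xi> t] by (intro mult_right_mono) auto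
    then show ?thesis using f2[OF t] by simp
  qed
  have f3: "\<bar>pg l \<xi> t\<bar> \<le> C2 * D * exp (- t)" if t: "t \<ge> 0" for t
  proof -
    have "\<bar>pg l \<xi> t\<bar> = \<bar>pcM l (t + \<xi>)\<bar> * pf l \<xi> t" using pf_pos[OF l, of \<xi> t] by (simp add: pg_def abs_mult)
    also have "\<dots> \<le> C2 * (1 + t) * pf l \<xi> t" using C2(2)[OF t] pf_pos[OF l, of \<xi> t] by (intro mult_right_mono) auto
    also have "\<dots> \<le> C2 * (D * exp (- t))" unfolding mult.assoc using f2[OF t] C2(1) by (intro mult_left_mono) (auto simp: mult.assoc)
    finally show ?thesis by (simp add: mult.assoc)
  qed
  have m1: "D * exp (- t) \<le> (D + C2 * D) * exp (- t)" "C2 * D * exp (- t) \<le> (D + C2 * D) * exp (- t)" for t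
    using D C2(1) by (auto intro!: mult_right_mono)
  show ?thesis
  proof (rule that[of "D + C2 * D"])
    show "D + C2 * D \<ge> 0" using D C2 by simp
    fix t :: real assume t: "t \<ge> 0"
    show "\<bar>pf l \<xi> t\<bar> \<le> (D + C2 * D) * exp (- t)" using f1[OF t] m1(1)[of t] pf_pos[OF l, of \<xi> t] by linarith
    show "\<bar>pg l \<xi> t\<bar> \<le> (D + C2 * D) * exp (- t)" using f3[OF t] m1(2)[of t] by linarith
    have "(1 + t) * pf l \<xi> t \<ge> 0" using t pf_pos[OF l, of \<xi> t] by simp
    then show "\<bar>(1 + t) * pf l \<xi> t\<bar> \<le> (D + C2 * D) * exp (- t)" using f2[OF t] m1(1)[of t] by linarith
  qed
qed

lemma HL_pf:
  assumes l: "l < 1"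
  shows "HL (pf l \<xi>) (pg l \<xi>)"
proof -
  obtain C where C: "C \<ge> 0" "\<And>t. t \<ge> 0 \<Longrightarrow> \<bar>pf l \<xi> t\<bar> \<le> C * exp (- t)"
    "\<And>t. t \<ge> 0 \<Longrightarrow> \<bar>pg l \<xi> t\<bar> \<le> C * exp (- t)" "\<And>t. t \<ge> 0 \<Longrightarrow> \<bar>(1 + t) * pf l \<xi> t\<bar> \<le> C * exp (- t)"
    using pf_pg_bound[OF l] by metis
  have "\<bar>t * pf l \<xi> t\<bar> \<le> C * exp (- t)" if t: "t \<ge> 0" for t
  proof -
    have "\<bar>t * pf l \<xi> t\<bar> \<le> \<bar>(1 + t) * pf l \<xi> t\<bar>"
      using t pf_pos[OF l, of \<xi> t] by (simp add: abs_mult mult_right_mono)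
    then show ?thesis using C(4)[OF t] by linarith
  qed
  moreover have "continuous_on UNIV (\<lambda>t. t * pf l \<xi> t)" by (intro continuous_intros pf_continuous l)
  ultimately have "sq_int_on {0<..} (\<lambda>t. t * pf l \<xi> t)" by (rule sq_int_on_exp_bound[rotated])
  then show ?thesis
    unfolding HL_def in_H1_pos_def
    using sq_int_on_exp_bound[OF pf_continuous[OF l] C(2)] sq_int_on_exp_bound[OF pg_continuous[OF l] C(3)]
    by (auto intro!: weak_deriv_on_C1 pf_deriv pg_continuous l)
qed

lemma pcR_pos: "l < 1 \<Longrightarrow> pcR l \<xi> > 0"
  unfolding pcR_def Nf_def
proof (rule set_integral_pos)
  assume l: "l < 1"
  show "set_integrable lborel {0<..} (\<lambda>t. (pf l \<xi> t)\<^sup>2)"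
    using HL_pf[OF l] by (auto simp: HL_def intro: in_H1_pos_integrable)
  show "(pf l \<xi> t)\<^sup>2 > 0" for t using pf_pos[OF l, of \<xi> t] by simp
qed

text \<open>The equality case of \<open>picone\<close>: the square vanishes since \<open>pg\<close>
  is M times \<open>pf\<close>.\<close>

lemma Qf_pf:
  assumes l: "l < 1"
  shows "Qf \<xi> (pf l \<xi>) (pg l \<xi>) = l * pcR l \<xi> - pcM l \<xi>"
  using picone[OF l HL_pf[OF l], of \<xi> \<xi>] pf_0[OF l, of \<xi>] by (simp add: pg_def pcR_def set_lebesgue_integral_def)

text \<open>For the profile f with derivative g, the quantity g^2 + l f^2 - (t + \<xi>)^2 f^2 has
  derivative -2 (t + \<xi>) f^2 and decays, so the first moment is read off at the origin. It
  evaluates the Hellmann-Feynman derivative of \<open>mu\<close> by boundary data.\<close>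

lemma Tf_pf:
  assumes l: "l < 1"
  shows "2 * Tf \<xi> (pf l \<xi>) = (pcM l \<xi>)\<^sup>2 + l - \<xi>\<^sup>2"
proof -
  let ?f = "pf l \<xi>" and ?g = "pg l \<xi>"
  let ?Y = "\<lambda>t. (?g t)\<^sup>2 + l * (?f t)\<^sup>2 - ((t + \<xi>) * ?f t)\<^sup>2"
  have "(LINT t:{0<..}|lborel. (-2) * ((t + \<xi>) * (?f t)\<^sup>2)) = 0 - ((pcM l \<xi>)\<^sup>2 + l - \<xi>\<^sup>2)"
  proof (rule set_integral_FTC_halfline[where F="?Y"])
    fix t :: real
    have "(?Y has_real_derivative (2 * ?g t * (((t + \<xi>)\<^sup>2 - l) * ?f t) + l * (2 * ?f t * ?g t)
        - 2 * ((t + \<xi>) * ?f t) * (1 * ?f t + ?g t * (t + \<xi>)))) (at t)"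
      by (auto intro!: derivative_eq_intros pf_deriv pg_deriv l simp: power2_eq_square algebra_simps)
    then show "(?Y has_real_derivative (-2) * ((t + \<xi>) * (?f t)\<^sup>2)) (at t)"
      by (rule DERIV_cong) (simp add: power2_eq_square algebra_simps)
    show "isCont (\<lambda>t. (-2) * ((t + \<xi>) * (?f t)\<^sup>2)) t"
      by (intro continuous_intros DERIV_isCont[OF pf_deriv[OF l]])
  next
    show "set_integrable lborel {0<..} (\<lambda>t. (-2) * ((t + \<xi>) * (?f t)\<^sup>2))"
      using HL_pf[OF l, of \<xi>] by (intro set_integrable_mult_right in_H1_pos_integrable) (auto simp: HL_def)
    have fg: "(?f \<longlongrightarrow> ?f 0) (at_right 0)" "(?g \<longlongrightarrow> ?g 0) (at_right 0)"
      using DERIV_isCont[OF pf_deriv[OF l, of \<xi> 0]] DERIV_isCont[OF pg_deriv[OF l, of \<xi> 0]]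
      by (auto simp: isCont_def intro: tendsto_within_subset)
    have "(?Y \<longlongrightarrow> (?g 0)\<^sup>2 + l * (?f 0)\<^sup>2 - ((0 + \<xi>) * ?f 0)\<^sup>2) (at_right 0)"
      by (intro tendsto_intros fg)
    moreover have "?g 0 = pcM l \<xi>" using pf_0[OF l, of \<xi>] by (simp add: pg_def)
    ultimately show "(?Y \<longlongrightarrow> (pcM l \<xi>)\<^sup>2 + l - \<xi>\<^sup>2) (at_right 0)" using pf_0[OF l, of \<xi>] by simp
    obtain C where C: "C \<ge> 0" "\<And>t. t \<ge> 0 \<Longrightarrow> \<bar>?f t\<bar> \<le> C * exp (- t)"
      "\<And>t. t \<ge> 0 \<Longrightarrow> \<bar>?g t\<bar> \<le> C * exp (- t)" "\<And>t. t \<ge> 0 \<Longrightarrow> \<bar>(1 + t) * ?f t\<bar> \<le> C * exp (- t)"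
      using pf_pg_bound[OF l] by metis
    have e: "((\<lambda>t::real. C * exp (- t)) \<longlongrightarrow> 0) at_top" by real_asymp
    have z: "(u \<longlongrightarrow> 0) at_top" if "\<And>t. t \<ge> 0 \<Longrightarrow> \<bar>u t\<bar> \<le> C * exp (- t)" for u :: "real \<Rightarrow> real"
      by (rule Lim_null_comparison[OF eventually_mono[OF eventually_ge_at_top[of 0]] e]) (use that in auto)
    note t1 = z[OF C(2)] and t2 = z[OF C(3)] and t3 = z[OF C(4)]
    \<comment> \<open>Writing t + \<xi> as (1 + t) + (\<xi> - 1) reuses the decay of (1 + t)
      f.\<close>
    have "((\<lambda>t. (?g t)\<^sup>2 + l * (?f t)\<^sup>2 - ((1 + t) * ?f t + (\<xi> - 1) * ?f t)\<^sup>2) \<longlongrightarrow> 0\<^sup>2 + l * 0\<^sup>2 - (0 + (\<xi> - 1) * 0)\<^sup>2) at_top"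
      by (intro tendsto_intros t1 t2 t3)
    then show "(?Y \<longlongrightarrow> 0) at_top" by (simp add: algebra_simps)
  qed
  then show ?thesis unfolding Tf_def set_integral_mult_right by simp
qed

text \<open>Dominated convergence. As J_s decreases in x, a profile lies below the quotient of its
  Gaussian factors, exp (-Y t - t^2/2), and the common lower bound -B on the shifts gives the
  majorant exp (2Bt - t^2) for its square, which is \<open>pcw 1 (- B)\<close>.\<close>

lemma pcR_tendsto:
  fixes X Y :: "nat \<Rightarrow> real"
  assumes X: "X \<longlonglongrightarrow> l" and Y: "Y \<longlonglongrightarrow> x" and l: "l < 1" and Xl: "\<And>n. X n < 1" and YB: "\<And>n. Y n \<ge> - B"
  shows "(\<lambda>n. pcR (X n) (Y n)) \<longlonglongrightarrow> pcR l x"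
  unfolding pcR_def Nf_def set_lebesgue_integral_def
proof (rule integral_dominated_convergence[where w="\<lambda>t. indicator {0<..} t *\<^sub>R pcw 1 (- B) t"])
  show "integrable lborel (\<lambda>t. indicat_real {0<..} t *\<^sub>R pcw 1 (- B) t)"
    using pcw_integrable[of 1 "-B"] by (simp add: set_integrable_def)
  have m: "(\<lambda>t. indicator {0<..} t *\<^sub>R (pf l' x' t)\<^sup>2) \<in> borel_measurable lborel" if "l' < 1" for l' x'
    using borel_measurable_continuous_onI[OF pf_continuous[OF that, of UNIV x']] by simp
  show "(\<lambda>t. indicator {0<..} t *\<^sub>R (pf l x t)\<^sup>2) \<in> borel_measurable lborel" by (rule m[OF l])
  show "(\<lambda>t. indicator {0<..} t *\<^sub>R (pf (X n) (Y n) t)\<^sup>2) \<in> borel_measurable lborel" for n by (rule m[OF Xl])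
  show "AE t in lborel. (\<lambda>n. indicator {0<..} t *\<^sub>R (pf (X n) (Y n) t)\<^sup>2) \<longlonglongrightarrow> indicator {0<..} t *\<^sub>R (pf l x t)\<^sup>2"
  proof (intro AE_I2 tendsto_intros)
    fix t
    show "(\<lambda>n. pf (X n) (Y n) t) \<longlonglongrightarrow> pf l x t"
      unfolding pf_def pcF_def
      by (intro tendsto_intros pcJ_tendsto X Y) (use l pcJ_half_pos(1)[OF l, of x] in auto)
  qed
  show "AE t in lborel. norm (indicator {0<..} t *\<^sub>R (pf (X n) (Y n) t)\<^sup>2) \<le> indicator {0<..} t *\<^sub>R pcw 1 (- B) t" for n
  proof (intro AE_I2)
    fix t :: real
    show "norm (indicator {0<..} t *\<^sub>R (pf (X n) (Y n) t)\<^sup>2) \<le> indicator {0<..} t *\<^sub>R pcw 1 (- B) t"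
    proof (cases "t > 0")
      case t: True
      let ?s = "(1 - X n) / 2"
      have s: "?s > 0" using Xl[of n] by simp
      have j: "pcJ ?s (t + Y n) / pcJ ?s (Y n) \<le> 1"
        using pcJ_antimono[OF s, of "Y n" "t + Y n"] pcJ_pos[OF s, of "Y n"] t by simp
      have "pf (X n) (Y n) t = exp (- (t + Y n)\<^sup>2 / 2) / exp (- (Y n)\<^sup>2 / 2) * (pcJ ?s (t + Y n) / pcJ ?s (Y n))"
        by (simp add: pf_def pcF_def)
      also have "\<dots> \<le> exp (- (t + Y n)\<^sup>2 / 2) / exp (- (Y n)\<^sup>2 / 2) * 1"
        by (intro mult_left_mono j) simp
      also have "\<dots> = exp (- (t + Y n)\<^sup>2 / 2 + (Y n)\<^sup>2 / 2)" by (simp add: exp_diff[symmetric])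
      also have "\<dots> \<le> exp (B * t - t\<^sup>2 / 2)"
      proof -
        have "- Y n * t \<le> B * t" using YB[of n] t by (intro mult_right_mono) auto
        moreover have "- (t + Y n)\<^sup>2 / 2 + (Y n)\<^sup>2 / 2 = - Y n * t - t\<^sup>2 / 2"
          by (simp add: power2_eq_square field_simps)
        ultimately show ?thesis by simp
      qed
      finally have "(pf (X n) (Y n) t)\<^sup>2 \<le> (exp (B * t - t\<^sup>2 / 2))\<^sup>2"
        using pf_pos[OF Xl, of n "Y n" t] by (intro power_mono) auto
      also have "\<dots> = pcw 1 (- B) t" using t by (simp add: pcw_def exp_double[symmetric] algebra_simps)
      finally show ?thesis using t by simp
    qed simp
  qed
qed

section \<open>Restriction, modification and extension of weakly differentiable functions\<close>

lemma weak_deriv_onD: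
  assumes "weak_deriv_on I u g" "x \<in> I" "y \<in> I" "x \<le> y"
  shows "set_integrable lborel {x..y} g" "u y - u x = (LINT t:{x..y}|lborel. g t)"
  using assms(1)[unfolded weak_deriv_on_def, rule_format, OF assms(2-4)] by simp_all

lemma weak_deriv_onI:
  assumes "\<And>x y. x \<in> I \<Longrightarrow> y \<in> I \<Longrightarrow> x \<le> y \<Longrightarrow> set_integrable lborel {x..y} g"
    "\<And>x y. x \<in> I \<Longrightarrow> y \<in> I \<Longrightarrow> x \<le> y \<Longrightarrow> u y - u x = (LINT t:{x..y}|lborel. g t)"
  shows "weak_deriv_on I u g"
  unfolding weak_deriv_on_def using assms by simp

lemma weak_deriv_on_subset: 
  assumes "weak_deriv_on I u g" "J \<subseteq> I" 
  shows "weak_deriv_on J u g"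
  by (rule weak_deriv_onI) (rule weak_deriv_onD[OF assms(1)]; use assms(2) in auto)+

lemma weak_deriv_split:
  assumes ab: "weak_deriv_on {a..b} u g" and bc: "weak_deriv_on {b..c} u g" and "a \<le> b" "b \<le> c"
  shows "set_integrable lborel {a..c} g" "u c - u a = (LINT t:{a..c}|lborel. g t)"
proof -
  have i: "set_integrable lborel {a..b} g" "set_integrable lborel {b..c} g"
    using \<open>a \<le> b\<close> \<open>b \<le> c\<close> by (auto intro: weak_deriv_onD(1)[OF ab] weak_deriv_onD(1)[OF bc])
  have e1: "u b - u a = (LINT t:{a..b}|lborel. g t)"
    by (rule weak_deriv_onD(2)[OF ab]) (use \<open>a \<le> b\<close> in auto)
  have e2: "u c - u b = (LINT t:{b..c}|lborel. g t)"
    by (rule weak_deriv_onD(2)[OF bc]) (use \<open>b \<le> c\<close> in auto)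
  have U: "{a..c} = {a..b} \<union> {b..c}" using assms by auto
  show "set_integrable lborel {a..c} g" unfolding U by (intro set_integrable_Un i) auto
  have "AE t in lborel. t \<noteq> b" by (rule AE_lborel_singleton)
  then have "AE t in lborel. \<not> (t \<in> {a..b} \<and> t \<in> {b..c})" by eventually_elim auto
  then have "(LINT t:{a..c}|lborel. g t) = (LINT t:{a..b}|lborel. g t) + (LINT t:{b..c}|lborel. g t)"
    unfolding U by (intro set_integral_Un_AE i) auto
  then show "u c - u a = (LINT t:{a..c}|lborel. g t)" using e1 e2 by linarith
qed

text \<open>The exceptional point c serves gluing at the origin, where the derivative is left
  arbitrary.\<close>

lemma weak_deriv_on_cong:
  assumes "weak_deriv_on I u g" "\<And>x. x \<in> I \<Longrightarrow> u x = u' x" "\<And>x. x \<noteq> c \<Longrightarrow> g' x = g x \<or> x \<notin> I" "is_interval I"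
  shows "weak_deriv_on I u' g'"
  unfolding weak_deriv_on_def
proof (intro ballI impI)
  fix x y assume xy: "x \<in> I" "y \<in> I" "x \<le> y"
  then have sub: "{x..y} \<subseteq> I" by (meson assms(4) atLeastAtMost_iff is_interval_1 subsetI)
  have d: "set_integrable lborel {x..y} f \<longleftrightarrow> set_integrable lborel ({x..y} - {c}) f"
    "(LINT t:{x..y}|lborel. f t) = (LINT t:({x..y} - {c})|lborel. f t)" for f :: "real \<Rightarrow> real"
    subgoal by (rule set_integrable_discrete_difference[of "{c}"]) auto
    subgoal by (rule set_integral_discrete_difference[of "{c}"]) auto
    done
  have gg: "g' t = g t" if "t \<in> {x..y} - {c}" for t using assms(3)[of t] that sub by auto
  have "set_integrable lborel ({x..y} - {c}) g' = set_integrable lborel ({x..y} - {c}) g"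
    by (rule set_integrable_cong) (auto simp: gg)
  moreover have "(LINT t:({x..y} - {c})|lborel. g' t) = (LINT t:({x..y} - {c})|lborel. g t)"
    by (rule set_lebesgue_integral_cong) (auto simp: gg)
  moreover have "set_integrable lborel {x..y} g \<and> u y - u x = (LINT t:{x..y}|lborel. g t)"
    using weak_deriv_onD[OF assms(1) xy] by simp
  ultimately show "set_integrable lborel {x..y} g' \<and> u' y - u' x = (LINT t:{x..y}|lborel. g' t)"
    using d[of g] d[of g'] assms(2) xy by auto
qed

lemma sq_int_on_cong:
  assumes "sq_int_on S u" "\<And>x. x \<in> S \<Longrightarrow> u x = u' x"
  shows "sq_int_on S u'"
proof -
  have "(\<lambda>x. indicator S x *\<^sub>R u x) = (\<lambda>x. indicator S x *\<^sub>R u' x)"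
    "(\<lambda>x. indicator S x *\<^sub>R (u x)\<^sup>2) = (\<lambda>x. indicator S x *\<^sub>R (u' x)\<^sup>2)"
    using assms(2) by (auto simp: fun_eq_iff indicator_def)
  then show ?thesis using assms(1) by (simp add: sq_int_on_def set_borel_measurable_def set_integrable_def)
qed

lemma HL_cong:
  assumes "HL v h" "\<And>t. t \<ge> 0 \<Longrightarrow> v t = v' t" "\<And>t. t > 0 \<Longrightarrow> h t = h' t"
  shows "HL v' h'"
proof -
  have w: "weak_deriv_on {0..} v' h'"
    by (rule weak_deriv_on_cong[where c=0 and u=v and g=h])
      (use assms in \<open>auto simp: HL_def is_interval_ci\<close>)
  then have "weak_deriv_on {0<..} v' h'" by (rule weak_deriv_on_subset) auto
  with w show ?thesis using assms
    by (auto simp: HL_def in_H1_pos_def intro: sq_int_on_cong)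
qed

lemma Nf_cong: "(\<And>t. t > 0 \<Longrightarrow> v t = v' t) \<Longrightarrow> Nf v = Nf v'"
  unfolding Nf_def by (rule set_lebesgue_integral_cong) auto

lemma Qf_cong: "(\<And>t. t > 0 \<Longrightarrow> v t = v' t) \<Longrightarrow> (\<And>t. t > 0 \<Longrightarrow> h t = h' t) \<Longrightarrow> Qf \<xi> v h = Qf \<xi> v' h'"
  unfolding Qf_def by (rule set_lebesgue_integral_cong) auto

text \<open>Square integrability makes h integrable on (0,1], so v tends at 0 to v(1) minus the
  integral of h. \<open>picone\<close> needs this trace, whereas the Neumann form domain lives on
  the open half-line.\<close>

lemma in_H1_pos_extend:
  assumes H: "in_H1_pos v h"
  obtains v' where "HL v' h" "\<And>t. t > 0 \<Longrightarrow> v' t = v t"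
proof -
  have w: "weak_deriv_on {0<..} v h" and sh: "sq_int_on {0<..} h" using H by (auto simp: in_H1_pos_def)
  have sub: "sq_int_on {0<..1} h"
    using sh unfolding sq_int_on_def
    by (auto intro: set_borel_measurable_subset set_integrable_subset)
  have one: "sq_int_on {0<..1} (\<lambda>t. 1 :: real)"
    by (auto simp: sq_int_on_def set_borel_measurable_def set_integrable_def)
  have "set_integrable lborel {0<..1} h" using sq_int_on_mult_integrable[OF sub one] by simp
  then have i01: "set_integrable lborel {0..1} h"
    by (rule set_integrable_discrete_difference[of "{0}", THEN iffD1, rotated -1]) auto
  define v' where "v' t = (if t > 0 then v t else v 1 - (LINT t:{0..1}|lborel. h t))" for t
  have w': "weak_deriv_on {0<..} v' h"
    by (rule weak_deriv_on_cong[where c=0 and u=v and g=h, OF w]) (auto simp: v'_def is_interval_oi)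
  have i0: "set_integrable lborel {0..y} h" if "y > 0" for y
  proof (cases "y \<le> 1")
    case True
    show ?thesis by (rule set_integrable_subset[OF i01]) (use True in auto)
  next
    case False
    have "set_integrable lborel {1..y} h" by (rule weak_deriv_onD[OF w]) (use False in auto)
    then have "set_integrable lborel ({0..1} \<union> {1..y}) h" by (intro set_integrable_Un i01) auto
    moreover have "{0..1} \<union> {1..y} = {0..y}" using False by auto
    ultimately show ?thesis by simp
  qed
  have un: "(LINT t:{0..c}|lborel. h t) = (LINT t:{0..b}|lborel. h t) + (v c - v b)" if "0 < b" "b \<le> c" for b c
  proof -
    have U: "{0..c} = {0..b} \<union> {b..c}" using that by auto
    have i: "set_integrable lborel {b..c} h" by (rule weak_deriv_onD[OF w]) (use that in auto)
    have e: "v c - v b = (LINT t:{b..c}|lborel. h t)" by (rule weak_deriv_onD[OF w]) (use that in auto)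
    have "AE t in lborel. t \<noteq> b" by (rule AE_lborel_singleton)
    then have "AE t in lborel. \<not> (t \<in> {0..b} \<and> t \<in> {b..c})" by eventually_elim auto
    then show ?thesis unfolding U e by (intro set_integral_Un_AE i i0 that) auto
  qed
  have "weak_deriv_on {0..} v' h"
    unfolding weak_deriv_on_def
  proof (intro ballI impI)
    fix x y :: real assume xy: "x \<in> {0..}" "y \<in> {0..}" "x \<le> y"
    consider "x > 0" | "x = 0" "y = 0" | "x = 0" "y > 0" using xy by force
    then show "set_integrable lborel {x..y} h \<and> v' y - v' x = (LINT t:{x..y}|lborel. h t)"
    proof cases
      case 1
      then show ?thesis using weak_deriv_onD[OF w', of x y] xy by simp
    next
      case 2
      have "set_integrable lborel {0..0} h" by (rule set_integrable_subset[OF i01]) auto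
      moreover have "(LINT t:{0..0}|lborel. h t) = (LINT t:{}|lborel. h t)"
        by (rule set_integral_discrete_difference[of "{0}"]) auto
      ultimately show ?thesis using 2 by (simp add: set_lebesgue_integral_def)
    next
      case 3
      have "(LINT t:{0..y}|lborel. h t) = (LINT t:{0..1}|lborel. h t) + (v y - v 1)"
      proof (cases "y \<le> 1")
        case True
        have "(LINT t:{0..1}|lborel. h t) = (LINT t:{0..y}|lborel. h t) + (v 1 - v y)"
          by (rule un) (use 3 True in auto)
        then show ?thesis by linarith
      qed (rule un, auto)
      then show ?thesis using i0[of y] 3 by (simp add: v'_def)
    qed
  qed
  moreover have "in_H1_pos v' h"
    using H w' by (auto simp: in_H1_pos_def v'_def intro: sq_int_on_cong)
  ultimately show ?thesis by (intro that[of v']) (auto simp: HL_def v'_def)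
qed

section \<open>Comparison with the de Gennes constant\<close>

lemma Nf_nonneg: "Nf v \<ge> 0"
  unfolding Nf_def set_lebesgue_integral_def by (intro Bochner_Integration.integral_nonneg) auto

lemma Qf_nonneg: "Qf \<xi> v h \<ge> 0"
  unfolding Qf_def set_lebesgue_integral_def by (intro Bochner_Integration.integral_nonneg) auto

lemma lambdaN_eq: "lambdaN \<xi> = Inf {Qf \<xi> u g / Nf u | u g. in_H1_pos u g \<and> Nf u \<noteq> 0}"
  by (simp add: lambdaN_def Qf_def Nf_def)

lemma Rayleigh_N_nonempty: "{Qf \<xi> u g / Nf u | u g. in_H1_pos u g \<and> Nf u \<noteq> 0} \<noteq> {}"
  using HL_pf[of 0 \<xi>] pcR_pos[of 0 \<xi>] unfolding pcR_def HL_def by force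

lemma lambdaN_nonneg: "lambdaN \<xi> \<ge> 0"
  unfolding lambdaN_eq by (rule cInf_greatest[OF Rayleigh_N_nonempty]) (auto simp: Nf_nonneg Qf_nonneg)

lemma Theta0_le:
  assumes "HL v h" "Nf v > 0"
  shows "Theta0 * Nf v \<le> Qf \<xi> v h"
proof -
  have "Theta0 \<le> lambdaN \<xi>" unfolding Theta0_def
    by (rule cINF_lower) (auto intro!: bdd_belowI[of _ 0] lambdaN_nonneg)
  also have "\<dots> \<le> Qf \<xi> v h / Nf v"
    unfolding lambdaN_eq
  proof (rule cInf_lower)
    show "Qf \<xi> v h / Nf v \<in> {Qf \<xi> u g / Nf u |u g. in_H1_pos u g \<and> Nf u \<noteq> 0}"
      using assms by (intro CollectI exI[of _ v] exI[of _ h]) (auto simp: HL_def)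
  qed (auto simp: Nf_nonneg Qf_nonneg intro!: bdd_belowI[of _ 0])
  finally show ?thesis using assms(2) by (simp add: field_simps)
qed

text \<open>Pick \<xi> with \<open>lambdaN \<xi> < l\<close> and a test function whose quotient is
  below l; \<open>picone_le\<close> then forces M(\<xi>) v(0)^2 > 0.\<close>

lemma Theta0_less_pcM:
  assumes "Theta0 < l" "l < 1"
  shows "\<exists>\<xi>. pcM l \<xi> > 0"
proof -
  have "\<exists>\<xi>. lambdaN \<xi> < l"
  proof (rule ccontr)
    assume "\<not> ?thesis"
    then have "l \<le> Theta0" unfolding Theta0_def by (intro cINF_greatest) (auto simp: not_less)
    then show False using assms by simp
  qed
  then obtain \<xi> where "lambdaN \<xi> < l" by blast
  then obtain u g where ug: "in_H1_pos u g" "Nf u \<noteq> 0" "Qf \<xi> u g / Nf u < l"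
    unfolding lambdaN_eq using cInf_lessD[OF Rayleigh_N_nonempty] by blast
  obtain v where v: "HL v g" "\<And>t. t > 0 \<Longrightarrow> v t = u t" using in_H1_pos_extend[OF ug(1)] by blast
  have "Nf v = Nf u" "Qf \<xi> v g = Qf \<xi> u g" using v(2) by (auto intro: Nf_cong Qf_cong)
  moreover have "Qf \<xi> u g < l * Nf u" using ug(2,3) Nf_nonneg[of u] by (simp add: divide_less_eq)
  ultimately have "pcM l \<xi> * (v 0)\<^sup>2 > 0" using picone_le[OF assms(2) v(1), of \<xi>] by simp
  then show ?thesis by (auto simp: zero_less_mult_iff not_less)
qed

section \<open>Splitting the line at the origin\<close>

text \<open>At t = -r/k one has \<xi> - k^2 t = k (r + \<xi>/k), so with this scale the kinetic and
  the potential term on the left acquire the same factor k^2.\<close>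

definition rest :: "real \<Rightarrow> (real \<Rightarrow> real) \<Rightarrow> real \<Rightarrow> real" where
  "rest k v r = v (- r / k)"

definition drest :: "real \<Rightarrow> (real \<Rightarrow> real) \<Rightarrow> real \<Rightarrow> real" where
  "drest k h r = - h (- r / k) / k"

lemma set_integrable_reflect:
  fixes f :: "real \<Rightarrow> real"
  assumes k: "k > 0" and S: "\<And>t. t \<in> S \<longleftrightarrow> - k * t \<in> T"
  shows "set_integrable lborel T (\<lambda>r. f (- r / k)) \<longleftrightarrow> set_integrable lborel S f"
    "(LINT t:S|lborel. f t) = (1 / k) * (LINT r:T|lborel. f (- r / k))"
proof -
  let ?F = "\<lambda>t. indicator S t *\<^sub>R f t"
  have ind: "indicat_real T r = indicator S (- r / k)" for r
    using S[of "- r / k"] k by (simp add: indicator_def)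
  have eq: "(\<lambda>r. indicator T r *\<^sub>R f (- r / k)) = (\<lambda>r. ?F (0 + (- 1 / k) * r))"
    by (simp add: ind)
  show "set_integrable lborel T (\<lambda>r. f (- r / k)) \<longleftrightarrow> set_integrable lborel S f"
    unfolding set_integrable_def eq by (rule lborel_integrable_real_affine_iff) (use k in simp)
  show "(LINT t:S|lborel. f t) = (1 / k) * (LINT r:T|lborel. f (- r / k))"
    unfolding set_lebesgue_integral_def eq
    by (subst lborel_integral_real_affine[of "- 1 / k" _ 0]) (use k in auto)
qed

lemma weak_deriv_on_reflect:
  assumes k: "k > 0" and w: "weak_deriv_on I v h" and J: "\<And>r. r \<in> J \<Longrightarrow> - r / k \<in> I"
  shows "weak_deriv_on J (rest k v) (drest k h)"
proof -
  have *: "set_integrable lborel {x..y} (drest k h) \<and> rest k v y - rest k v x = (LINT t:{x..y}|lborel. drest k h t)"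
    if xy: "x \<in> J" "y \<in> J" "x \<le> y" for x y
  proof -
    have le: "- y / k \<le> - x / k" using xy k by (intro divide_right_mono) auto
    note d = weak_deriv_onD[OF w J[OF xy(2)] J[OF xy(1)] le]
    have S: "t \<in> {- y / k..- x / k} \<longleftrightarrow> - k * t \<in> {x..y}" for t using k by (auto simp: field_simps)
    note R = set_integrable_reflect[OF k S, of h]
    have dr: "drest k h = (\<lambda>r. (- 1 / k) * h (- r / k))" by (simp add: drest_def fun_eq_iff)
    have "set_integrable lborel {x..y} (drest k h)"
      unfolding dr using R(1) d(1) by (intro set_integrable_mult_right) blast
    moreover have "(LINT t:{x..y}|lborel. drest k h t) = - ((1 / k) * (LINT r:{x..y}|lborel. h (- r / k)))"
      unfolding dr set_integral_mult_right by simp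
    ultimately show ?thesis using R(2) d(2) by (simp add: rest_def)
  qed
  show ?thesis by (rule weak_deriv_onI) (use * in blast)+
qed

lemma rest_rest: "k > 0 \<Longrightarrow> rest (1 / k) (rest k v) = v"
  by (simp add: rest_def fun_eq_iff)

lemma drest_drest: "k > 0 \<Longrightarrow> drest (1 / k) (drest k v) = v"
  by (simp add: drest_def fun_eq_iff)

lemma integrable_halves:
  fixes f :: "real \<Rightarrow> real"
  assumes k: "k > 0"
  shows "integrable lborel f \<longleftrightarrow> set_integrable lborel {0<..} f \<and> set_integrable lborel {0<..} (rest k f)"
    "integrable lborel f \<Longrightarrow> (\<integral>t. f t \<partial>lborel) = (LINT t:{0<..}|lborel. f t) + (1 / k) * (LINT r:{0<..}|lborel. rest k f r)"
proof -
  have S: "t \<in> {..<0} \<longleftrightarrow> - k * t \<in> {0<..}" for t using k by (auto simp: mult_less_0_iff)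
  note R = set_integrable_reflect[OF k S, of f, folded rest_def]
  have n: "set_integrable lborel {..0} f \<longleftrightarrow> set_integrable lborel {..<0} f" 
    by (rule set_integrable_discrete_difference[of "{0}"]) auto
  have n2: "(LINT t:{..0}|lborel. f t) = (LINT t:{..<0}|lborel. f t)"
    by (rule set_integral_discrete_difference[of "{0}"]) auto
  have U: "UNIV = {0<..} \<union> {..(0::real)}" by auto
  have i: "integrable lborel f \<longleftrightarrow> set_integrable lborel UNIV f" by (simp add: set_integrable_def)
  have sp: "set_integrable lborel UNIV f \<longleftrightarrow> set_integrable lborel {0<..} f \<and> set_integrable lborel {..0} f"
  proof
    assume "set_integrable lborel UNIV f"
    then show "set_integrable lborel {0<..} f \<and> set_integrable lborel {..0} f" 
      by (auto intro: set_integrable_subset)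
  next
    assume "set_integrable lborel {0<..} f \<and> set_integrable lborel {..0} f"
    then show "set_integrable lborel UNIV f" unfolding U by (intro set_integrable_Un) auto
  qed
  show "integrable lborel f \<longleftrightarrow> set_integrable lborel {0<..} f \<and> set_integrable lborel {0<..} (rest k f)"
    unfolding i sp n R(1) ..
  assume "integrable lborel f"
  then have ii: "set_integrable lborel {0<..} f" "set_integrable lborel {..0} f" using i sp by auto
  have "(\<integral>t. f t \<partial>lborel) = (LINT t:UNIV|lborel. f t)" by (simp add: set_lebesgue_integral_def)
  also have "\<dots> = (LINT t:{0<..}|lborel. f t) + (LINT t:{..0}|lborel. f t)"
    unfolding U by (intro set_integral_Un ii) auto
  finally show "(\<integral>t. f t \<partial>lborel) = (LINT t:{0<..}|lborel. f t) + (1 / k) * (LINT r:{0<..}|lborel. rest k f r)"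
    unfolding n2 R(2) .
qed

lemma measurable_halves:
  fixes f :: "real \<Rightarrow> real"
  assumes k: "k > 0"
  shows "f \<in> borel_measurable borel \<longleftrightarrow> set_borel_measurable lborel {0<..} f \<and> set_borel_measurable lborel {0<..} (rest k f)"
proof
  assume f [measurable]: "f \<in> borel_measurable borel"
  have [measurable]: "rest k f \<in> borel_measurable borel" unfolding rest_def[abs_def] by measurable
  show "set_borel_measurable lborel {0<..} f \<and> set_borel_measurable lborel {0<..} (rest k f)"
    unfolding set_borel_measurable_def by simp
next
  assume "set_borel_measurable lborel {0<..} f \<and> set_borel_measurable lborel {0<..} (rest k f)"
  then have m1 [measurable]: "(\<lambda>t. indicat_real {0<..} t * f t) \<in> borel_measurable borel"
    and m2 [measurable]: "(\<lambda>t. indicat_real {0<..} t * rest k f t) \<in> borel_measurable borel"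
    by (auto simp: set_borel_measurable_def)
  have m3: "(\<lambda>t. (\<lambda>t. indicat_real {0<..} t * rest k f t) (- k * t)) \<in> borel_measurable borel"
    by (rule measurable_compose[OF _ m2]) simp
  \<comment> \<open>Neither open half sees the origin, hence the separate term
    \<open>f 0\<close>.\<close>
  have "(\<lambda>t. indicat_real {0<..} t * f t + (\<lambda>t. indicat_real {0<..} t * rest k f t) (- k * t) + indicat_real {0} t * f 0) \<in> borel_measurable borel"
    using m1 m3 by (intro borel_measurable_add) auto
  also have "(\<lambda>t. indicat_real {0<..} t * f t + (\<lambda>t. indicat_real {0<..} t * rest k f t) (- k * t) + indicat_real {0} t * f 0) = f"
  proof
    fix t
    show "indicat_real {0<..} t * f t + (\<lambda>t. indicat_real {0<..} t * rest k f t) (- k * t) + indicat_real {0} t * f 0 = f t"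
      using k by (cases t "0::real" rule: linorder_cases) (auto simp: indicator_def rest_def mult_less_0_iff)
  qed
  finally show "f \<in> borel_measurable borel" .
qed

lemma sq_int_on_halves:
  assumes k: "k > 0"
  shows "sq_int_on UNIV f \<longleftrightarrow> sq_int_on {0<..} f \<and> sq_int_on {0<..} (rest k f)"
proof -
  have "rest k (\<lambda>t. (f t)\<^sup>2) = (\<lambda>t. (rest k f t)\<^sup>2)" by (simp add: rest_def fun_eq_iff)
  then show ?thesis
    using integrable_halves(1)[OF k, of "\<lambda>t. (f t)\<^sup>2"] measurable_halves[OF k, of f]
    by (auto simp: sq_int_on_def set_borel_measurable_def set_integrable_def)
qed

lemma sq_int_on_cmult_iff:
  assumes "c \<noteq> 0"
  shows "sq_int_on S (\<lambda>t. c * f t) \<longleftrightarrow> sq_int_on S f"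
  using sq_int_on_cmult[of S f c] sq_int_on_cmult[of S "\<lambda>t. c * f t" "1 / c"] assms by auto

text \<open>Both closed half-lines contain 0 and \<open>rest k v 0 = v 0\<close>, so the two weak
  derivatives share one trace and join up across the origin.\<close>

lemma in_B1_halves:
  assumes k: "k > 0"
  shows "in_B1 v h \<longleftrightarrow> HL v h \<and> HL (rest k v) (drest k h)"
proof -
  have e1: "drest k h = (\<lambda>t. (- 1 / k) * rest k h t)" by (simp add: drest_def rest_def fun_eq_iff)
  have e2: "rest k (\<lambda>t. t * v t) = (\<lambda>t. (- 1 / k) * (t * rest k v t))" by (simp add: rest_def fun_eq_iff)
  have c: "- 1 / k \<noteq> 0" using k by simp
  have sq: "sq_int_on UNIV v \<and> sq_int_on UNIV h \<and> sq_int_on UNIV (\<lambda>t. t * v t) \<longleftrightarrow>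
    (sq_int_on {0<..} v \<and> sq_int_on {0<..} h \<and> sq_int_on {0<..} (\<lambda>t. t * v t)) \<and>
    (sq_int_on {0<..} (rest k v) \<and> sq_int_on {0<..} (drest k h) \<and> sq_int_on {0<..} (\<lambda>t. t * rest k v t))"
    unfolding sq_int_on_halves[OF k] e1 e2 sq_int_on_cmult_iff[OF c] by blast
  have w: "weak_deriv_on UNIV v h \<longleftrightarrow> weak_deriv_on {0..} v h \<and> weak_deriv_on {0..} (rest k v) (drest k h)"
  proof
    assume w: "weak_deriv_on UNIV v h"
    have "weak_deriv_on {0..} v h" by (rule weak_deriv_on_subset[OF w]) simp
    moreover have "weak_deriv_on {0..} (rest k v) (drest k h)" by (rule weak_deriv_on_reflect[OF k w]) simp
    ultimately show "weak_deriv_on {0..} v h \<and> weak_deriv_on {0..} (rest k v) (drest k h)" ..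
  next
    assume a: "weak_deriv_on {0..} v h \<and> weak_deriv_on {0..} (rest k v) (drest k h)"
    then have p: "weak_deriv_on {0..} v h" by simp
    \<comment> \<open>Reflecting once more with scale 1/k undoes the first reflection.\<close>
    have "weak_deriv_on {..0} (rest (1 / k) (rest k v)) (drest (1 / k) (drest k h))"
      by (rule weak_deriv_on_reflect[OF _ conjunct2[OF a]]) (use k in \<open>auto simp: mult_nonpos_nonneg\<close>)
    then have n: "weak_deriv_on {..0} v h" by (simp add: rest_rest[OF k] drest_drest[OF k])
    have *: "set_integrable lborel {x..y} h \<and> v y - v x = (LINT t:{x..y}|lborel. h t)" if xy: "x \<le> y" for x y
    proof -
      consider "x \<ge> 0" | "y \<le> 0" | "x < 0" "y > 0" by linarith
      then show ?thesis
      proof cases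
        case 1
        then show ?thesis using weak_deriv_onD[OF p _ _ xy] xy by simp
      next
        case 2
        then show ?thesis using weak_deriv_onD[OF n _ _ xy] xy by simp
      next
        case 3
        have "weak_deriv_on {x..0} v h" "weak_deriv_on {0..y} v h"
          by (rule weak_deriv_on_subset[OF n], simp) (rule weak_deriv_on_subset[OF p], simp)
        from weak_deriv_split[OF this] 3 show ?thesis by simp
      qed
    qed
    show "weak_deriv_on UNIV v h" by (rule weak_deriv_onI) (use * in blast)+
  qed
  have sub: "weak_deriv_on {0..} u g \<Longrightarrow> weak_deriv_on {0<..} u g" for u g :: "real \<Rightarrow> real"
    by (rule weak_deriv_on_subset) auto
  show ?thesis
    unfolding in_B1_def HL_def in_H1_pos_def using sq w sub by blast
qed

lemma L2sq_halves:
  assumes k: "k > 0" and v: "in_B1 v h"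
  shows "L2sq v = Nf v + Nf (rest k v) / k"
proof -
  have "integrable lborel (\<lambda>t. (v t)\<^sup>2)" using v by (simp add: in_B1_def sq_int_on_def set_integrable_def)
  from integrable_halves(2)[OF k this] show ?thesis by (simp add: L2sq_def Nf_def rest_def)
qed

lemma form_integrand_integrable:
  assumes v: "in_B1 v h" and w: "in_B1 w g" and k: "k > 0"
  shows "integrable lborel (\<lambda>t. h t * g t + (\<xi> + sigma (- k\<^sup>2) t * t)\<^sup>2 * v t * w t)"
    "integrable lborel (\<lambda>t. v t * w t)"
proof -
  have sq: "sq_int_on UNIV v" "sq_int_on UNIV h" "sq_int_on UNIV (\<lambda>t. t * v t)"
    "sq_int_on UNIV w" "sq_int_on UNIV g" "sq_int_on UNIV (\<lambda>t. t * w t)" 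
    using v w by (auto simp: in_B1_def)
  have V: "sq_int_on UNIV (\<lambda>t. (\<xi> + sigma (- k\<^sup>2) t * t) * u t)" if u: "sq_int_on UNIV u" "sq_int_on UNIV (\<lambda>t. t * u t)" for u
  proof -
    have su: "sq_int_on {0<..} u" "sq_int_on {0<..} (\<lambda>t. t * u t)"
      and ru: "sq_int_on {0<..} (rest k u)" "sq_int_on {0<..} (rest k (\<lambda>t. t * u t))"
      using u unfolding sq_int_on_halves[OF k] by auto
    have "sq_int_on {0<..} (\<lambda>t. \<xi> * u t + t * u t)" by (intro sq_int_on_add sq_int_on_cmult su)
    then have 1: "sq_int_on {0<..} (\<lambda>t. (\<xi> + sigma (- k\<^sup>2) t * t) * u t)"
      by (rule sq_int_on_cong) (simp add: sigma_def algebra_simps)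
    have "sq_int_on {0<..} (\<lambda>t. \<xi> * rest k u t + (- k\<^sup>2) * rest k (\<lambda>t. t * u t) t)" by (intro sq_int_on_add sq_int_on_cmult ru)
    then have 2: "sq_int_on {0<..} (rest k (\<lambda>t. (\<xi> + sigma (- k\<^sup>2) t * t) * u t))"
      by (rule sq_int_on_cong) (use k in \<open>simp add: rest_def sigma_def divide_less_0_iff algebra_simps\<close>)
    show ?thesis unfolding sq_int_on_halves[OF k] using 1 2 by simp
  qed
  have "integrable lborel (\<lambda>t. h t * g t + ((\<xi> + sigma (- k\<^sup>2) t * t) * v t) * ((\<xi> + sigma (- k\<^sup>2) t * t) * w t))"
    using sq_int_on_mult_integrable[OF sq(2,5)] sq_int_on_mult_integrable[OF V[OF sq(1,3)] V[OF sq(4,6)]]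
    by (intro Bochner_Integration.integrable_add) (auto simp: set_integrable_def)
  then show "integrable lborel (\<lambda>t. h t * g t + (\<xi> + sigma (- k\<^sup>2) t * t)\<^sup>2 * v t * w t)"
    by (simp add: power2_eq_square mult_ac)
  show "integrable lborel (\<lambda>t. v t * w t)"
    using sq_int_on_mult_integrable[OF sq(1,4)] by (simp add: set_integrable_def)
qed

text \<open>The substitution $t = -r/k$ turns the left half into the half-line problem at $\xi/k$.\<close>
lemma qform_halves:
  assumes k: "k > 0" and v: "in_B1 v h"
  shows "qform (- k\<^sup>2) \<xi> v h = Qf \<xi> v h + k * Qf (\<xi> / k) (rest k v) (drest k h)"
proof -
  let ?f = "\<lambda>t. (h t)\<^sup>2 + (\<xi> + sigma (- k\<^sup>2) t * t)\<^sup>2 * (v t)\<^sup>2"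
  have "integrable lborel ?f" using form_integrand_integrable(1)[OF v v k, of \<xi>] by (simp add: power2_eq_square mult_ac)
  from integrable_halves(2)[OF k this]
  have "qform (- k\<^sup>2) \<xi> v h = (LINT t:{0<..}|lborel. ?f t) + 1 / k * (LINT r:{0<..}|lborel. rest k ?f r)"
    by (simp add: qform_def)
  moreover have "(LINT t:{0<..}|lborel. ?f t) = Qf \<xi> v h"
    unfolding Qf_def by (rule set_lebesgue_integral_cong) (auto simp: sigma_def add.commute)
  moreover have "(LINT r:{0<..}|lborel. rest k ?f r) = k\<^sup>2 * Qf (\<xi> / k) (rest k v) (drest k h)"
    unfolding Qf_def set_integral_mult_right[symmetric]
  proof (rule set_lebesgue_integral_cong, simp, intro allI impI)
    fix r :: real assume "r \<in> {0<..}"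
    then have r: "\<not> 0 < - r / k" using k by (simp add: divide_less_0_iff)
    have "(\<xi> + - k\<^sup>2 * (- r / k))\<^sup>2 = (k * (r + \<xi> / k))\<^sup>2" using k by (simp add: power2_eq_square field_simps)
    then have 1: "(\<xi> + - k\<^sup>2 * (- r / k))\<^sup>2 = k\<^sup>2 * (r + \<xi> / k)\<^sup>2" by (simp only: power_mult_distrib)
    have 2: "(h (- r / k))\<^sup>2 = k\<^sup>2 * (drest k h r)\<^sup>2" using k by (simp add: drest_def power_divide)
    show "rest k ?f r = k\<^sup>2 * ((drest k h r)\<^sup>2 + (r + \<xi> / k)\<^sup>2 * (rest k v r)\<^sup>2)"
      unfolding rest_def sigma_def if_not_P[OF r] 1 2 by (simp add: algebra_simps)
  qed
  ultimately show ?thesis using k by (simp add: power2_eq_square)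
qed

text \<open>The origin belongs to the left branch; the result is continuous there once
  \<open>u 0 = v 0\<close> and both branches are.\<close>

definition glue :: "real \<Rightarrow> (real \<Rightarrow> real) \<Rightarrow> (real \<Rightarrow> real) \<Rightarrow> real \<Rightarrow> real" where
  "glue k u v t = (if t > 0 then u t else v (- k * t))"

definition dglue :: "real \<Rightarrow> (real \<Rightarrow> real) \<Rightarrow> (real \<Rightarrow> real) \<Rightarrow> real \<Rightarrow> real" where
  "dglue k g h t = (if t > 0 then g t else - k * h (- k * t))"

lemma rest_glue: "k > 0 \<Longrightarrow> r \<ge> 0 \<Longrightarrow> rest k (glue k u v) r = v r"
  by (simp add: rest_def glue_def divide_less_0_iff not_less)

lemma drest_dglue: "k > 0 \<Longrightarrow> r \<ge> 0 \<Longrightarrow> drest k (dglue k u v) r = v r"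
  by (simp add: drest_def dglue_def divide_less_0_iff not_less)

lemma glue_forms:
  assumes k: "k > 0" and u: "HL u g" and v: "HL v h" and eq: "u 0 = v 0"
  shows "in_B1 (glue k u v) (dglue k g h)"
    "qform (- k\<^sup>2) \<xi> (glue k u v) (dglue k g h) = Qf \<xi> u g + k * Qf (\<xi> / k) v h"
    "L2sq (glue k u v) = Nf u + Nf v / k"
proof -
  have 1: "HL (glue k u v) (dglue k g h)"
    by (rule HL_cong[OF u]) (use eq in \<open>auto simp: glue_def dglue_def\<close>)
  have 2: "HL (rest k (glue k u v)) (drest k (dglue k g h))"
    by (rule HL_cong[OF v]) (use k in \<open>auto simp: rest_glue drest_dglue\<close>)
  show B: "in_B1 (glue k u v) (dglue k g h)" using 1 2 in_B1_halves[OF k] by blast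
  have "Qf \<xi> (glue k u v) (dglue k g h) = Qf \<xi> u g" "Nf (glue k u v) = Nf u"
    by (auto intro!: Qf_cong Nf_cong simp: glue_def dglue_def)
  moreover have "Qf (\<xi> / k) (rest k (glue k u v)) (drest k (dglue k g h)) = Qf (\<xi> / k) v h" "Nf (rest k (glue k u v)) = Nf v"
    using k by (auto intro!: Qf_cong Nf_cong simp: rest_glue drest_dglue)
  ultimately show "qform (- k\<^sup>2) \<xi> (glue k u v) (dglue k g h) = Qf \<xi> u g + k * Qf (\<xi> / k) v h"
    "L2sq (glue k u v) = Nf u + Nf v / k"
    using qform_halves[OF k B] L2sq_halves[OF k B] by simp_all
qed

section \<open>The band function\<close>

lemma L2sq_nonneg: "L2sq u \<ge> 0"
  unfolding L2sq_def by (intro Bochner_Integration.integral_nonneg) auto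

lemma qform_nonneg: "qform a \<xi> u g \<ge> 0"
  unfolding qform_def by (intro Bochner_Integration.integral_nonneg) auto

lemma mu_le:
  assumes "in_B1 u g"
  shows "mu a \<xi> * L2sq u \<le> qform a \<xi> u g"
proof (cases "L2sq u = 0")
  case False
  then have "L2sq u > 0" using L2sq_nonneg[of u] by simp
  moreover have "mu a \<xi> \<le> qform a \<xi> u g / L2sq u"
    unfolding mu_def
  proof (rule cInf_lower)
    show "qform a \<xi> u g / L2sq u \<in> {qform a \<xi> u g / L2sq u |u g. in_B1 u g \<and> L2sq u \<noteq> 0}"
      using assms False by blast
  qed (auto simp: L2sq_nonneg qform_nonneg intro!: bdd_belowI[of _ 0])
  ultimately show ?thesis by (simp add: field_simps)
qed (simp add: qform_nonneg)

text \<open>The jump u'(0+) - u'(0-) of the two profiles glued at the origin: the left branch,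
  evaluated at -k t, has slope -k times its \<open>pcM\<close> there.\<close>

definition pcG :: "real \<Rightarrow> real \<Rightarrow> real \<Rightarrow> real" where
  "pcG k l \<xi> = pcM l \<xi> + k * pcM (l / k\<^sup>2) (\<xi> / k)"

definition pcN :: "real \<Rightarrow> real \<Rightarrow> real \<Rightarrow> real" where
  "pcN k l \<xi> = pcR l \<xi> + pcR (l / k\<^sup>2) (\<xi> / k) / k"

lemma div_sq_less_1: "0 < k \<Longrightarrow> l < k\<^sup>2 \<Longrightarrow> l / k\<^sup>2 < (1::real)"
  by simp

lemma less_sq_imp_less_1: "0 < k \<Longrightarrow> k < 1 \<Longrightarrow> l < k\<^sup>2 \<Longrightarrow> l < (1::real)"
  using power_le_one[of k 2] by simp

lemma pcN_pos: "0 < k \<Longrightarrow> k < 1 \<Longrightarrow> l < k\<^sup>2 \<Longrightarrow> pcN k l \<xi> > 0"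
  using pcR_pos[of l \<xi>] pcR_pos[of "l / k\<^sup>2" "\<xi> / k"] less_sq_imp_less_1[of k l] div_sq_less_1[of k l]
  by (simp add: pcN_def add_pos_pos)

text \<open>By \<open>Qf_pf\<close> each half contributes a multiple of its squared norm minus its
  slope; after weighting, the slopes add up to the jump G.\<close>

lemma trial_function:
  fixes k l \<xi> :: real
  assumes k: "0 < k" "k < 1" and l: "l < k\<^sup>2"
  defines "u \<equiv> glue k (pf l \<xi>) (pf (l / k\<^sup>2) (\<xi> / k))" and "g \<equiv> dglue k (pg l \<xi>) (pg (l / k\<^sup>2) (\<xi> / k))"
  shows "in_B1 u g" "L2sq u = pcN k l \<xi>" "qform (- k\<^sup>2) \<xi> u g = l * pcN k l \<xi> - pcG k l \<xi>"
proof -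
  have l1: "l < 1" and l2: "l / k\<^sup>2 < 1" using less_sq_imp_less_1[OF k l] div_sq_less_1[OF k(1) l] by auto
  note G = glue_forms[OF k(1) HL_pf[OF l1, of \<xi>] HL_pf[OF l2, of "\<xi> / k"], unfolded pf_0[OF l1] pf_0[OF l2], OF refl, folded u_def g_def]
  show "in_B1 u g" by (rule G)
  show "L2sq u = pcN k l \<xi>" using G(3) by (simp add: pcN_def pcR_def)
  have "k * (l / k\<^sup>2 * x - y) = l * (x / k) - k * y" for x y using k by (simp add: power2_eq_square right_diff_distrib)
  then show "qform (- k\<^sup>2) \<xi> u g = l * pcN k l \<xi> - pcG k l \<xi>"
    unfolding G(2) Qf_pf[OF l1] Qf_pf[OF l2] pcN_def pcG_def by (simp only:) (simp add: distrib_left)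
qed

lemma mu_greatest:
  assumes k: "0 < k" "k < 1" and c: "\<And>u g. in_B1 u g \<Longrightarrow> c * L2sq u \<le> qform (- k\<^sup>2) \<xi> u g"
  shows "c \<le> mu (- k\<^sup>2) \<xi>"
  unfolding mu_def
proof (rule cInf_greatest)
  \<comment> \<open>Makes l = 0 admissible for the trial function, which then witnesses that the set
    of quotients is nonempty.\<close>
  have "0 < k\<^sup>2" using k by simp
  then show "{qform (- k\<^sup>2) \<xi> u g / L2sq u |u g. in_B1 u g \<and> L2sq u \<noteq> 0} \<noteq> {}"
    using trial_function[OF k, of 0 \<xi>] pcN_pos[OF k, of 0 \<xi>] by force
  fix x assume "x \<in> {qform (- k\<^sup>2) \<xi> u g / L2sq u |u g. in_B1 u g \<and> L2sq u \<noteq> 0}"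
  then obtain u g where "in_B1 u g" "L2sq u \<noteq> 0" "x = qform (- k\<^sup>2) \<xi> u g / L2sq u" by blast
  moreover from this have "L2sq u > 0" using L2sq_nonneg[of u] by simp
  ultimately have "c * L2sq u \<le> x * L2sq u" "L2sq u > 0" using c by (auto simp: field_simps)
  then show "c \<le> x" by simp
qed

lemma mu_nonneg: "0 < k \<Longrightarrow> k < 1 \<Longrightarrow> mu (- k\<^sup>2) \<xi> \<ge> 0"
  by (rule mu_greatest) (auto simp: qform_nonneg)

text \<open>The two half-line inequalities share the boundary value \<open>v 0\<close>; the weight k
  of the left form and the factor 1/k in the left norm turn the parameter l/k^2 back into l.\<close>

lemma qform_picone:
  assumes k: "0 < k" "k < 1" and l: "l < k\<^sup>2" and v: "in_B1 v h"
  shows "l * L2sq v - pcG k l \<xi> * (v 0)\<^sup>2 \<le> qform (- k\<^sup>2) \<xi> v h"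
proof -
  have l1: "l < 1" and l2: "l / k\<^sup>2 < 1" using less_sq_imp_less_1[OF k l] div_sq_less_1[OF k(1) l] by auto
  have H: "HL v h" "HL (rest k v) (drest k h)" using v in_B1_halves[OF k(1)] by blast+
  have "l * Nf v - pcM l \<xi> * (v 0)\<^sup>2 \<le> Qf \<xi> v h" by (rule picone_le[OF l1 H(1)])
  moreover have "k * (l / k\<^sup>2 * Nf (rest k v) - pcM (l / k\<^sup>2) (\<xi> / k) * (v 0)\<^sup>2) \<le> k * Qf (\<xi> / k) (rest k v) (drest k h)"
    using picone_le[OF l2 H(2), of "\<xi> / k"] k by (intro mult_left_mono) (auto simp: rest_def)
  moreover have "k * (l / k\<^sup>2 * Nf (rest k v) - pcM (l / k\<^sup>2) (\<xi> / k) * (v 0)\<^sup>2)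
      = l * (Nf (rest k v) / k) - k * pcM (l / k\<^sup>2) (\<xi> / k) * (v 0)\<^sup>2"
    using k by (simp add: power2_eq_square right_diff_distrib)
  ultimately show ?thesis
    unfolding qform_halves[OF k(1) v] L2sq_halves[OF k(1) v] pcG_def distrib_left distrib_right by linarith
qed

lemma mu_ge_of_pcG:
  assumes k: "0 < k" "k < 1" and l: "l < k\<^sup>2" and G: "pcG k l \<xi> \<le> 0"
  shows "l \<le> mu (- k\<^sup>2) \<xi>"
proof (rule mu_greatest[OF k])
  fix u g assume u: "in_B1 u g"
  have "pcG k l \<xi> * (u 0)\<^sup>2 \<le> 0" using G by (simp add: mult_nonpos_nonneg)
  then show "l * L2sq u \<le> qform (- k\<^sup>2) \<xi> u g" using qform_picone[OF k l u, of \<xi>] by simp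
qed

lemma mu_less_of_pcG:
  assumes k: "0 < k" "k < 1" and l: "l < k\<^sup>2" and G: "pcG k l \<xi> > 0"
  shows "mu (- k\<^sup>2) \<xi> < l"
proof -
  note T = trial_function[OF k l, of \<xi>]
  have "mu (- k\<^sup>2) \<xi> * pcN k l \<xi> \<le> l * pcN k l \<xi> - pcG k l \<xi>"
    using mu_le[OF T(1), of "- k\<^sup>2" \<xi>] unfolding T(2,3) .
  then have "mu (- k\<^sup>2) \<xi> * pcN k l \<xi> < l * pcN k l \<xi>" using G by simp
  then show ?thesis using pcN_pos[OF k l, of \<xi>] by simp
qed

text \<open>If G were negative at l = mu, continuity in l would keep it negative just above, and
  \<open>mu_ge_of_pcG\<close> would give mu >= l > mu. A positive value is excluded by
  \<open>mu_less_of_pcG\<close>.\<close>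

lemma pcG_mu:
  assumes k: "0 < k" "k < 1" and l: "mu (- k\<^sup>2) \<xi> < k\<^sup>2"
  shows "pcG k (mu (- k\<^sup>2) \<xi>) \<xi> = 0"
proof (rule ccontr)
  let ?m = "mu (- k\<^sup>2) \<xi>"
  assume "pcG k ?m \<xi> \<noteq> 0"
  moreover have "\<not> pcG k ?m \<xi> > 0" using mu_less_of_pcG[OF k l] by blast
  ultimately have neg: "pcG k ?m \<xi> < 0" by simp
  have l1: "?m < 1" and l2: "?m / k\<^sup>2 < 1" using less_sq_imp_less_1[OF k l] div_sq_less_1[OF k(1) l] by auto
  have "((\<lambda>l. pcG k l \<xi>) \<longlongrightarrow> pcG k ?m \<xi>) (at_right ?m)"
    unfolding pcG_def by (intro tendsto_intros pcM_tendsto l1 l2) (use k in auto)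
  then have "eventually (\<lambda>l. pcG k l \<xi> < 0) (at_right ?m)" using neg by (rule order_tendstoD(2))
  moreover have "eventually (\<lambda>l. l < k\<^sup>2) (at_right ?m)" unfolding eventually_at_right_field using l by blast
  moreover have "eventually (\<lambda>l. ?m < l) (at_right ?m)" by (simp add: eventually_at_right_less)
  ultimately have "eventually (\<lambda>l. False) (at_right ?m)"
  proof eventually_elim
    case (elim l)
    then show ?case using mu_ge_of_pcG[OF k, of l \<xi>] by simp
  qed
  then show False by simp
qed

section \<open>Dependence of the forms and of the band function on \<xi>\<close>

lemma Qf_shift:
  assumes "HL v h"
  shows "Qf \<xi>' v h = Qf \<xi> v h + 2 * (\<xi>' - \<xi>) * Tf \<xi> v + (\<xi>' - \<xi>)\<^sup>2 * Nf v"
proof -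
  have H: "in_H1_pos v h" using assms by (simp add: HL_def)
  note i = in_H1_pos_integrable[OF H]
  have iq: "set_integrable lborel {0<..} (\<lambda>t. (h t)\<^sup>2 + (t + \<xi>)\<^sup>2 * (v t)\<^sup>2)" by (intro set_integral_add i)
  have "Qf \<xi>' v h = (LINT t:{0<..}|lborel. ((h t)\<^sup>2 + (t + \<xi>)\<^sup>2 * (v t)\<^sup>2) + (2 * (\<xi>' - \<xi>)) * ((t + \<xi>) * (v t)\<^sup>2) + (\<xi>' - \<xi>)\<^sup>2 * (v t)\<^sup>2)"
    unfolding Qf_def by (rule set_lebesgue_integral_cong) (auto simp: power2_eq_square algebra_simps)
  also have "\<dots> = Qf \<xi> v h + 2 * (\<xi>' - \<xi>) * Tf \<xi> v + (\<xi>' - \<xi>)\<^sup>2 * Nf v"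
    unfolding Qf_def Tf_def Nf_def
      set_integral_add(2)[OF set_integral_add(1)[OF iq set_integrable_mult_right[OF i(4)]] set_integrable_mult_right[OF i(1)]]
      set_integral_add(2)[OF iq set_integrable_mult_right[OF i(4)]] set_integral_mult_right by (rule refl)
  finally show ?thesis .
qed

lemma qform_shift:
  assumes k: "k > 0" and v: "in_B1 v h"
  shows "qform (- k\<^sup>2) \<xi>' v h = qform (- k\<^sup>2) \<xi> v h + 2 * (\<xi>' - \<xi>) * (Tf \<xi> v + Tf (\<xi> / k) (rest k v)) + (\<xi>' - \<xi>)\<^sup>2 * L2sq v"
proof -
  have H: "HL v h" "HL (rest k v) (drest k h)" using v in_B1_halves[OF k] by blast+
  have e: "\<xi>' / k - \<xi> / k = (\<xi>' - \<xi>) / k" by (simp add: diff_divide_distrib)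
  show ?thesis
    unfolding qform_halves[OF k v] L2sq_halves[OF k v] Qf_shift[OF H(1), of \<xi>' \<xi>] Qf_shift[OF H(2), of "\<xi>' / k" "\<xi> / k"] e
    using k by (simp add: field_simps power2_eq_square)
qed

text \<open>Up to the term $\xi^2$, the Rayleigh quotients are affine in $\xi$, so $\xi^2-\mu(\xi)$ is a supremum of affine functions.\<close>
lemma mu_continuous:
  assumes k: "0 < k" "k < 1"
  shows "continuous_on UNIV (mu (- k\<^sup>2))"
proof -
  have "convex_on UNIV (\<lambda>\<xi>. \<xi>\<^sup>2 - mu (- k\<^sup>2) \<xi>)"
  proof (rule convex_onI)
    fix r x y :: real assume r: "0 < r" "r < 1"
    let ?z = "(1 - r) *\<^sub>R x + r *\<^sub>R y" and ?m = "\<lambda>x. mu (- k\<^sup>2) x - x\<^sup>2"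
    have "(1 - r) * ?m x + r * ?m y + ?z\<^sup>2 \<le> mu (- k\<^sup>2) ?z"
    proof (rule mu_greatest[OF k])
      fix u g assume u: "in_B1 u g"
      define A where "A = qform (- k\<^sup>2) 0 u g"
      define B where "B = Tf 0 u + Tf 0 (rest k u)"
      define L where "L = L2sq u"
      have q: "qform (- k\<^sup>2) \<xi> u g = A + 2 * \<xi> * B + \<xi>\<^sup>2 * L" for \<xi>
        using qform_shift[OF k(1) u, of \<xi> 0] by (simp add: A_def B_def L_def)
      have "?m x * L \<le> A + 2 * x * B" "?m y * L \<le> A + 2 * y * B"
        using mu_le[OF u, of "- k\<^sup>2" x] mu_le[OF u, of "- k\<^sup>2" y] unfolding q L_def[symmetric] by (auto simp: left_diff_distrib)
      then have "(1 - r) * (?m x * L) \<le> (1 - r) * (A + 2 * x * B)" "r * (?m y * L) \<le> r * (A + 2 * y * B)"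
        using r by (auto intro: mult_left_mono)
      then show "((1 - r) * ?m x + r * ?m y + ?z\<^sup>2) * L2sq u \<le> qform (- k\<^sup>2) ?z u g"
        unfolding q L_def[symmetric] by (simp add: algebra_simps)
    qed
    then show "?z\<^sup>2 - mu (- k\<^sup>2) ?z \<le> (1 - r) * (x\<^sup>2 - mu (- k\<^sup>2) x) + r * (y\<^sup>2 - mu (- k\<^sup>2) y)"
      by (simp add: algebra_simps)
  qed simp
  then have "continuous_on UNIV (\<lambda>\<xi>. \<xi>\<^sup>2 - mu (- k\<^sup>2) \<xi>)" by (intro convex_on_continuous) auto
  then have "continuous_on UNIV (\<lambda>\<xi>. \<xi>\<^sup>2 - (\<xi>\<^sup>2 - mu (- k\<^sup>2) \<xi>))" 
    by (rule continuous_on_diff[rotated]) (intro continuous_intros)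
  then show ?thesis by (rule continuous_on_eq) simp
qed

text \<open>The Hellmann-Feynman expression, valid where mu < k^2: twice the first moments of the
  glued profile over its squared norm. There G = 0 makes the slope of the left profile -M/k, so the
  left half contributes 1/k^2 times the right half.\<close>

definition dmu :: "real \<Rightarrow> real \<Rightarrow> real" where
  "dmu k \<xi> = (1 + 1 / k\<^sup>2) * ((pcM (mu (- k\<^sup>2) \<xi>) \<xi>)\<^sup>2 + mu (- k\<^sup>2) \<xi> - \<xi>\<^sup>2) / pcN k (mu (- k\<^sup>2) \<xi>) \<xi>"

text \<open>For a fixed function the form is a quadratic polynomial in \<xi>' whose leading
  coefficient is the squared norm; \<open>mu\<close> at \<xi>' is tested with the glued profile that
  attains it at \<xi>.\<close>

lemma mu_le_quadratic:
  assumes k: "0 < k" "k < 1" and m: "mu (- k\<^sup>2) \<xi> < k\<^sup>2"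
  shows "mu (- k\<^sup>2) \<xi>' \<le> mu (- k\<^sup>2) \<xi> + dmu k \<xi> * (\<xi>' - \<xi>) + (\<xi>' - \<xi>)\<^sup>2"
proof -
  let ?m = "mu (- k\<^sup>2) \<xi>"
  let ?u = "glue k (pf ?m \<xi>) (pf (?m / k\<^sup>2) (\<xi> / k))" and ?g = "dglue k (pg ?m \<xi>) (pg (?m / k\<^sup>2) (\<xi> / k))"
  let ?N = "pcN k ?m \<xi>" and ?M = "pcM ?m \<xi>" and ?M2 = "pcM (?m / k\<^sup>2) (\<xi> / k)"
  have l1: "?m < 1" and l2: "?m / k\<^sup>2 < 1" using less_sq_imp_less_1[OF k m] div_sq_less_1[OF k(1) m] by auto
  note T = trial_function[OF k m, of \<xi>] and N = pcN_pos[OF k m, of \<xi>]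
  have M2: "?M2 = - ?M / k" using pcG_mu[OF k m] k by (simp add: pcG_def field_simps)
  have "Tf \<xi> ?u = Tf \<xi> (pf ?m \<xi>)" unfolding Tf_def by (rule set_lebesgue_integral_cong) (auto simp: glue_def)
  moreover have "Tf (\<xi> / k) (rest k ?u) = Tf (\<xi> / k) (pf (?m / k\<^sup>2) (\<xi> / k))"
    unfolding Tf_def by (rule set_lebesgue_integral_cong) (auto simp: rest_glue[OF k(1)])
  ultimately have "2 * (Tf \<xi> ?u + Tf (\<xi> / k) (rest k ?u)) = (?M\<^sup>2 + ?m - \<xi>\<^sup>2) + (?M2\<^sup>2 + ?m / k\<^sup>2 - (\<xi> / k)\<^sup>2)"
    using Tf_pf[OF l1, of \<xi>] Tf_pf[OF l2, of "\<xi> / k"] by simp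
  also have "\<dots> = (1 + 1 / k\<^sup>2) * (?M\<^sup>2 + ?m - \<xi>\<^sup>2)"
    unfolding M2 using k by (simp add: field_simps power_divide)
  also have "\<dots> = dmu k \<xi> * ?N" using N by (simp add: dmu_def)
  finally have t: "2 * (Tf \<xi> ?u + Tf (\<xi> / k) (rest k ?u)) = dmu k \<xi> * ?N" .
  have "mu (- k\<^sup>2) \<xi>' * ?N \<le> qform (- k\<^sup>2) \<xi>' ?u ?g" using mu_le[OF T(1), of "- k\<^sup>2" \<xi>'] unfolding T(2) .
  also have "\<dots> = ?m * ?N + (2 * (Tf \<xi> ?u + Tf (\<xi> / k) (rest k ?u))) * (\<xi>' - \<xi>) + (\<xi>' - \<xi>)\<^sup>2 * ?N"
    unfolding qform_shift[OF k(1) T(1), of \<xi>' \<xi>] T(2,3) pcG_mu[OF k m] by (simp add: algebra_simps)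
  also have "\<dots> = (?m + dmu k \<xi> * (\<xi>' - \<xi>) + (\<xi>' - \<xi>)\<^sup>2) * ?N" unfolding t by (simp add: algebra_simps)
  finally show ?thesis using N by simp
qed

text \<open>Picone's inequality for one parameter, tested with the profile of the other, squeezes
  the increment between (l' - l) times the two values of \<open>pcR\<close>; the lower bound enters
  through its sign.\<close>

lemma pcM_increment:
  assumes "l \<le> l'" "l' < 1"
  shows "pcM l x \<le> pcM l' x" "pcM l' x - pcM l x \<le> (l' - l) * pcR l' x"
proof -
  have l: "l < 1" using assms by simp
  have "l' * pcR l x - pcM l' x * 1\<^sup>2 \<le> l * pcR l x - pcM l x"
    using picone_le[OF assms(2) HL_pf[OF l, of x], of x] unfolding Qf_pf[OF l] pf_0[OF l] pcR_def .
  moreover have "l * pcR l x \<le> l' * pcR l x" using assms pcR_pos[OF l, of x] by (intro mult_right_mono) auto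
  ultimately show "pcM l x \<le> pcM l' x" by simp
  have "l * pcR l' x - pcM l x * 1\<^sup>2 \<le> l' * pcR l' x - pcM l' x"
    using picone_le[OF l HL_pf[OF assms(2), of x], of x] unfolding Qf_pf[OF assms(2)] pf_0[OF assms(2)] pcR_def .
  then show "pcM l' x - pcM l x \<le> (l' - l) * pcR l' x" by (simp add: algebra_simps)
qed

lemma open_mu_less: "0 < k \<Longrightarrow> k < 1 \<Longrightarrow> open {\<xi>. mu (- k\<^sup>2) \<xi> < k\<^sup>2}"
  by (intro open_Collect_less mu_continuous continuous_intros)

lemma isCont_pcR_mu:
  assumes k: "0 < k" "k < 1" and m: "mu (- k\<^sup>2) \<xi> < k\<^sup>2"
  shows "isCont (\<lambda>x. pcR (mu (- k\<^sup>2) x) x) \<xi>" "isCont (\<lambda>x. pcR (mu (- k\<^sup>2) x / k\<^sup>2) (x / k)) \<xi>"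
proof -
  \<comment> \<open>Radius 1 keeps the shifts bounded below, as the majorant in
    \<open>pcR_tendsto\<close> demands.\<close>
  let ?S = "{x. mu (- k\<^sup>2) x < k\<^sup>2} \<inter> {\<xi> - 1<..<\<xi> + 1}"
  have S: "open ?S" "\<xi> \<in> ?S" using open_mu_less[OF k] m by auto
  have c: "continuous (at \<xi> within ?S) f" if 
    "\<And>X. (\<And>n. X n \<in> ?S) \<Longrightarrow> X \<longlonglongrightarrow> \<xi> \<Longrightarrow> (\<lambda>n. f (X n)) \<longlonglongrightarrow> f \<xi>" for f :: "real \<Rightarrow> real"
    unfolding continuous_within_sequentially comp_def using that by blast
  have mc: "(\<lambda>n. mu (- k\<^sup>2) (X n)) \<longlonglongrightarrow> mu (- k\<^sup>2) \<xi>" if "X \<longlonglongrightarrow> \<xi>" for X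
    using mu_continuous[OF k] that by (simp add: continuous_on_tendsto_compose)
  have "continuous (at \<xi> within ?S) (\<lambda>x. pcR (mu (- k\<^sup>2) x) x)"
  proof (rule c)
    fix X :: "nat \<Rightarrow> real" assume X: "\<And>n. X n \<in> ?S" "X \<longlonglongrightarrow> \<xi>"
    show "(\<lambda>n. pcR (mu (- k\<^sup>2) (X n)) (X n)) \<longlonglongrightarrow> pcR (mu (- k\<^sup>2) \<xi>) \<xi>"
    proof (rule pcR_tendsto[where B="\<bar>\<xi>\<bar> + 1", OF mc[OF X(2)] X(2)])
      show "- (\<bar>\<xi>\<bar> + 1) \<le> X n" for n using X(1)[of n] by auto
    qed (use less_sq_imp_less_1[OF k] m X(1) in auto)
  qed
  then show "isCont (\<lambda>x. pcR (mu (- k\<^sup>2) x) x) \<xi>" using at_within_open[OF S(2,1)] by simp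
  have "continuous (at \<xi> within ?S) (\<lambda>x. pcR (mu (- k\<^sup>2) x / k\<^sup>2) (x / k))"
  proof (rule c)
    fix X :: "nat \<Rightarrow> real" assume X: "\<And>n. X n \<in> ?S" "X \<longlonglongrightarrow> \<xi>"
    show "(\<lambda>n. pcR (mu (- k\<^sup>2) (X n) / k\<^sup>2) (X n / k)) \<longlonglongrightarrow> pcR (mu (- k\<^sup>2) \<xi> / k\<^sup>2) (\<xi> / k)"
    proof (rule pcR_tendsto[where B="(\<bar>\<xi>\<bar> + 1) / k"])
      show "- ((\<bar>\<xi>\<bar> + 1) / k) \<le> X n / k" for n
        unfolding minus_divide_left using X(1)[of n] k by (intro divide_right_mono) auto
      show "(\<lambda>n. mu (- k\<^sup>2) (X n) / k\<^sup>2) \<longlonglongrightarrow> mu (- k\<^sup>2) \<xi> / k\<^sup>2"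
        using k by (intro tendsto_intros mc X) auto
      show "(\<lambda>n. X n / k) \<longlonglongrightarrow> \<xi> / k" using k by (intro tendsto_intros X) auto
    qed (use div_sq_less_1[OF k(1)] m X(1) in auto)
  qed
  then show "isCont (\<lambda>x. pcR (mu (- k\<^sup>2) x / k\<^sup>2) (x / k)) \<xi>" using at_within_open[OF S(2,1)] by simp
qed

lemma isCont_pcN_mu:
  assumes k: "0 < k" "k < 1" and m: "mu (- k\<^sup>2) \<xi> < k\<^sup>2"
  shows "isCont (\<lambda>x. pcN k (mu (- k\<^sup>2) x) x) \<xi>"
  unfolding pcN_def using k by (intro continuous_intros isCont_pcR_mu[OF k m]) auto

lemma isCont_mu: "0 < k \<Longrightarrow> k < 1 \<Longrightarrow> isCont (mu (- k\<^sup>2)) \<xi>"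
  using mu_continuous by (simp add: continuous_on_eq_continuous_at)

lemma isCont_dmu:
  assumes k: "0 < k" "k < 1" and m: "mu (- k\<^sup>2) \<xi> < k\<^sup>2"
  shows "isCont (dmu k) \<xi>"
proof -
  have c: "((\<lambda>x. mu (- k\<^sup>2) x) \<longlongrightarrow> mu (- k\<^sup>2) \<xi>) (at \<xi>)" using isCont_mu[OF k] by (simp add: isCont_def)
  have n: "((\<lambda>x. pcN k (mu (- k\<^sup>2) x) x) \<longlongrightarrow> pcN k (mu (- k\<^sup>2) \<xi>) \<xi>) (at \<xi>)"
    using isCont_pcN_mu[OF k m] by (simp add: isCont_def)
  show ?thesis unfolding isCont_def dmu_def
    using pcN_pos[OF k m, of \<xi>] less_sq_imp_less_1[OF k m]
    by (intro tendsto_intros pcM_tendsto c n) auto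
qed

text \<open>\<open>mu_le_quadratic\<close> at \<xi> bounds mu(\<xi> + h) from above; with the two
  points exchanged it gives a lower bound with slope dmu(\<xi> + h). Continuity of
  \<open>dmu\<close> brings the slopes together.\<close>

lemma mu_deriv:
  assumes k: "0 < k" "k < 1" and m: "mu (- k\<^sup>2) \<xi> < k\<^sup>2"
  shows "(mu (- k\<^sup>2) has_real_derivative dmu k \<xi>) (at \<xi>)"
proof -
  let ?m = "mu (- k\<^sup>2)" 
  have "((\<lambda>h. (?m (\<xi> + h) - ?m \<xi>) / h) \<longlongrightarrow> dmu k \<xi>) (at 0)"
  proof (rule LIM_zero_cancel, rule Lim_null_comparison)
    have i: "((\<lambda>h. \<xi> + h) \<longlongrightarrow> \<xi>) (at 0)" by (auto intro!: tendsto_eq_intros)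
    have ev: "\<forall>\<^sub>F h in at 0. ?m (\<xi> + h) < k\<^sup>2"
    proof (rule order_tendstoD(2)[OF _ m])
      show "((\<lambda>h. ?m (\<xi> + h)) \<longlongrightarrow> ?m \<xi>) (at 0)" by (rule isCont_tendsto_compose[OF isCont_mu[OF k] i])
    qed
    have nz: "\<forall>\<^sub>F h in at 0. h \<noteq> (0::real)" by (simp add: eventually_at_filter)
    show "\<forall>\<^sub>F h in at 0. norm ((?m (\<xi> + h) - ?m \<xi>) / h - dmu k \<xi>) \<le> \<bar>dmu k (\<xi> + h) - dmu k \<xi>\<bar> + \<bar>h\<bar>"
      using ev nz
    proof eventually_elim
      case (elim h)
      define d where "d = ?m (\<xi> + h) - ?m \<xi>"
      have 1: "d - dmu k \<xi> * h \<le> h\<^sup>2" using mu_le_quadratic[OF k m, of "\<xi> + h"] by (simp add: d_def)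
      have 2: "dmu k (\<xi> + h) * h - h\<^sup>2 \<le> d" using mu_le_quadratic[OF k elim(1), of \<xi>] by (simp add: d_def)
      have "- (\<bar>dmu k (\<xi> + h) - dmu k \<xi>\<bar> * \<bar>h\<bar>) \<le> (dmu k (\<xi> + h) - dmu k \<xi>) * h"
        using abs_ge_minus_self[of "(dmu k (\<xi> + h) - dmu k \<xi>) * h"] by (simp add: abs_mult)
      then have 3: "- (\<bar>dmu k (\<xi> + h) - dmu k \<xi>\<bar> * \<bar>h\<bar>) - h\<^sup>2 \<le> d - dmu k \<xi> * h"
        using 2 by (simp add: left_diff_distrib)
      have "0 \<le> \<bar>dmu k (\<xi> + h) - dmu k \<xi>\<bar> * \<bar>h\<bar>" by simp
      then have "\<bar>d - dmu k \<xi> * h\<bar> \<le> \<bar>dmu k (\<xi> + h) - dmu k \<xi>\<bar> * \<bar>h\<bar> + h\<^sup>2" using 1 3 by linarith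
      also have "\<dots> = (\<bar>dmu k (\<xi> + h) - dmu k \<xi>\<bar> + \<bar>h\<bar>) * \<bar>h\<bar>" by (simp add: distrib_right power2_eq_square)
      finally have "\<bar>d - dmu k \<xi> * h\<bar> / \<bar>h\<bar> \<le> \<bar>dmu k (\<xi> + h) - dmu k \<xi>\<bar> + \<bar>h\<bar>" using elim(2) by (simp add: field_simps)
      moreover have "d / h - dmu k \<xi> = (d - dmu k \<xi> * h) / h" using elim(2) by (simp add: diff_divide_distrib)
      ultimately show ?case unfolding d_def[symmetric] by (simp add: abs_divide)
    qed
    have "((\<lambda>h. dmu k (\<xi> + h)) \<longlongrightarrow> dmu k \<xi>) (at 0)" by (rule isCont_tendsto_compose[OF isCont_dmu[OF k m] i])
    then have "((\<lambda>h. \<bar>dmu k (\<xi> + h) - dmu k \<xi>\<bar> + \<bar>h\<bar>) \<longlongrightarrow> \<bar>dmu k \<xi> - dmu k \<xi>\<bar> + \<bar>0\<bar>) (at 0)"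
      by (intro tendsto_intros)
    then show "((\<lambda>h. \<bar>dmu k (\<xi> + h) - dmu k \<xi>\<bar> + \<bar>h\<bar>) \<longlongrightarrow> 0) (at 0)" by simp
  qed
  then show ?thesis by (simp add: DERIV_def)
qed

text \<open>At a global minimum, $0\le\mu(\zeta+h)-\mu(\zeta)\le h^2$, so that the slope at the origin is stationary as well.\<close>
lemma dmu_deriv_at_min:
  assumes k: "0 < k" "k < 1" and m: "mu (- k\<^sup>2) \<zeta> < k\<^sup>2" and min: "\<And>\<xi>. mu (- k\<^sup>2) \<zeta> \<le> mu (- k\<^sup>2) \<xi>"
  shows "(pcM (mu (- k\<^sup>2) \<zeta>) \<zeta>)\<^sup>2 + mu (- k\<^sup>2) \<zeta> - \<zeta>\<^sup>2 = 0"
    "(dmu k has_real_derivative (1 + 1 / k\<^sup>2) * (- 2 * \<zeta>) / pcN k (mu (- k\<^sup>2) \<zeta>) \<zeta>) (at \<zeta>)"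
proof -
  let ?m = "mu (- k\<^sup>2)" 
  let ?D = "\<lambda>x. (pcM (?m x) x)\<^sup>2 + ?m x - x\<^sup>2" and ?N = "\<lambda>x. pcN k (?m x) x"
  have l1: "?m \<zeta> < 1" by (rule less_sq_imp_less_1[OF k m])
  have dm: "(?m has_real_derivative dmu k \<zeta>) (at \<zeta>)" by (rule mu_deriv[OF k m])
  have d0: "dmu k \<zeta> = 0"
    by (rule DERIV_local_min[OF dm, of 1]) (use min in auto)
  moreover have "(1 + 1 / k\<^sup>2) \<noteq> 0" using k by (simp add: add_pos_pos less_imp_neq[THEN not_sym])
  ultimately show D0: "?D \<zeta> = 0" using pcN_pos[OF k m, of \<zeta>] by (simp add: dmu_def)
  \<comment> \<open>At the critical point the right-hand side of the Riccati equation vanishes by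
    \<open>D0\<close>.\<close>
  have g1: "((\<lambda>x. pcM (?m \<zeta>) x) has_real_derivative 0) (at \<zeta>)"
    by (rule DERIV_cong[OF pcM_deriv[OF l1]]) (use D0 in simp)
  \<comment> \<open>The change of l costs at most (mu(x) - mu(\<zeta>)) times a locally bounded
    factor by \<open>pcM_increment\<close>, and mu(x) - mu(\<zeta>) <= (x - \<zeta>)^2 since
    \<open>dmu\<close> vanishes at \<zeta>.\<close>
  have g2: "((\<lambda>x. pcM (?m x) x - pcM (?m \<zeta>) x) has_real_derivative 0) (at \<zeta>)"
    unfolding has_field_derivative_iff
  proof (rule Lim_null_comparison)
    have ev: "\<forall>\<^sub>F x in at \<zeta>. ?m x < k\<^sup>2"
      using order_tendstoD(2)[OF isCont_mu[OF k, of \<zeta>, unfolded isCont_def] m] .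
    have nz: "\<forall>\<^sub>F x in at \<zeta>. x \<noteq> \<zeta>" by (simp add: eventually_at_filter)
    show "\<forall>\<^sub>F x in at \<zeta>. norm ((pcM (?m x) x - pcM (?m \<zeta>) x - (pcM (?m \<zeta>) \<zeta> - pcM (?m \<zeta>) \<zeta>)) / (x - \<zeta>)) \<le> \<bar>x - \<zeta>\<bar> * pcR (?m x) x"
      using ev nz
    proof eventually_elim
      case (elim x)
      have l: "?m x < 1" by (rule less_sq_imp_less_1[OF k elim(1)])
      have R: "pcR (?m x) x > 0" by (rule pcR_pos[OF l])
      have q: "?m x - ?m \<zeta> \<le> (x - \<zeta>)\<^sup>2" using mu_le_quadratic[OF k m, of x] d0 by simp
      have "pcM (?m x) x - pcM (?m \<zeta>) x \<le> (?m x - ?m \<zeta>) * pcR (?m x) x"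
        by (rule pcM_increment[OF min l])
      also have "\<dots> \<le> (x - \<zeta>)\<^sup>2 * pcR (?m x) x" using q R by (intro mult_right_mono) auto
      finally have "\<bar>pcM (?m x) x - pcM (?m \<zeta>) x\<bar> \<le> \<bar>x - \<zeta>\<bar> * (\<bar>x - \<zeta>\<bar> * pcR (?m x) x)"
        using pcM_increment(1)[OF min l, of x] by (simp add: power2_eq_square mult.assoc[symmetric])
      then show ?case using elim(2) by (simp add: abs_divide divide_le_eq mult.commute)
    qed
    have "((\<lambda>x. \<bar>x - \<zeta>\<bar> * pcR (?m x) x) \<longlongrightarrow> \<bar>\<zeta> - \<zeta>\<bar> * pcR (?m \<zeta>) \<zeta>) (at \<zeta>)"
      using isCont_pcR_mu(1)[OF k m] unfolding isCont_def by (intro tendsto_intros)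
    then show "((\<lambda>x. \<bar>x - \<zeta>\<bar> * pcR (?m x) x) \<longlongrightarrow> 0) (at \<zeta>)" by simp
  qed
  have "((\<lambda>x. pcM (?m x) x) has_real_derivative 0) (at \<zeta>)"
    using DERIV_add[OF g1 g2] by simp
  then have "(?D has_real_derivative 2 * (pcM (?m \<zeta>) \<zeta> * 0) + 0 - 2 * \<zeta>) (at \<zeta>)"
    using dm d0 by (auto intro!: derivative_eq_intros)
  then have dD: "((\<lambda>x. ?D x / (x - \<zeta>)) \<longlongrightarrow> - 2 * \<zeta>) (at \<zeta>)"
    using D0 by (simp add: has_field_derivative_iff)
  have n: "(?N \<longlongrightarrow> ?N \<zeta>) (at \<zeta>)" using isCont_pcN_mu[OF k m] by (simp add: isCont_def)
  \<comment> \<open>The numerator of \<open>dmu\<close> vanishes at \<zeta>, so continuity of the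
    denominator is enough to differentiate the quotient.\<close>
  have "((\<lambda>x. (1 + 1 / k\<^sup>2) * (?D x / (x - \<zeta>)) / ?N x) \<longlongrightarrow> (1 + 1 / k\<^sup>2) * (- 2 * \<zeta>) / ?N \<zeta>) (at \<zeta>)"
    using pcN_pos[OF k m, of \<zeta>] by (intro tendsto_intros dD n) auto
  then show "(dmu k has_real_derivative (1 + 1 / k\<^sup>2) * (- 2 * \<zeta>) / ?N \<zeta>) (at \<zeta>)"
    unfolding has_field_derivative_iff d0 by (simp add: dmu_def mult.commute)
qed

section \<open>Minimum of the band function and the ground state\<close>

text \<open>By \<open>Tf_pf\<close> the expression is twice the first moment of the profile, which
  is positive for x >= 0.\<close>

lemma pcM_critical_neg:
  assumes l: "l < 1" and D: "(pcM l x)\<^sup>2 + l - x\<^sup>2 = 0"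
  shows "x < 0"
proof (rule ccontr)
  assume "\<not> x < 0"
  then have x: "x \<ge> 0" by simp
  have "Tf x (pf l x) > 0"
    unfolding Tf_def
  proof (rule set_integral_pos)
    show "set_integrable lborel {0<..} (\<lambda>t. (t + x) * (pf l x t)\<^sup>2)"
      using HL_pf[OF l] by (auto simp: HL_def intro: in_H1_pos_integrable)
    show "(t + x) * (pf l x t)\<^sup>2 > 0" if "t > 0" for t using pf_pos[OF l, of x t] x that by simp
  qed
  then show False using Tf_pf[OF l, of x] D by simp
qed

lemma pcM_critical_unique:
  assumes l: "l < 1" and x: "(pcM l x)\<^sup>2 + l - x\<^sup>2 = 0" and y: "(pcM l y)\<^sup>2 + l - y\<^sup>2 = 0"
  shows "x = y"
proof -
  let ?Z = "\<lambda>x. ((pcM l x)\<^sup>2 + l - x\<^sup>2) * (pcF l x)\<^sup>2"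
  have dZ: "(?Z has_real_derivative - 2 * z * (pcF l z)\<^sup>2) (at z)" for z
  proof -
    have "(?Z has_real_derivative (2 * pcM l z * (z\<^sup>2 - l - (pcM l z)\<^sup>2) - 2 * z) * (pcF l z)\<^sup>2
       + ((pcM l z)\<^sup>2 + l - z\<^sup>2) * (2 * pcF l z * (pcM l z * pcF l z))) (at z)"
      by (auto intro!: derivative_eq_intros pcM_deriv[OF l] pcF_deriv[OF l])
    then show ?thesis by (rule DERIV_cong) (simp add: power2_eq_square algebra_simps)
  qed
  have less: False if "u < v" and u: "(pcM l u)\<^sup>2 + l - u\<^sup>2 = 0" and v: "(pcM l v)\<^sup>2 + l - v\<^sup>2 = 0" for u v
  proof -
    \<comment> \<open>The larger zero is negative, so Z increases strictly between the two.\<close>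
    have "?Z u < ?Z v"
    proof (rule DERIV_pos_imp_increasing[OF \<open>u < v\<close>])
      fix z assume "u \<le> z" "z \<le> v"
      then have "z < 0" using pcM_critical_neg[OF l v] by simp
      then have "- 2 * z * (pcF l z)\<^sup>2 > 0" using pcF_pos[OF l, of z] by (intro mult_pos_pos[of "- 2 * z"]) auto
      then show "\<exists>d. (?Z has_real_derivative d) (at z) \<and> d > 0" using dZ by blast
    qed
    then show False using u v by simp
  qed
  show ?thesis using less[of x y] less[of y x] x y by (cases x y rule: linorder_cases) auto
qed

text \<open>Let l increase to k^2. The left parameter l/k^2 tends to 1, where the slope becomes
  Gaussian, and G tends to \<open>pcM (k^2) x - x\<close>, positive for the x of
  \<open>pcM_gt_self\<close>.\<close>

lemma exists_mu_less:
  assumes k: "0 < k" "k < 1"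
  shows "\<exists>l \<xi>. l < k\<^sup>2 \<and> mu (- k\<^sup>2) \<xi> < l"
proof -
  have b: "0 < k\<^sup>2" "k\<^sup>2 < 1" using k by (auto simp: power_less_one_iff)
  obtain x where x: "x < 0" "pcM (k\<^sup>2) x > x" using pcM_gt_self[of "k\<^sup>2"] b by auto
  have f: "filterlim (\<lambda>l. l / k\<^sup>2) (at_left 1) (at_left (k\<^sup>2))"
  proof (rule tendsto_imp_filterlim_at_left)
    show "((\<lambda>l. l / k\<^sup>2) \<longlongrightarrow> 1) (at_left (k\<^sup>2))" using b by (auto intro!: tendsto_eq_intros)
    show "\<forall>\<^sub>F l in at_left (k\<^sup>2). l / k\<^sup>2 < 1"
      using b by (intro eventually_at_leftI[of 0]) auto
  qed
  have 1: "((\<lambda>l. pcM (l / k\<^sup>2) (x / k)) \<longlongrightarrow> - (x / k)) (at_left (k\<^sup>2))"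
    by (rule filterlim_compose[OF pcM_tendsto_1 f])
  have 2: "((\<lambda>l. pcM l x) \<longlongrightarrow> pcM (k\<^sup>2) x) (at_left (k\<^sup>2))"
    by (rule pcM_tendsto) (use b in auto)
  have "((\<lambda>l. pcG k l x) \<longlongrightarrow> pcM (k\<^sup>2) x + k * - (x / k)) (at_left (k\<^sup>2))"
    unfolding pcG_def by (intro tendsto_intros 1 2)
  moreover have "0 < pcM (k\<^sup>2) x + k * - (x / k)" using x k by simp
  ultimately have "eventually (\<lambda>l. pcG k l x > 0) (at_left (k\<^sup>2))" by (rule order_tendstoD(1))
  moreover have "eventually (\<lambda>l. l < k\<^sup>2) (at_left (k\<^sup>2))"
    using b by (intro eventually_at_leftI[of 0]) auto
  ultimately have "eventually (\<lambda>l. pcG k l x > 0 \<and> l < k\<^sup>2) (at_left (k\<^sup>2))" by eventually_elim simp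
  then obtain l where "pcG k l x > 0" "l < k\<^sup>2" using eventually_happens[of _ "at_left (k\<^sup>2)"] by auto
  then show ?thesis using mu_less_of_pcG[OF k] by blast
qed

lemma mu_attains_min:
  assumes k: "0 < k" "k < 1"
  shows "\<exists>\<zeta>. mu (- k\<^sup>2) \<zeta> < k\<^sup>2 \<and> (\<forall>\<xi>. mu (- k\<^sup>2) \<zeta> \<le> mu (- k\<^sup>2) \<xi>)"
proof -
  obtain l x where l: "l < k\<^sup>2" and x: "mu (- k\<^sup>2) x < l" using exists_mu_less[OF k] by blast
  have l1: "l < 1" and l2: "l / k\<^sup>2 < 1" using less_sq_imp_less_1[OF k l] div_sq_less_1[OF k(1) l] by auto
  obtain X1 where X1: "X1 \<le> 0" "\<And>x. x \<le> X1 \<Longrightarrow> pcM l x < 0" using pcM_neg_at_bot[OF l1] by blast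
  obtain X2 where X2: "X2 \<le> 0" "\<And>x. x \<le> X2 \<Longrightarrow> pcM (l / k\<^sup>2) x < 0" using pcM_neg_at_bot[OF l2] by blast
  \<comment> \<open>The left profile is evaluated at \<xi>/k, so its threshold is scaled by
    k.\<close>
  define X where "X = min X1 (k * X2)"
  have out: "l \<le> mu (- k\<^sup>2) \<xi>" if "\<xi> \<notin> {X..0}" for \<xi>
  proof (rule mu_ge_of_pcG[OF k l])
    have "pcM l \<xi> \<le> 0 \<and> pcM (l / k\<^sup>2) (\<xi> / k) \<le> 0"
    proof (cases "\<xi> > 0")
      case True
      then have "\<xi> / k > 0" using k by simp
      then show ?thesis using pcM_less[OF l1, of \<xi>] pcM_less[OF l2, of "\<xi> / k"] True by linarith
    next
      case False
      then have "\<xi> < X" using that by auto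
      then have "\<xi> \<le> X1" "\<xi> \<le> k * X2" by (auto simp: X_def)
      moreover from this have "\<xi> / k \<le> X2" using k by (simp add: divide_le_eq mult.commute)
      ultimately show ?thesis using X1(2) X2(2) by (simp add: less_imp_le)
    qed
    then show "pcG k l \<xi> \<le> 0" using k by (simp add: pcG_def add_nonpos_nonpos mult_nonneg_nonpos)
  qed
  have xX: "x \<in> {X..0}" using out[of x] x by (meson not_less)
  have "\<exists>\<zeta>\<in>{X..0}. \<forall>\<xi>\<in>{X..0}. mu (- k\<^sup>2) \<zeta> \<le> mu (- k\<^sup>2) \<xi>"
  proof (rule continuous_attains_inf)
    show "continuous_on {X..0} (mu (- k\<^sup>2))" by (rule continuous_on_subset[OF mu_continuous[OF k]]) simp
  qed (use xX in auto)
  then obtain \<zeta> where z: "\<zeta> \<in> {X..0}" "\<And>\<xi>. \<xi> \<in> {X..0} \<Longrightarrow> mu (- k\<^sup>2) \<zeta> \<le> mu (- k\<^sup>2) \<xi>" by blast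
  have "mu (- k\<^sup>2) \<zeta> \<le> mu (- k\<^sup>2) \<xi>" for \<xi>
  proof (cases "\<xi> \<in> {X..0}")
    case False
    then show ?thesis using out[OF False] z(2)[OF xX] x by linarith
  qed (rule z(2))
  moreover have "mu (- k\<^sup>2) \<zeta> < k\<^sup>2" using z(2)[OF xX] x l by linarith
  ultimately show ?thesis by blast
qed

lemma beta_eq_iff:
  assumes k: "0 < k" "k < 1"
  shows "beta (- k\<^sup>2) = mu (- k\<^sup>2) \<zeta> \<longleftrightarrow> (\<forall>\<xi>. mu (- k\<^sup>2) \<zeta> \<le> mu (- k\<^sup>2) \<xi>)"
proof
  have bdd: "bdd_below (range (mu (- k\<^sup>2)))" using mu_nonneg[OF k] by (auto intro!: bdd_belowI[of _ 0])
  show "beta (- k\<^sup>2) = mu (- k\<^sup>2) \<zeta> \<Longrightarrow> \<forall>\<xi>. mu (- k\<^sup>2) \<zeta> \<le> mu (- k\<^sup>2) \<xi>"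
    unfolding beta_def by (metis UNIV_I cINF_lower[OF bdd])
  assume "\<forall>\<xi>. mu (- k\<^sup>2) \<zeta> \<le> mu (- k\<^sup>2) \<xi>"
  then have "mu (- k\<^sup>2) \<zeta> \<le> beta (- k\<^sup>2)" unfolding beta_def by (intro cINF_greatest) auto
  moreover have "beta (- k\<^sup>2) \<le> mu (- k\<^sup>2) \<zeta>" unfolding beta_def by (rule cINF_lower[OF bdd]) simp
  ultimately show "beta (- k\<^sup>2) = mu (- k\<^sup>2) \<zeta>" by simp
qed

text \<open>For a parameter l <= 0 both slopes are negative, so G cannot vanish. Positivity makes
  the final comparison in \<open>beta_less_Theta0\<close> strict.\<close>

lemma mu_pos:
  assumes k: "0 < k" "k < 1" and m: "mu (- k\<^sup>2) \<xi> < k\<^sup>2"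
  shows "mu (- k\<^sup>2) \<xi> > 0"
proof (rule ccontr)
  let ?m = "mu (- k\<^sup>2) \<xi>"
  assume "\<not> ?m > 0"
  then have "?m \<le> 0" "?m / k\<^sup>2 \<le> 0" using k by (auto simp: divide_le_0_iff)
  then have "pcM ?m \<xi> < 0" "k * pcM (?m / k\<^sup>2) (\<xi> / k) < 0" using pcM_neg k by (auto simp: mult_pos_neg)
  then show False using pcG_mu[OF k m] by (simp add: pcG_def)
qed

text \<open>After its last zero f stays negative up to b, so f' <= 0 at that zero. Applied to M,
  whose derivative at a zero is x^2 - l, this provides a Neumann profile with x^2 <= l.\<close>

lemma DERIV_last_zero:
  fixes f f' :: "real \<Rightarrow> real"
  assumes ab: "a < b" and f: "\<And>x. (f has_real_derivative f' x) (at x)" and fa: "f a > 0" and fb: "f b < 0"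
  shows "\<exists>x. a < x \<and> x < b \<and> f x = 0 \<and> f' x \<le> 0"
proof -
  have c: "continuous_on S f" for S by (intro continuous_at_imp_continuous_on ballI DERIV_isCont[OF f])
  define Z where "Z = {x \<in> {a..b}. f x = 0}"
  have "\<exists>x\<ge>a. x \<le> b \<and> f x = 0" using IVT2'[of f b 0 a] fa fb ab c by auto
  then have Zne: "Z \<noteq> {}" by (auto simp: Z_def)
  have "Z = {a..b} \<inter> {x. f x = 0}" by (auto simp: Z_def)
  then have "compact Z" by (simp add: compact_Int_closed closed_Collect_eq c continuous_on_const)
  then obtain x where x: "x \<in> Z" "\<And>y. y \<in> Z \<Longrightarrow> y \<le> x" using compact_attains_sup[OF _ Zne] by blast
  have xb: "a < x" "x < b" "f x = 0" using x(1) fa fb by (auto simp: Z_def less_le)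
  have neg: "f y < 0" if y: "x < y" "y \<le> b" for y
  proof (rule ccontr)
    assume "\<not> f y < 0"
    then have "\<exists>z\<ge>y. z \<le> b \<and> f z = 0" using IVT2'[of f b 0 y] fb y c by auto
    then obtain z where "z \<ge> y" "z \<le> b" "f z = 0" by blast
    then have "z \<in> Z" using y xb by (auto simp: Z_def)
    then show False using x(2)[of z] \<open>z \<ge> y\<close> y by simp
  qed
  have "f' x \<le> 0"
  proof (rule ccontr)
    assume "\<not> f' x \<le> 0"
    then obtain d where d: "d > 0" "\<And>h. 0 < h \<Longrightarrow> h < d \<Longrightarrow> f x < f (x + h)"
      using DERIV_pos_inc_right[OF f[of x]] by auto
    define h where "h = min (d / 2) (b - x)"
    have "0 < h" "h < d" "x + h \<le> b" using d xb by (auto simp: h_def)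
    then show False using d(2)[of h] neg[of "x + h"] xb by simp
  qed
  then show ?thesis using xb by blast
qed

text \<open>The same profile goes on both sides, but on the left the potential sits at x/k instead
  of x. The linear term of this shift is nonpositive, as 2 Tf = l - x^2 >= 0 and x/k <= x; the
  quadratic term costs at most l (1/k - 1)^2 R. After multiplication by k the weights k + k^2 + (1 -
  k)^2 add up to 1 - k + 2 k^2.\<close>

lemma mu_le_of_Neumann:
  assumes k: "0 < k" "k < 1" and l: "l < 1" and x: "x < 0" "x\<^sup>2 \<le> l" and M: "pcM l x = 0"
  shows "mu (- k\<^sup>2) x * (1 + k) \<le> l * (1 - k + 2 * k\<^sup>2)"
proof -
  let ?f = "pf l x" and ?g = "pg l x" and ?R = "pcR l x"
  let ?d = "x / k - x"
  have R: "?R > 0" by (rule pcR_pos[OF l])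
  note G = glue_forms[OF k(1) HL_pf[OF l, of x] HL_pf[OF l, of x] refl]
  have d: "?d \<le> 0" using k x by (simp add: divide_le_eq)
  have d2: "?d\<^sup>2 \<le> l * (1 / k - 1)\<^sup>2"
  proof -
    have "?d = x * (1 / k - 1)" by (simp add: right_diff_distrib)
    then have "?d\<^sup>2 = x\<^sup>2 * (1 / k - 1)\<^sup>2" by (simp only: power_mult_distrib)
    then show ?thesis using x(2) by (simp add: mult_right_mono)
  qed
  have "2 * Tf x ?f \<ge> 0" using Tf_pf[OF l, of x] M x(2) by simp
  then have t: "2 * ?d * Tf x ?f \<le> 0" using d by (simp add: mult_nonpos_nonneg)
  have Q: "Qf x ?f ?g = l * ?R" using Qf_pf[OF l, of x] M by simp
  have "Qf (x / k) ?f ?g = l * ?R + 2 * ?d * Tf x ?f + ?d\<^sup>2 * ?R"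
    using Qf_shift[OF HL_pf[OF l, of x], of "x / k" x] unfolding Q pcR_def .
  also have "\<dots> \<le> l * ?R + l * (1 / k - 1)\<^sup>2 * ?R" using t mult_right_mono[OF d2, of ?R] R by linarith
  finally have Q2: "Qf (x / k) ?f ?g \<le> l * ?R + l * (1 / k - 1)\<^sup>2 * ?R" .
  have "mu (- k\<^sup>2) x * (?R + ?R / k) \<le> Qf x ?f ?g + k * Qf (x / k) ?f ?g"
    using mu_le[OF G(1), of "- k\<^sup>2" x] unfolding G(2)[of x] G(3) pcR_def .
  also have "\<dots> \<le> l * ?R + k * (l * ?R + l * (1 / k - 1)\<^sup>2 * ?R)" 
    unfolding Q using Q2 k by simp
  finally have "k * (mu (- k\<^sup>2) x * (?R + ?R / k)) \<le> k * (l * ?R + k * (l * ?R + l * (1 / k - 1)\<^sup>2 * ?R))"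
    using k by simp
  also have "k * (mu (- k\<^sup>2) x * (?R + ?R / k)) = (mu (- k\<^sup>2) x * (1 + k)) * ?R" using k by (simp add: field_simps)
  also have "k * (l * ?R + k * (l * ?R + l * (1 / k - 1)\<^sup>2 * ?R)) = l * (k + k\<^sup>2 + (k * (1 / k - 1))\<^sup>2) * ?R"
    by (simp add: power2_eq_square algebra_simps)
  also have "k * (1 / k - 1) = 1 - k" using k by (simp add: right_diff_distrib)
  also have "l * (k + k\<^sup>2 + (1 - k)\<^sup>2) = l * (1 - k + 2 * k\<^sup>2)" by (simp add: power2_eq_square algebra_simps)
  finally show ?thesis using R by simp
qed

lemma beta_less_Theta0:
  assumes k: "0 < k" "k < 1" and m: "mu (- k\<^sup>2) \<zeta> < k\<^sup>2" and min: "\<And>\<xi>. mu (- k\<^sup>2) \<zeta> \<le> mu (- k\<^sup>2) \<xi>"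
  shows "mu (- k\<^sup>2) \<zeta> < Theta0"
proof (rule ccontr)
  let ?m = "mu (- k\<^sup>2) \<zeta>" and ?c = "1 - k + 2 * k\<^sup>2"
  assume "\<not> ?m < Theta0"
  then have T: "Theta0 \<le> ?m" by simp
  have m1: "?m < 1" by (rule less_sq_imp_less_1[OF k m])
  have m0: "?m > 0" by (rule mu_pos[OF k m])
  \<comment> \<open>\<open>Theta0\<close> is an infimum, so l stays strictly above it and is chosen
    close to mu at the end.\<close>
  have key: "?m * (1 + k) \<le> l * ?c" if l: "?m < l" "l < 1" for l
  proof -
    obtain y where y: "pcM l y > 0" using Theta0_less_pcM[of l] T l by auto
    have y0: "y < 0" using pcM_less[OF l(2), of y] y by simp
    have M0: "pcM l 0 < 0" using pcM_less[OF l(2), of 0] by simp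
    obtain x where x: "x < 0" "pcM l x = 0" "x\<^sup>2 - l - (pcM l x)\<^sup>2 \<le> 0"
      using DERIV_last_zero[of y 0 "pcM l" "\<lambda>x. x\<^sup>2 - l - (pcM l x)\<^sup>2", OF y0 pcM_deriv[OF l(2)] y M0] by blast
    have "?m * (1 + k) \<le> mu (- k\<^sup>2) x * (1 + k)" using min[of x] k by (intro mult_right_mono) auto
    also have "\<dots> \<le> l * ?c" by (rule mu_le_of_Neumann[OF k l(2) x(1) _ x(2)]) (use x in simp)
    finally show ?thesis .
  qed
  have c: "?c > 0" using k by (simp add: add_pos_pos)
  \<comment> \<open>Equivalent to k^2 < k.\<close>
  have ck: "?c < 1 + k" using k by (simp add: power2_eq_square)
  have "?m < min 1 (?m * (1 + k) / ?c)" using m1 m0 c ck by (simp add: less_divide_eq)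
  then obtain l where l: "?m < l" "l < min 1 (?m * (1 + k) / ?c)" using dense by blast
  then have "l * ?c < ?m * (1 + k)" using c by (simp add: less_divide_eq)
  then show False using key[of l] l by simp
qed

section \<open>Minimisers as ground states, and their uniqueness\<close>

lemma in_B1_add_cmult:
  assumes u: "in_B1 u g" and v: "in_B1 v h"
  shows "in_B1 (\<lambda>t. u t + c * v t) (\<lambda>t. g t + c * h t)"
proof -
  have "sq_int_on UNIV (\<lambda>t. t * u t + c * (t * v t))"
    using u v by (intro sq_int_on_add sq_int_on_cmult) (auto simp: in_B1_def)
  moreover have "(\<lambda>t. t * u t + c * (t * v t)) = (\<lambda>t. t * (u t + c * v t))" by (simp add: fun_eq_iff algebra_simps)
  ultimately have "sq_int_on UNIV (\<lambda>t. t * (u t + c * v t))" by simp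
  moreover have "sq_int_on UNIV (\<lambda>t. u t + c * v t)" "sq_int_on UNIV (\<lambda>t. g t + c * h t)"
    using u v by (auto simp: in_B1_def intro!: sq_int_on_add sq_int_on_cmult)
  moreover have "weak_deriv_on UNIV (\<lambda>t. u t + c * v t) (\<lambda>t. g t + c * h t)"
  proof (rule weak_deriv_onI)
    fix x y :: real assume xy: "x \<le> y"
    have wu: "weak_deriv_on UNIV u g" and wv: "weak_deriv_on UNIV v h" using u v by (auto simp: in_B1_def)
    note U = weak_deriv_onD[OF wu UNIV_I UNIV_I xy] and V = weak_deriv_onD[OF wv UNIV_I UNIV_I xy]
    show "set_integrable lborel {x..y} (\<lambda>t. g t + c * h t)" by (intro set_integral_add set_integrable_mult_right U V)
    have "(LINT t:{x..y}|lborel. g t + c * h t) = (u y - u x) + c * (v y - v x)"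
      unfolding set_integral_add(2)[OF U(1) set_integrable_mult_right[OF V(1)]] set_integral_mult_right U(2) V(2) ..
    then show "u y + c * v y - (u x + c * v x) = (LINT t:{x..y}|lborel. g t + c * h t)" by (simp add: algebra_simps)
  qed
  ultimately show ?thesis by (simp add: in_B1_def)
qed

lemma zero_if_linear_nonneg:
  fixes x y :: real
  assumes "\<And>c. 0 \<le> 2 * c * x + c\<^sup>2 * y"
  shows "x = 0"
proof (rule ccontr)
  assume x: "x \<noteq> 0"
  define Y where "Y = \<bar>y\<bar> + 1"
  have Y: "Y > 0" "y < Y" by (auto simp: Y_def)
  \<comment> \<open>c = -x/Y minimises 2cx + c^2 Y, where Y is a positive bound for y.\<close>
  have "0 \<le> 2 * (- x / Y) * x + (- x / Y)\<^sup>2 * y" by (rule assms)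
  also have "\<dots> \<le> 2 * (- x / Y) * x + (- x / Y)\<^sup>2 * Y" using Y by (simp add: mult_left_mono)
  also have "\<dots> = - x\<^sup>2 / Y" using Y by (simp add: power2_eq_square field_simps)
  also have "\<dots> < 0" using x Y by simp
  finally show False by simp
qed

lemma
  assumes k: "k > 0" and u: "in_B1 u g" and v: "in_B1 v h"
  shows qform_add_cmult: "qform (- k\<^sup>2) \<xi> (\<lambda>t. u t + c * v t) (\<lambda>t. g t + c * h t) = qform (- k\<^sup>2) \<xi> u g
      + 2 * c * (LINT t|lborel. g t * h t + (\<xi> + sigma (- k\<^sup>2) t * t)\<^sup>2 * u t * v t) + c\<^sup>2 * qform (- k\<^sup>2) \<xi> v h"
    and L2sq_add_cmult: "L2sq (\<lambda>t. u t + c * v t) = L2sq u + 2 * c * (LINT t|lborel. u t * v t) + c\<^sup>2 * L2sq v"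
proof -
  let ?V = "\<lambda>t. (\<xi> + sigma (- k\<^sup>2) t * t)\<^sup>2"
  note i = form_integrand_integrable(1)[OF u u k, of \<xi>] form_integrand_integrable(1)[OF u v k, of \<xi>]
    form_integrand_integrable(1)[OF v v k, of \<xi>] form_integrand_integrable(2)[OF u u k]
    form_integrand_integrable(2)[OF u v k] form_integrand_integrable(2)[OF v v k]
  have q: "qform (- k\<^sup>2) \<xi> w f = (\<integral>t. f t * f t + ?V t * w t * w t \<partial>lborel)" for w f
    by (simp add: qform_def power2_eq_square mult.assoc)
  have "qform (- k\<^sup>2) \<xi> (\<lambda>t. u t + c * v t) (\<lambda>t. g t + c * h t) =
    (\<integral>t. (g t * g t + ?V t * u t * u t) + (2 * c) * (g t * h t + ?V t * u t * v t) + c\<^sup>2 * (h t * h t + ?V t * v t * v t) \<partial>lborel)"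
    unfolding q by (rule Bochner_Integration.integral_cong) (auto simp: power2_eq_square algebra_simps)
  also have "\<dots> = qform (- k\<^sup>2) \<xi> u g + 2 * c * (LINT t|lborel. g t * h t + ?V t * u t * v t) + c\<^sup>2 * qform (- k\<^sup>2) \<xi> v h"
    unfolding q using i by simp
  finally show "qform (- k\<^sup>2) \<xi> (\<lambda>t. u t + c * v t) (\<lambda>t. g t + c * h t) = qform (- k\<^sup>2) \<xi> u g
      + 2 * c * (LINT t|lborel. g t * h t + ?V t * u t * v t) + c\<^sup>2 * qform (- k\<^sup>2) \<xi> v h" .
  have l: "L2sq w = (\<integral>t. w t * w t \<partial>lborel)" for w by (simp add: L2sq_def power2_eq_square)
  have "L2sq (\<lambda>t. u t + c * v t) = (\<integral>t. u t * u t + (2 * c) * (u t * v t) + c\<^sup>2 * (v t * v t) \<partial>lborel)"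
    unfolding l by (rule Bochner_Integration.integral_cong) (auto simp: power2_eq_square algebra_simps)
  also have "\<dots> = L2sq u + 2 * c * (LINT t|lborel. u t * v t) + c\<^sup>2 * L2sq v"
    unfolding l using i by simp
  finally show "L2sq (\<lambda>t. u t + c * v t) = L2sq u + 2 * c * (LINT t|lborel. u t * v t) + c\<^sup>2 * L2sq v" .
qed

text \<open>First variation: along u + c v, the form minus \<open>mu\<close> times the squared norm
  is a nonnegative quadratic polynomial in c without constant term, so its linear coefficient
  vanishes, which is the weak eigenvalue equation.\<close>

lemma is_ground_stateI:
  assumes k: "k > 0" and u: "in_B1 u g" and pos: "\<And>t. u t > 0" and L: "L2sq u = 1" and q: "qform (- k\<^sup>2) \<xi> u g = mu (- k\<^sup>2) \<xi>"
  shows "is_ground_state (- k\<^sup>2) \<xi> u"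
  unfolding is_ground_state_def
proof (intro exI[of _ g] conjI allI impI u L pos)
  fix v h assume v: "in_B1 v h"
  let ?B = "LINT t|lborel. g t * h t + (\<xi> + sigma (- k\<^sup>2) t * t)\<^sup>2 * u t * v t" and ?I = "LINT t|lborel. u t * v t"
  let ?m = "mu (- k\<^sup>2) \<xi>"
  have "?B - ?m * ?I = 0"
  proof (rule zero_if_linear_nonneg)
    fix c
    have "?m * (1 + 2 * c * ?I + c\<^sup>2 * L2sq v) \<le> ?m + 2 * c * ?B + c\<^sup>2 * qform (- k\<^sup>2) \<xi> v h"
      using mu_le[OF in_B1_add_cmult[OF u v, of c], of "- k\<^sup>2" \<xi>]
      unfolding qform_add_cmult[OF k u v] L2sq_add_cmult[OF k u v] L q .
    then show "0 \<le> 2 * c * (?B - ?m * ?I) + c\<^sup>2 * (qform (- k\<^sup>2) \<xi> v h - ?m * L2sq v)"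
      by (simp add: algebra_simps)
  qed
  then show "?B = ?m * ?I" by simp
qed

text \<open>u is continuous, so vanishing almost everywhere becomes vanishing everywhere. The
  definite description in \<open>phi\<close> asks for such pointwise uniqueness.\<close>

lemma L2sq_zero:
  assumes u: "in_B1 u g" and L: "L2sq u = 0"
  shows "u t = 0"
proof -
  have i: "set_integrable lborel UNIV (\<lambda>t. (u t)\<^sup>2)" using u by (simp add: in_B1_def sq_int_on_def)
  let ?I = "{t - 1..t + 1}"
  have iI: "set_integrable lborel ?I (\<lambda>t. (u t)\<^sup>2)" by (rule set_integrable_subset[OF i]) auto
  have "weak_deriv_on ?I u g" using u by (auto simp: in_B1_def intro: weak_deriv_on_subset)
  then have c: "continuous_on ?I u" by (rule weak_deriv_on_continuous)
  have "(LINT t:?I|lborel. (u t)\<^sup>2) \<le> L2sq u"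
    unfolding L2sq_def set_lebesgue_integral_def
    by (rule integral_mono) (use i iI in \<open>auto simp: set_integrable_def indicator_def\<close>)
  moreover have "(LINT t:?I|lborel. (u t)\<^sup>2) \<ge> 0"
    unfolding set_lebesgue_integral_def by (intro Bochner_Integration.integral_nonneg) auto
  ultimately have "integral ?I (\<lambda>t. (u t)\<^sup>2) = 0" using set_borel_integral_eq_integral(2)[OF iI] L by simp
  then have "\<forall>x\<in>?I. (u x)\<^sup>2 = 0"
    by (subst (asm) integral_eq_0_iff) (auto intro!: continuous_intros c)
  then show ?thesis by simp
qed

text \<open>Subtract a multiple of v to get w with w(0) = 0. By bilinearity q(w) is still mu times
  the squared norm of w, but \<open>qform_picone\<close>, freed of its boundary term, bounds q(w)
  below by some l > mu times that norm, so w = 0. Positivity and normalisation fix the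
  factor.\<close>

lemma ground_state_unique:
  assumes k: "0 < k" "k < 1" and m: "mu (- k\<^sup>2) \<xi> < k\<^sup>2"
    and u: "is_ground_state (- k\<^sup>2) \<xi> u" and v: "is_ground_state (- k\<^sup>2) \<xi> v"
  shows "u = v"
proof -
  let ?m = "mu (- k\<^sup>2) \<xi>" and ?V = "\<lambda>t. (\<xi> + sigma (- k\<^sup>2) t * t)\<^sup>2"
  obtain g where g: "in_B1 u g" "\<And>t. u t > 0" "L2sq u = 1"
    "\<And>w f. in_B1 w f \<Longrightarrow> (LINT t|lborel. g t * f t + ?V t * u t * w t) = ?m * (LINT t|lborel. u t * w t)"
    using u unfolding is_ground_state_def by blast
  obtain h where h: "in_B1 v h" "\<And>t. v t > 0" "L2sq v = 1"
    "\<And>w f. in_B1 w f \<Longrightarrow> (LINT t|lborel. h t * f t + ?V t * v t * w t) = ?m * (LINT t|lborel. v t * w t)"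
    using v unfolding is_ground_state_def by blast
  have qq: "qform (- k\<^sup>2) \<xi> w f = (\<integral>t. f t * f t + ?V t * w t * w t \<partial>lborel)" for w f
    by (simp add: qform_def power2_eq_square mult.assoc)
  have ll: "L2sq w = (\<integral>t. w t * w t \<partial>lborel)" for w by (simp add: L2sq_def power2_eq_square)
  have qu: "qform (- k\<^sup>2) \<xi> u g = ?m * L2sq u" unfolding qq ll by (rule g(4)[OF g(1)])
  have qv: "qform (- k\<^sup>2) \<xi> v h = ?m * L2sq v" unfolding qq ll by (rule h(4)[OF h(1)])
  define c where "c = - u 0 / v 0"
  let ?w = "\<lambda>t. u t + c * v t" and ?f = "\<lambda>t. g t + c * h t"
  have w: "in_B1 ?w ?f" by (rule in_B1_add_cmult[OF g(1) h(1)])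
  have w0: "?w 0 = 0" using h(2)[of 0] by (simp add: c_def)
  have "qform (- k\<^sup>2) \<xi> ?w ?f = ?m * L2sq ?w"
    unfolding qform_add_cmult[OF k(1) g(1) h(1)] L2sq_add_cmult[OF k(1) g(1) h(1)] qu qv g(4)[OF h(1)]
    by (simp add: algebra_simps)
  moreover define l where "l = (?m + k\<^sup>2) / 2"
  have l: "?m < l" "l < k\<^sup>2" using m by (auto simp: l_def)
  have "l * L2sq ?w - pcG k l \<xi> * (?w 0)\<^sup>2 \<le> qform (- k\<^sup>2) \<xi> ?w ?f"
    by (rule qform_picone[OF k l(2) w])
  ultimately have "l * L2sq ?w \<le> ?m * L2sq ?w" unfolding w0 by simp
  then have "L2sq ?w = 0" 
    using L2sq_nonneg[of ?w] l(1) mult_strict_right_mono[OF l(1), of "L2sq ?w"] by (cases "L2sq ?w = 0") auto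
  then have uv: "u t = - c * v t" for t using L2sq_zero[OF w, of t] by simp
  then have "L2sq u = (- c)\<^sup>2 * L2sq v" unfolding L2sq_def by (simp add: power_mult_distrib)
  then have "(- c)\<^sup>2 = 1" using g(3) h(3) by simp
  moreover have "- c > 0" using g(2)[of 0] h(2)[of 0] by (simp add: c_def)
  ultimately have "- c = 1" unfolding power2_eq_1_iff by auto
  then show ?thesis using uv by (simp add: fun_eq_iff)
qed

lemma phi_eq:
  assumes k: "0 < k" "k < 1" and m: "mu (- k\<^sup>2) \<xi> < k\<^sup>2"
  shows "phi (- k\<^sup>2) \<xi> = (\<lambda>t. glue k (pf (mu (- k\<^sup>2) \<xi>) \<xi>) (pf (mu (- k\<^sup>2) \<xi> / k\<^sup>2) (\<xi> / k)) t / sqrt (pcN k (mu (- k\<^sup>2) \<xi>) \<xi>))"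
proof -
  let ?m = "mu (- k\<^sup>2) \<xi>"
  let ?u = "glue k (pf ?m \<xi>) (pf (?m / k\<^sup>2) (\<xi> / k))" and ?g = "dglue k (pg ?m \<xi>) (pg (?m / k\<^sup>2) (\<xi> / k))"
  let ?N = "pcN k ?m \<xi>"
  define c where "c = 1 / sqrt ?N"
  have l1: "?m < 1" and l2: "?m / k\<^sup>2 < 1" using less_sq_imp_less_1[OF k m] div_sq_less_1[OF k(1) m] by auto
  note T = trial_function[OF k m, of \<xi>]
  have N: "?N > 0" by (rule pcN_pos[OF k m])
  have c: "c > 0" "c\<^sup>2 * ?N = 1" using N by (auto simp: c_def power_divide)
  \<comment> \<open>With the zero function as first summand, the rules for u + c v become scaling
    rules.\<close>
  have z: "in_B1 (\<lambda>t. 0) (\<lambda>t. 0)"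
    using in_B1_add_cmult[OF T(1) T(1), of "-1"] by simp
  have z0: "qform (- k\<^sup>2) \<xi> (\<lambda>t. 0) (\<lambda>t. 0) = 0" "L2sq (\<lambda>t. 0) = 0" by (auto simp: qform_def L2sq_def)
  have B: "in_B1 (\<lambda>t. c * ?u t) (\<lambda>t. c * ?g t)" using in_B1_add_cmult[OF z T(1), of c] by simp
  have q: "qform (- k\<^sup>2) \<xi> (\<lambda>t. c * ?u t) (\<lambda>t. c * ?g t) = c\<^sup>2 * qform (- k\<^sup>2) \<xi> ?u ?g"
    using qform_add_cmult[OF k(1) z T(1), of \<xi> c] z0 by simp
  have L: "L2sq (\<lambda>t. c * ?u t) = c\<^sup>2 * L2sq ?u"
    using L2sq_add_cmult[OF k(1) z T(1), of c] z0 by simp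
  have "is_ground_state (- k\<^sup>2) \<xi> (\<lambda>t. c * ?u t)"
  proof (rule is_ground_stateI[OF k(1) B])
    show "0 < c * ?u t" for t using c pf_pos[OF l1] pf_pos[OF l2] by (simp add: glue_def)
    show "L2sq (\<lambda>t. c * ?u t) = 1" unfolding L T(2) by (rule c(2))
    have "c\<^sup>2 * (?m * ?N) = ?m" using c(2) by (simp add: mult.left_commute)
    then show "qform (- k\<^sup>2) \<xi> (\<lambda>t. c * ?u t) (\<lambda>t. c * ?g t) = ?m" unfolding q T(3) pcG_mu[OF k m] by simp
  qed
  then have "phi (- k\<^sup>2) \<xi> = (\<lambda>t. c * ?u t)"
    unfolding phi_def using ground_state_unique[OF k m] by (intro the_equality) blast+
  then show ?thesis by (simp add: c_def)
qed

lemma glue_deriv_0: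
  assumes k: "k > 0" and u: "(u has_real_derivative d) (at 0)" and v: "(v has_real_derivative e) (at 0)"
    and 0: "u 0 = v 0" and e: "d = - k * e"
  shows "(glue k u v has_real_derivative d) (at 0)"
proof -
  have v': "((\<lambda>t. v (- k * t)) has_real_derivative d) (at 0)"
  proof -
    have "((\<lambda>t. - k * t) has_real_derivative - k) (at 0)" by (auto intro!: derivative_eq_intros)
    then have "((\<lambda>t. v (- k * t)) has_real_derivative e * - k) (at 0)" by (intro DERIV_chain2[of v]) (use v in auto)
    then show ?thesis by (simp add: e mult.commute)
  qed
  have "((\<lambda>t. (glue k u v t - glue k u v 0) / (t - 0)) \<longlongrightarrow> d) (at_right 0)"
  proof (rule Lim_transform_eventually)
    show "((\<lambda>t. (u t - u 0) / (t - 0)) \<longlongrightarrow> d) (at_right 0)"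
      using u unfolding has_field_derivative_iff by (rule tendsto_within_subset) simp
    show "\<forall>\<^sub>F t in at_right 0. (u t - u 0) / (t - 0) = (glue k u v t - glue k u v 0) / (t - 0)"
      by (rule eventually_at_rightI[of 0 1]) (auto simp: glue_def 0)
  qed
  then show ?thesis unfolding has_field_derivative_iff
  proof (rule filterlim_split_at[rotated])
    show "((\<lambda>t. (glue k u v t - glue k u v 0) / (t - 0)) \<longlongrightarrow> d) (at_left 0)"
  proof (rule Lim_transform_eventually)
    show "((\<lambda>t. (v (- k * t) - v (- k * 0)) / (t - 0)) \<longlongrightarrow> d) (at_left 0)"
      using v' unfolding has_field_derivative_iff by (rule tendsto_within_subset) simp
    show "\<forall>\<^sub>F t in at_left 0. (v (- k * t) - v (- k * 0)) / (t - 0) = (glue k u v t - glue k u v 0) / (t - 0)"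
      by (rule eventually_at_leftI[of "-1"]) (auto simp: glue_def)
  qed
  qed
qed

theorem theorem1p1:
  fixes a :: real
  assumes "-1 < a" and "a < 0"
  shows "(\<exists>!\<zeta>. beta a = mu a \<zeta>) \<and>
         \<bar>a\<bar> * Theta0 < beta a \<and> beta a < Theta0 \<and>
         (\<forall>\<zeta>. beta a = mu a \<zeta> \<longrightarrow>
            \<zeta> < 0 \<and> deriv (deriv (mu a)) \<zeta> > 0 \<and>
            (\<exists>d. (phi a \<zeta> has_real_derivative d) (at 0) \<and> d < 0))"
proof -
  define k where "k = sqrt (- a)"
  have a: "a = - k\<^sup>2" and k: "0 < k" "k < 1" using assms by (auto simp: k_def)
  let ?m = "mu (- k\<^sup>2)"
  obtain z where z: "?m z < k\<^sup>2" "\<And>\<xi>. ?m z \<le> ?m \<xi>" using mu_attains_min[OF k] by blast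
  have bz: "beta (- k\<^sup>2) = ?m z" using beta_eq_iff[OF k] z(2) by blast
  define b where "b = ?m z"
  have b1: "b < 1" "b / k\<^sup>2 < 1" using less_sq_imp_less_1[OF k z(1)] div_sq_less_1[OF k(1) z(1)] by (auto simp: b_def)
  have crit: "(pcM b x)\<^sup>2 + b - x\<^sup>2 = 0" if "?m x = b" for x
    using dmu_deriv_at_min(1)[OF k, of x] z that by (simp add: b_def)
  have uniq: "x = z" if "?m x = b" for x
    using pcM_critical_unique[OF b1(1) crit[OF that] crit[of z]] by (simp add: b_def)
  have zneg: "z < 0" by (rule pcM_critical_neg[OF b1(1) crit]) (simp add: b_def)
  have bT: "b < Theta0" unfolding b_def by (rule beta_less_Theta0[OF k z])
  have M1: "pcM b z < 0"
  proof (rule ccontr)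
    assume "\<not> pcM b z < 0"
    \<comment> \<open>The right half of the ground state serves as Neumann test function; a
      nonnegative slope would push its quotient down to b < Theta0.\<close>
    moreover have "Theta0 * pcR b z \<le> b * pcR b z - pcM b z"
      using Theta0_le[OF HL_pf[OF b1(1)], of z z] pcR_pos[OF b1(1), of z] unfolding Qf_pf[OF b1(1)] pcR_def by simp
    ultimately have "Theta0 * pcR b z \<le> b * pcR b z" by simp
    then show False using pcR_pos[OF b1(1), of z] bT by simp
  qed
  have M2: "pcM b z = - k * pcM (b / k\<^sup>2) (z / k)" using pcG_mu[OF k z(1)] by (simp add: pcG_def b_def)
  have lower: "k\<^sup>2 * Theta0 < b"
  proof -
    let ?R = "pcR (b / k\<^sup>2) (z / k)"
    have "Theta0 * ?R \<le> b / k\<^sup>2 * ?R - pcM (b / k\<^sup>2) (z / k)"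
      using Theta0_le[OF HL_pf[OF b1(2)], of "z / k" "z / k"] pcR_pos[OF b1(2), of "z / k"] unfolding Qf_pf[OF b1(2)] pcR_def by simp
    \<comment> \<open>This sign makes the lower bound strict.\<close>
    moreover have "pcM (b / k\<^sup>2) (z / k) > 0" using M1 M2 k by (simp add: zero_less_mult_iff)
    ultimately have "Theta0 * ?R < b / k\<^sup>2 * ?R" by simp
    then have "Theta0 < b / k\<^sup>2" using mult_less_cancel_right_pos[OF pcR_pos[OF b1(2), of "z / k"]] by blast
    then show ?thesis using k by (simp add: less_divide_eq mult.commute)
  qed
  have d2: "deriv (deriv ?m) z > 0"
  proof -
    \<comment> \<open>The second derivative needs mu' on a neighbourhood of z; \<open>dmu\<close>
      gives it wherever mu < k^2, an open condition.\<close>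
    have "eventually (\<lambda>x. ?m x < k\<^sup>2) (nhds z)"
      using eventually_nhds_in_open[OF open_mu_less[OF k], of z] z(1) by simp
    then have "eventually (\<lambda>x. deriv ?m x = dmu k x) (nhds z)"
      by eventually_elim (rule DERIV_imp_deriv[OF mu_deriv[OF k]])
    then have "deriv (deriv ?m) z = deriv (dmu k) z" by (rule deriv_cong_ev) simp
    also have "\<dots> = (1 + 1 / k\<^sup>2) * (- 2 * z) / pcN k (?m z) z"
      by (rule DERIV_imp_deriv[OF dmu_deriv_at_min(2)[OF k z]])
    also have "\<dots> > 0" using zneg pcN_pos[OF k z(1), of z] k
      by (intro divide_pos_pos mult_pos_pos[of "1 + 1 / k\<^sup>2" "- 2 * z"] add_pos_pos) auto
    finally show ?thesis .
  qed
  have dphi: "\<exists>d. (phi (- k\<^sup>2) z has_real_derivative d) (at 0) \<and> d < 0"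
  proof (intro exI conjI)
    let ?N = "pcN k b z"
    have N: "?N > 0" unfolding b_def by (rule pcN_pos[OF k z(1)])
    have g0: "pg l x 0 = pcM l x" if "l < 1" for l x using pf_0[OF that] by (simp add: pg_def)
    \<comment> \<open>\<open>M2\<close>, that is G = 0, makes the one-sided slopes agree.\<close>
    have "(glue k (pf b z) (pf (b / k\<^sup>2) (z / k)) has_real_derivative pcM b z) (at 0)"
      using pf_deriv[OF b1(1), of z 0] pf_deriv[OF b1(2), of "z / k" 0] M2
      by (intro glue_deriv_0[OF k(1)]) (auto simp: g0 b1 pf_0)
    then show "(phi (- k\<^sup>2) z has_real_derivative pcM b z / sqrt ?N) (at 0)"
      unfolding phi_eq[OF k z(1)] b_def by (rule DERIV_cdivide)
    show "pcM b z / sqrt ?N < 0" using M1 N by (simp add: divide_neg_pos)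
  qed
  have "beta a = mu a x \<longleftrightarrow> x = z" for x
    unfolding a bz using uniq[of x] by (auto simp: b_def)
  then show ?thesis
    using lower bT zneg d2 dphi bz unfolding a b_def by auto
qed

end
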